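(* Let $M\subset\mathbb{C}^n$ be a smooth real hypersurface and $p\in M$ a point where the cubic tensor $\tau^3_p$ vanishes. Then there exists a unique tensor $$\tau^4_p\colon\mathbb{C}T_p\times\mathbb{C}T_p\times K^{10}_p\times\overline{K^{10}_p}\to\mathbb{C}Q_p$$ such that for any $(1,0)$ vector fields $\overline{L^1},L^2\in H^{10}$ that are in the Levi kernel up to order $1$ at $p$, any vector fields $L^3,L^4\in\mathbb{C}T$, and any contact form $\theta$, $$\langle\theta_p,\tau^4_p(L^4_p,L^3_p,L^2_p,L^1_p)\rangle=i\,(L^4L^3\langle\theta,[L^2,L^1]\rangle)_p.$$ More generally, this identity still holds whenever both $L^1$ and $L^2$ are in the Levi kernel up to $L^j_p$-order $1$ at $p$, for $j=3,4$.
   Context: Everything is $C^\infty$. $T=TM$; $H\subset T$ is the complex tangent bundle; $Q=T/H$; $\mathbb{C}T,\mathbb{C}H,\mathbb{C}Q$ are complexifications; $\mathbb{C}H=H^{10}\oplus\overline{H^{10}}$ is the decomposition into $(1,0)$ and $(0,1)$ vectors. "$L\in V$" means $L$ is a local section of $V$ near $p$. A contact form is a real $1$-form on $M$ vanishing on $H$; it pairs with $\mathbb{C}Q$ via $\langle\theta,\cdot\rangle$. The Levi form is the bilinear map $\tau^2_p\colon H^{10}_p\times\overline{H^{10}_p}\to\mathbb{C}Q_p$ with $\langle\theta_p,\tau^2_p(L^2_p,L^1_p)\rangle=i\langle\theta,[L^2,L^1]\rangle_p$ for all contact forms $\theta$. Levi kernel: $K^{10}_p=\{v\in H^{10}_p:\tau^2_p(v,\bar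 u)=0\ \forall u\in H^{10}_p\}$. $\tau^3_p\colon\mathbb{C}T_p\times K^{10}_p\times\overline{K^{10}_p}\to\mathbb{C}Q_p$ is the tensor given by $\langle\theta_p,\tau^3_p(L^3_p,L^2_p,L^1_p)\rangle=i(L^3\langle\theta,[L^2,L^1]\rangle)_p$ for contact forms $\theta$, $L^3\in\mathbb{C}T$, $L^2,\overline{L^1}\in H^{10}$ with $L^2_p,\overline{L^1_p}\in K^{10}_p$ (it is well defined). A $(1,0)$ vector field $L$ is in the Levi kernel up to order $1$ at $p$ if for all $L^1\in H^{10}$, $L^2\in\mathbb{C}T$ and all contact forms $\theta$: $\langle\theta,[L^1,\overline L]\rangle_p=(L^2\langle\theta,[L^1,\overline L]\rangle)_p=0$. For fixed $v\in\mathbb{C}T_p$, $L$ is in the Levi kernel up to $v$-order $1$ at $p$ if these equalities hold whenever $L^2_p=v$. A $(0,1)$ vector field $L$ has one of these properties if $\overline L$ does. *)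

theory Defs
  imports "HOL-Analysis.Analysis"
begin

primrec Ck_on :: "nat \<Rightarrow> ('a::real_normed_vector \<Rightarrow> 'b::real_normed_vector) \<Rightarrow> 'a set \<Rightarrow> bool" where
  "Ck_on 0 f U \<longleftrightarrow> continuous_on U f"
| "Ck_on (Suc k) f U \<longleftrightarrow> (\<forall>x\<in>U. f differentiable (at x)) \<and>
     (\<forall>v. Ck_on k (\<lambda>x. frechet_derivative f (at x) v) U)"

text \<open>Used only for open sets in finite-dimensional spaces, where it is the usual notion.\<close>

definition smooth_on_open ::
    "('a::real_normed_vector \<Rightarrow> 'b::real_normed_vector) \<Rightarrow> 'a set \<Rightarrow> bool" where
  "smooth_on_open f U \<longleftrightarrow> open U \<and> (\<forall>k. Ck_on k f U)"

text \<open>Smoothness on an arbitrary subset: local existence of smooth ambient extensions.\<close>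

definition smooth_along ::
    "'a::real_normed_vector set \<Rightarrow> ('a \<Rightarrow> 'b::real_normed_vector) \<Rightarrow> bool" where
  "smooth_along S f \<longleftrightarrow>
     (\<forall>q\<in>S. \<exists>U F. q \<in> U \<and> smooth_on_open F U \<and> (\<forall>x\<in>S \<inter> U. f x = F x))"

definition local_defining_function ::
    "(complex^'n) set \<Rightarrow> (complex^'n) set \<Rightarrow> (complex^'n \<Rightarrow> real) \<Rightarrow> bool" where
  "local_defining_function M U \<rho> \<longleftrightarrow> smooth_on_open \<rho> U \<and> M \<inter> U = {z\<in>U. \<rho> z = 0} \<and>
     (\<forall>z\<in>M \<inter> U. frechet_derivative \<rho> (at z) \<noteq> (\<lambda>v. 0))"

definition smooth_real_hypersurface :: "(complex^'n) set \<Rightarrow> bool" where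
  "smooth_real_hypersurface M \<longleftrightarrow> (\<forall>p\<in>M. \<exists>U \<rho>. p \<in> U \<and> local_defining_function M U \<rho>)"

definition tangent_space :: "(complex^'n) set \<Rightarrow> complex^'n \<Rightarrow> (complex^'n) set" where
  "tangent_space M p = {v. \<forall>U \<rho>. p \<in> U \<and> local_defining_function M U \<rho> \<longrightarrow>
     frechet_derivative \<rho> (at p) v = 0}"

definition J :: "complex^'n \<Rightarrow> complex^'n" where
  "J v = \<i> *s v"

definition complex_tangent_space :: "(complex^'n) set \<Rightarrow> complex^'n \<Rightarrow> (complex^'n) set" where
  "complex_tangent_space M p = {v \<in> tangent_space M p. J v \<in> tangent_space M p}"

text \<open>The pair \<open>(u, v)\<close> stands for the element \<open>u + i v\<close> of the formal complexification
  \<open>\<complex> \<otimes>\<^sub>\<real> \<complex>\<^sup>n\<close>; this \<open>i\<close> (the operation \<open>cscale \<i>\<close>) is not the complex structure \<open>J\<close>.\<close>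

type_synonym 'n cxvec = "(complex^'n) \<times> (complex^'n)"

definition cscale :: "complex \<Rightarrow> 'n cxvec \<Rightarrow> 'n::finite cxvec" where
  "cscale c w = (Re c *\<^sub>R fst w - Im c *\<^sub>R snd w, Re c *\<^sub>R snd w + Im c *\<^sub>R fst w)"

definition cconj :: "'n cxvec \<Rightarrow> 'n::finite cxvec" where
  "cconj w = (fst w, - snd w)"

definition CT :: "(complex^'n) set \<Rightarrow> complex^'n \<Rightarrow> 'n cxvec set" where
  "CT M p = tangent_space M p \<times> tangent_space M p"

definition CH :: "(complex^'n) set \<Rightarrow> complex^'n \<Rightarrow> 'n cxvec set" where
  "CH M p = complex_tangent_space M p \<times> complex_tangent_space M p"

text \<open>The eigenspace for the eigenvalue \<open>i\<close> of the complex-linear extension of \<open>J\<close>.\<close>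

definition H10 :: "(complex^'n) set \<Rightarrow> complex^'n \<Rightarrow> 'n cxvec set" where
  "H10 M p = {w \<in> CH M p. (J (fst w), J (snd w)) = cscale \<i> w}"

definition H01 :: "(complex^'n) set \<Rightarrow> complex^'n \<Rightarrow> 'n cxvec set" where
  "H01 M p = cconj ` H10 M p"

definition CQ_rel :: "(complex^'n) set \<Rightarrow> complex^'n \<Rightarrow> ('n cxvec \<times> 'n cxvec) set" where
  "CQ_rel M p = {(v, w). v \<in> CT M p \<and> w \<in> CT M p \<and> v - w \<in> CH M p}"

definition CQ :: "(complex^'n) set \<Rightarrow> complex^'n \<Rightarrow> 'n cxvec set set" where
  "CQ M p = CT M p // CQ_rel M p"

definition CQ_zero :: "(complex^'n) set \<Rightarrow> complex^'n \<Rightarrow> 'n cxvec set" where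
  "CQ_zero M p = CQ_rel M p `` {0}"

definition CQ_add ::
    "(complex^'n) set \<Rightarrow> complex^'n \<Rightarrow> 'n cxvec set \<Rightarrow> 'n cxvec set \<Rightarrow> 'n cxvec set" where
  "CQ_add M p A B = (\<Union>a\<in>A. \<Union>b\<in>B. CQ_rel M p `` {a + b})"

definition CQ_scale ::
    "(complex^'n) set \<Rightarrow> complex^'n \<Rightarrow> complex \<Rightarrow> 'n cxvec set \<Rightarrow> 'n cxvec set" where
  "CQ_scale M p c A = (\<Union>a\<in>A. CQ_rel M p `` {cscale c a})"

definition local_section ::
    "(complex^'n) set \<Rightarrow> complex^'n \<Rightarrow> (complex^'n \<Rightarrow> 'n cxvec set) \<Rightarrow> (complex^'n \<Rightarrow> 'n cxvec) \<Rightarrow> bool"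
  where
  "local_section M p E L \<longleftrightarrow>
     (\<exists>U. open U \<and> p \<in> U \<and> smooth_along (M \<inter> U) L \<and> (\<forall>q\<in>M \<inter> U. L q \<in> E q))"

text \<open>A real 1-form on \<open>M\<close> is given by a smooth family of covectors \<open>\<theta> q\<close> (\<open>q \<in> M\<close>) of the
  ambient space; only their restrictions to the tangent spaces of \<open>M\<close> are ever used.\<close>

definition contact_form ::
    "(complex^'n) set \<Rightarrow> (complex^'n \<Rightarrow> (complex^'n) \<Rightarrow>\<^sub>L real) \<Rightarrow> bool" where
  "contact_form M \<theta> \<longleftrightarrow> smooth_along M \<theta> \<and>
     (\<forall>q\<in>M. \<forall>v\<in>complex_tangent_space M q. blinfun_apply (\<theta> q) v = 0)"

definition cpair :: "(complex^'n) \<Rightarrow>\<^sub>L real \<Rightarrow> 'n cxvec \<Rightarrow> complex" where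
  "cpair \<alpha> w = complex_of_real (blinfun_apply \<alpha> (fst w)) + \<i> * complex_of_real (blinfun_apply \<alpha> (snd w))"

text \<open>For \<open>\<alpha>\<close> vanishing on \<open>H\<close> the image below is a singleton.\<close>

definition CQ_pair :: "(complex^'n) \<Rightarrow>\<^sub>L real \<Rightarrow> 'n cxvec set \<Rightarrow> complex" where
  "CQ_pair \<alpha> A = the_elem (cpair \<alpha> ` A)"

text \<open>Derivatives of functions on \<open>M\<close> are Frechet derivatives within \<open>M\<close>.  Such a derivative
  is unique only on tangent vectors of \<open>M\<close>, and is only applied to those.\<close>

definition vderiv ::
    "(complex^'n) set \<Rightarrow> (complex^'n \<Rightarrow> 'n cxvec) \<Rightarrow> (complex^'n \<Rightarrow> complex) \<Rightarrow> complex^'n \<Rightarrow> complex"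
  where
  "vderiv M X f q = frechet_derivative f (at q within M) (fst (X q))
     + \<i> * frechet_derivative f (at q within M) (snd (X q))"

definition field_deriv ::
    "(complex^'n) set \<Rightarrow> (complex^'n \<Rightarrow> 'n cxvec) \<Rightarrow> (complex^'n \<Rightarrow> 'n cxvec) \<Rightarrow> complex^'n \<Rightarrow> 'n cxvec"
  where
  "field_deriv M X Y q = frechet_derivative Y (at q within M) (fst (X q))
     + cscale \<i> (frechet_derivative Y (at q within M) (snd (X q)))"

definition bracket ::
    "(complex^'n) set \<Rightarrow> (complex^'n \<Rightarrow> 'n cxvec) \<Rightarrow> (complex^'n \<Rightarrow> 'n cxvec) \<Rightarrow> complex^'n \<Rightarrow> 'n cxvec"
  where
  "bracket M X Y q = field_deriv M X Y q - field_deriv M Y X q"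

definition contact_bracket ::
    "(complex^'n) set \<Rightarrow> (complex^'n \<Rightarrow> (complex^'n) \<Rightarrow>\<^sub>L real) \<Rightarrow>
     (complex^'n \<Rightarrow> 'n cxvec) \<Rightarrow> (complex^'n \<Rightarrow> 'n cxvec) \<Rightarrow> complex^'n \<Rightarrow> complex" where
  "contact_bracket M \<theta> X Y q = cpair (\<theta> q) (bracket M X Y q)"

definition CQ_linear_on ::
    "(complex^'n) set \<Rightarrow> complex^'n \<Rightarrow> 'n cxvec set \<Rightarrow> ('n cxvec \<Rightarrow> 'n cxvec set) \<Rightarrow> bool" where
  "CQ_linear_on M p S f \<longleftrightarrow>
     (\<forall>x\<in>S. \<forall>y\<in>S. f (x + y) = CQ_add M p (f x) (f y)) \<and>
     (\<forall>c. \<forall>x\<in>S. f (cscale c x) = CQ_scale M p c (f x))"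

text \<open>The tensors below are extensional functions (\<open>undefined\<close> outside the stated domain), so that
  equality of functions is equality of tensors.\<close>

definition tensor2 ::
    "(complex^'n) set \<Rightarrow> complex^'n \<Rightarrow> 'n cxvec set \<Rightarrow> 'n cxvec set \<Rightarrow>
     ('n cxvec \<times> 'n cxvec \<Rightarrow> 'n cxvec set) \<Rightarrow> bool" where
  "tensor2 M p A B \<tau> \<longleftrightarrow> \<tau> \<in> (A \<times> B) \<rightarrow>\<^sub>E CQ M p \<and>
     (\<forall>b\<in>B. CQ_linear_on M p A (\<lambda>x. \<tau> (x, b))) \<and>
     (\<forall>a\<in>A. CQ_linear_on M p B (\<lambda>x. \<tau> (a, x)))"

definition tensor3 ::
    "(complex^'n) set \<Rightarrow> complex^'n \<Rightarrow> 'n cxvec set \<Rightarrow> 'n cxvec set \<Rightarrow> 'n cxvec set \<Rightarrow>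
     ('n cxvec \<times> 'n cxvec \<times> 'n cxvec \<Rightarrow> 'n cxvec set) \<Rightarrow> bool" where
  "tensor3 M p A B C \<tau> \<longleftrightarrow> \<tau> \<in> (A \<times> B \<times> C) \<rightarrow>\<^sub>E CQ M p \<and>
     (\<forall>b\<in>B. \<forall>c\<in>C. CQ_linear_on M p A (\<lambda>x. \<tau> (x, b, c))) \<and>
     (\<forall>a\<in>A. \<forall>c\<in>C. CQ_linear_on M p B (\<lambda>x. \<tau> (a, x, c))) \<and>
     (\<forall>a\<in>A. \<forall>b\<in>B. CQ_linear_on M p C (\<lambda>x. \<tau> (a, b, x)))"

definition tensor4 ::
    "(complex^'n) set \<Rightarrow> complex^'n \<Rightarrow> 'n cxvec set \<Rightarrow> 'n cxvec set \<Rightarrow> 'n cxvec set \<Rightarrow> 'n cxvec set \<Rightarrow>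
     ('n cxvec \<times> 'n cxvec \<times> 'n cxvec \<times> 'n cxvec \<Rightarrow> 'n cxvec set) \<Rightarrow> bool" where
  "tensor4 M p A B C D \<tau> \<longleftrightarrow> \<tau> \<in> (A \<times> B \<times> C \<times> D) \<rightarrow>\<^sub>E CQ M p \<and>
     (\<forall>b\<in>B. \<forall>c\<in>C. \<forall>d\<in>D. CQ_linear_on M p A (\<lambda>x. \<tau> (x, b, c, d))) \<and>
     (\<forall>a\<in>A. \<forall>c\<in>C. \<forall>d\<in>D. CQ_linear_on M p B (\<lambda>x. \<tau> (a, x, c, d))) \<and>
     (\<forall>a\<in>A. \<forall>b\<in>B. \<forall>d\<in>D. CQ_linear_on M p C (\<lambda>x. \<tau> (a, b, x, d))) \<and>
     (\<forall>a\<in>A. \<forall>b\<in>B. \<forall>c\<in>C. CQ_linear_on M p D (\<lambda>x. \<tau> (a, b, c, x)))"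

definition levi_form ::
    "(complex^'n) set \<Rightarrow> complex^'n \<Rightarrow> 'n cxvec \<times> 'n cxvec \<Rightarrow> 'n cxvec set" where
  "levi_form M p = (THE \<tau>. tensor2 M p (H10 M p) (H01 M p) \<tau> \<and>
     (\<forall>L2 L1 \<theta>. local_section M p (H10 M) L2 \<and> local_section M p (H01 M) L1 \<and>
        contact_form M \<theta> \<longrightarrow>
        CQ_pair (\<theta> p) (\<tau> (L2 p, L1 p)) = \<i> * contact_bracket M \<theta> L2 L1 p))"

definition K10 :: "(complex^'n) set \<Rightarrow> complex^'n \<Rightarrow> 'n cxvec set" where
  "K10 M p = {v \<in> H10 M p. \<forall>u\<in>H10 M p. levi_form M p (v, cconj u) = CQ_zero M p}"

definition K01 :: "(complex^'n) set \<Rightarrow> complex^'n \<Rightarrow> 'n cxvec set" where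
  "K01 M p = cconj ` K10 M p"

definition cubic_tensor ::
    "(complex^'n) set \<Rightarrow> complex^'n \<Rightarrow> 'n cxvec \<times> 'n cxvec \<times> 'n cxvec \<Rightarrow> 'n cxvec set" where
  "cubic_tensor M p = (THE \<tau>. tensor3 M p (CT M p) (K10 M p) (K01 M p) \<tau> \<and>
     (\<forall>L3 L2 L1 \<theta>. local_section M p (CT M) L3 \<and>
        local_section M p (H10 M) L2 \<and> local_section M p (H10 M) (cconj \<circ> L1) \<and>
        L2 p \<in> K10 M p \<and> cconj (L1 p) \<in> K10 M p \<and> contact_form M \<theta> \<longrightarrow>
        CQ_pair (\<theta> p) (\<tau> (L3 p, L2 p, L1 p)) = \<i> * vderiv M L3 (contact_bracket M \<theta> L2 L1) p))"

text \<open>Both notions are meant for a \<open>(1,0)\<close> field \<open>L\<close>; for a \<open>(0,1)\<close> field they are applied to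
  its conjugate.\<close>

definition levi_kernel_order1 ::
    "(complex^'n) set \<Rightarrow> complex^'n \<Rightarrow> (complex^'n \<Rightarrow> 'n cxvec) \<Rightarrow> bool" where
  "levi_kernel_order1 M p L \<longleftrightarrow>
     (\<forall>L1 L2 \<theta>. local_section M p (H10 M) L1 \<and> local_section M p (CT M) L2 \<and>
        contact_form M \<theta> \<longrightarrow>
        contact_bracket M \<theta> L1 (cconj \<circ> L) p = 0 \<and>
        vderiv M L2 (contact_bracket M \<theta> L1 (cconj \<circ> L)) p = 0)"

definition levi_kernel_vorder1 ::
    "(complex^'n) set \<Rightarrow> complex^'n \<Rightarrow> 'n cxvec \<Rightarrow> (complex^'n \<Rightarrow> 'n cxvec) \<Rightarrow> bool" where
  "levi_kernel_vorder1 M p v L \<longleftrightarrow>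
     (\<forall>L1 L2 \<theta>. local_section M p (H10 M) L1 \<and> local_section M p (CT M) L2 \<and> L2 p = v \<and>
        contact_form M \<theta> \<longrightarrow>
        contact_bracket M \<theta> L1 (cconj \<circ> L) p = 0 \<and>
        vderiv M L2 (contact_bracket M \<theta> L1 (cconj \<circ> L)) p = 0)"

definition quartic_identity ::
    "(complex^'n) set \<Rightarrow> complex^'n \<Rightarrow>
     ('n cxvec \<times> 'n cxvec \<times> 'n cxvec \<times> 'n cxvec \<Rightarrow> 'n cxvec set) \<Rightarrow>
     (complex^'n \<Rightarrow> 'n cxvec) \<Rightarrow> (complex^'n \<Rightarrow> 'n cxvec) \<Rightarrow>
     (complex^'n \<Rightarrow> 'n cxvec) \<Rightarrow> (complex^'n \<Rightarrow> 'n cxvec) \<Rightarrow>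
     (complex^'n \<Rightarrow> (complex^'n) \<Rightarrow>\<^sub>L real) \<Rightarrow> bool" where
  "quartic_identity M p \<tau> L4 L3 L2 L1 \<theta> \<longleftrightarrow>
     CQ_pair (\<theta> p) (\<tau> (L4 p, L3 p, L2 p, L1 p)) =
       \<i> * vderiv M L4 (vderiv M L3 (contact_bracket M \<theta> L2 L1)) p"

definition is_quartic_tensor ::
    "(complex^'n) set \<Rightarrow> complex^'n \<Rightarrow>
     ('n cxvec \<times> 'n cxvec \<times> 'n cxvec \<times> 'n cxvec \<Rightarrow> 'n cxvec set) \<Rightarrow> bool" where
  "is_quartic_tensor M p \<tau> \<longleftrightarrow>
     tensor4 M p (CT M p) (CT M p) (K10 M p) (K01 M p) \<tau> \<and>
     (\<forall>L4 L3 L2 L1 \<theta>.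
        local_section M p (H10 M) (cconj \<circ> L1) \<and> levi_kernel_order1 M p (cconj \<circ> L1) \<and>
        local_section M p (H10 M) L2 \<and> levi_kernel_order1 M p L2 \<and>
        local_section M p (CT M) L3 \<and> local_section M p (CT M) L4 \<and> contact_form M \<theta> \<longrightarrow>
        quartic_identity M p \<tau> L4 L3 L2 L1 \<theta>)"

end

theory Submission
  imports Defs
begin

text \<open>
  Near \<open>p\<close> the hypersurface is given by a defining function \<open>\<rho>\<close>. A vector of type \<open>(1,0)\<close> at \<open>q\<close> has the
  form \<open>(a, - J a)\<close> and a vector of type \<open>(0,1)\<close> the form \<open>(b, J b)\<close>, with \<open>a\<close>, \<open>b\<close> in the complex
  tangent space, which is cut out by \<open>d\<rho>\<close> and \<open>d\<rho> \<circ> J\<close>. Differentiating the equations that place \<open>a\<close> and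
  \<open>b\<close> there removes all derivatives of fields from the bracket: if \<open>\<theta> = c d\<rho> \<circ> J\<close> on tangent vectors,
  then \<open>\<langle>\<theta>, [X, Y]\<rangle> = 2 i c h(a, b)\<close>, where \<open>h\<close> is a hermitian form built from the Hessian of \<open>\<rho>\<close>
  (\<open>contact_bracket_eq\<close>). Composed with the projection to the complex tangent space, \<open>h\<close> is a smooth
  family of forms on the whole ambient space, and everything becomes a statement about the derivatives
  at \<open>p\<close> of functions \<open>h(a, b)\<close>. A field \<open>b\<close> is in the Levi kernel to first order exactly if for each
  constant vector \<open>i\<close> the function \<open>h(i, b)\<close> vanishes at \<open>p\<close> together with the derivatives concerned.

  The quartic tensor is well defined for the following reason. If \<open>z\<close> vanishes at \<open>p\<close>, then expanding
  \<open>z\<close> in a basis writes \<open>h(z, b)\<close> as a sum of products of functions vanishing at \<open>p\<close> with functions \<open>h(i, b)\<close>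
  that vanish to first order, and the Leibniz rule shows that \<open>L4 L3 h(z, b)\<close> vanishes at \<open>p\<close>. Hence
  \<open>L4 L3 h(a, b)\<close> depends only on \<open>a\<close> and \<open>b\<close> at \<open>p\<close>, and one of the arguments may be exchanged after
  the other: the first exchange uses the derivatives of \<open>h(i, b)\<close> along \<open>L3\<close> and \<open>L4\<close> only, and it
  brings in a field \<open>a\<close> that satisfies the condition in all directions, as the second exchange requires
  (\<open>vderiv2_levi_eq_quartic\<close>). This covers the general form of the identity as well. Finally,
  the field \<open>L3\<close> enters only through its value because \<open>h(a, b)\<close> has zero differential at \<open>p\<close>.

  The vanishing of the cubic tensor provides enough fields (\<open>kernel_field_exists\<close>). For \<open>v\<close> in the Levi
  kernel one looks for \<open>b(q) = v + A (q - p)\<close>; the requirement is a linear equation for \<open>A u\<close>, for each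
  tangent vector \<open>u\<close>, with the Levi form at \<open>p\<close> as its operator. By symmetry of the operator it is
  solvable if and only if the right-hand side is orthogonal to the kernel of the operator, and the numbers that
  have to vanish come from values of the cubic tensor. Since such fields exist for all vectors in the Levi
  kernel, multilinearity of the quartic tensor follows from its independence of the fields, and so
  does its uniqueness.

  Two facts underlie the computation. Derivatives within \<open>M\<close> are well defined on tangent vectors, because
  tangent vectors are limits of secants (\<open>secant\<close>). And there is a contact form on all of \<open>M\<close> that does
  not vanish at \<open>p\<close>, even if \<open>M\<close> has no global normal field (\<open>contact_form_global\<close>).
\<close>

section \<open>Closure properties of smooth functions\<close>

lemma Ck_on_cong:
  assumes "open U" "\<And>x. x \<in> U \<Longrightarrow> f x = g x"
  shows "Ck_on k f U \<longleftrightarrow> Ck_on k g U"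
  using assms(2)
proof (induction k arbitrary: f g)
  case 0
  then show ?case by (simp cong: continuous_on_cong)
next
  case (Suc k)
  have tr: "f differentiable at x \<Longrightarrow> g differentiable at x" 
    if "x \<in> U" "\<And>x. x \<in> U \<Longrightarrow> f x = g x" for x and f g :: "'a \<Rightarrow> 'b"
    using that assms(1) unfolding differentiable_def
    by (meson has_derivative_transform_within_open)
  have d: "f differentiable at x \<longleftrightarrow> g differentiable at x" if "x \<in> U" for x
    using tr[of x f g] tr[of x g f] that Suc.prems by metis
  have e: "frechet_derivative f (at x) v = frechet_derivative g (at x) v" if "x \<in> U" for x v
  proof -
    have "(f has_derivative F) (at x) \<longleftrightarrow> (g has_derivative F) (at x)" for F
      using that assms(1) Suc.prems has_derivative_transform_within_open[of f F x UNIV U g]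
        has_derivative_transform_within_open[of g F x UNIV U f] by auto
    then show ?thesis by (simp add: frechet_derivative_def)
  qed
  have "Ck_on k (\<lambda>x. frechet_derivative f (at x) v) U \<longleftrightarrow> Ck_on k (\<lambda>x. frechet_derivative g (at x) v) U" for v
    by (rule Suc.IH) (simp add: e)
  then show ?case using d by simp
qed

lemma Ck_on_mono: "Ck_on k f U \<Longrightarrow> V \<subseteq> U \<Longrightarrow> Ck_on k f V"
  by (induction k arbitrary: f) (auto intro: continuous_on_subset)

lemma Ck_on_lower: "Ck_on (Suc k) f U \<Longrightarrow> Ck_on k f U"
proof (induction k arbitrary: f)
  case 0
  then show ?case
    by (auto intro!: differentiable_imp_continuous_on
        simp: differentiable_on_def differentiable_at_withinI)
next
  case (Suc k)
  then show ?case by (metis Ck_on.simps(2))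
qed

text \<open>The derivative may be replaced by any family \<open>D\<close> of derivatives on the open set, so the closure
  properties below are inductions on \<open>k\<close> in which the rules of calculus supply \<open>D\<close>.\<close>

lemma Ck_on_SucI:
  assumes "open U" "\<And>x. x \<in> U \<Longrightarrow> (f has_derivative D x) (at x)"
    "\<And>v. Ck_on k (\<lambda>x. D x v) U"
  shows "Ck_on (Suc k) f U"
proof -
  have "frechet_derivative f (at x) v = D x v" if "x \<in> U" for x v
    using assms(2)[OF that] frechet_derivative_at by metis
  then have "Ck_on k (\<lambda>x. frechet_derivative f (at x) v) U \<longleftrightarrow> Ck_on k (\<lambda>x. D x v) U" for v
    by (intro Ck_on_cong assms(1))
  then show ?thesis using assms by (auto simp: differentiable_def)
qed

lemma Ck_on_SucD:
  assumes "Ck_on (Suc k) f U" "x \<in> U"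
  shows "(f has_derivative frechet_derivative f (at x)) (at x)"
  using assms by (simp add: frechet_derivative_works)

lemma Ck_on_const: "open U \<Longrightarrow> Ck_on k (\<lambda>x. c) U"
  by (induction k arbitrary: c) (auto)

lemma Ck_on_linear:
  assumes "open U" "bounded_linear L" shows "Ck_on k L U"
proof (cases k)
  case 0
  then show ?thesis using assms by (simp add: linear_continuous_on)
next
  case (Suc m)
  have "(L has_derivative L) (at x)" for x
    using assms(2) by (rule bounded_linear_imp_has_derivative)
  then show ?thesis unfolding Suc by (intro Ck_on_SucI[of _ _ "\<lambda>x. L"] assms Ck_on_const)
qed

lemma Ck_on_linear_comp:
  assumes "open U" "bounded_linear L" "Ck_on k f U" shows "Ck_on k (\<lambda>x. L (f x)) U"
  using assms(3)
proof (induction k arbitrary: f)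
  case 0
  then show ?case using assms by (simp add: bounded_linear.continuous_on)
next
  case (Suc k)
  show ?case
  proof (rule Ck_on_SucI[OF assms(1)])
    show "((\<lambda>x. L (f x)) has_derivative (\<lambda>v. L (frechet_derivative f (at x) v))) (at x)"
      if "x \<in> U" for x
      by (rule bounded_linear.has_derivative[OF assms(2) Ck_on_SucD[OF Suc.prems that]])
  qed (use Suc in auto)
qed

lemma Ck_on_add:
  assumes "open U" "Ck_on k f U" "Ck_on k g U" shows "Ck_on k (\<lambda>x. f x + g x) U"
  using assms(2,3)
proof (induction k arbitrary: f g)
  case 0
  then show ?case by (simp add: continuous_on_add)
next
  case (Suc k)
  show ?case
  proof (rule Ck_on_SucI[OF assms(1)])
    show "((\<lambda>x. f x + g x) has_derivative
        (\<lambda>v. frechet_derivative f (at x) v + frechet_derivative g (at x) v)) (at x)"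
      if "x \<in> U" for x
      by (intro has_derivative_add Ck_on_SucD[OF Suc.prems(1) that] Ck_on_SucD[OF Suc.prems(2) that])
  qed (use Suc in auto)
qed

lemma Ck_on_bilinear:
  assumes "open U" "bounded_bilinear B" "Ck_on k f U" "Ck_on k g U"
  shows "Ck_on k (\<lambda>x. B (f x) (g x)) U"
  using assms(3,4)
proof (induction k arbitrary: f g)
  case 0
  then show ?case by (simp add: bounded_bilinear.continuous_on[OF assms(2)])
next
  case (Suc k)
  show ?case
  proof (rule Ck_on_SucI[OF assms(1)])
    show "((\<lambda>x. B (f x) (g x)) has_derivative
        (\<lambda>v. B (f x) (frechet_derivative g (at x) v) + B (frechet_derivative f (at x) v) (g x))) (at x)"
      if "x \<in> U" for x
      by (intro bounded_bilinear.FDERIV[OF assms(2)] Ck_on_SucD[OF Suc.prems(1) that] Ck_on_SucD[OF Suc.prems(2) that])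
    have "Ck_on k f U" "Ck_on k g U" using Suc.prems Ck_on_lower by auto
    then show "Ck_on k (\<lambda>x. B (f x) (frechet_derivative g (at x) v)
        + B (frechet_derivative f (at x) v) (g x)) U" for v
      using Suc by (intro Ck_on_add assms(1)) auto
  qed
qed

lemma Ck_on_inverse:
  fixes f :: "'a::real_normed_vector \<Rightarrow> real"
  assumes "open U" "Ck_on k f U" "\<And>x. x \<in> U \<Longrightarrow> f x \<noteq> 0"
  shows "Ck_on k (\<lambda>x. inverse (f x)) U"
  using assms(2)
proof (induction k)
  case 0
  then show ?case using assms(3) by (simp add: continuous_on_inverse)
next
  case (Suc k)
  have I: "Ck_on k (\<lambda>x. inverse (f x)) U" using Suc Ck_on_lower by blast
  have bl: "bounded_linear (uminus :: real \<Rightarrow> real)"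
    by (intro bounded_linear_minus bounded_linear_ident)
  show ?case
  proof (rule Ck_on_SucI[OF assms(1)])
    show "((\<lambda>x. inverse (f x)) has_derivative
        (\<lambda>v. - (inverse (f x) * frechet_derivative f (at x) v * inverse (f x)))) (at x)"
      if "x \<in> U" for x
      by (rule Deriv.has_derivative_inverse) (use that assms(3) Ck_on_SucD[OF Suc.prems that] in auto)
    show "Ck_on k (\<lambda>x. - (inverse (f x) * frechet_derivative f (at x) v * inverse (f x))) U" for v
      using Suc.prems by (intro Ck_on_linear_comp[OF assms(1) bl]
          Ck_on_bilinear[OF assms(1) bounded_bilinear_mult] I) auto
  qed
qed

subsection \<open>Germs of smooth functions on a subset\<close>

text \<open>The notion at one point behind \<open>smooth_along\<close>. Fields, forms and functions on the hypersurface are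
  handled as germs of this kind, so that only local arguments occur.\<close>

definition smooth_near ::
    "'a::real_normed_vector set \<Rightarrow> 'a \<Rightarrow> ('a \<Rightarrow> 'b::real_normed_vector) \<Rightarrow> bool" where
  "smooth_near S q f \<longleftrightarrow> (\<exists>U F. q \<in> U \<and> smooth_on_open F U \<and> (\<forall>x\<in>S \<inter> U. f x = F x))"

lemma smooth_along_iff: "smooth_along S f \<longleftrightarrow> (\<forall>q\<in>S. smooth_near S q f)"
  by (simp add: smooth_along_def smooth_near_def)

abbreviation near_in :: "'a::topological_space set \<Rightarrow> 'a \<Rightarrow> 'a filter" where
  "near_in S q \<equiv> inf (nhds q) (principal S)"

lemma eventually_near_in:
  "eventually P (near_in S q) \<longleftrightarrow> (\<exists>U. open U \<and> q \<in> U \<and> (\<forall>x\<in>S \<inter> U. P x))"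
  by (auto simp: eventually_inf_principal eventually_nhds)

lemma eventually_near_in_self: "eventually P (near_in S q) \<Longrightarrow> q \<in> S \<Longrightarrow> P q"
  by (auto simp: eventually_near_in)

lemma eventually_near_in_mem: "eventually (\<lambda>x. x \<in> S) (near_in S q)"
  by (auto simp: eventually_near_in)

lemma eventually_eventually_near_in:
  "eventually P (near_in S q) \<Longrightarrow> eventually (\<lambda>x. eventually P (near_in S x)) (near_in S q)"
  unfolding eventually_near_in by blast

lemma smooth_near_E:
  assumes "smooth_near S q f"
  obtains U F where "open U" "q \<in> U" "\<And>k. Ck_on k F U" "\<And>x. x \<in> S \<Longrightarrow> x \<in> U \<Longrightarrow> f x = F x"
  using assms by (auto simp: smooth_near_def smooth_on_open_def)

lemma smooth_near_I:
  assumes "open U" "q \<in> U" "\<And>k. Ck_on k F U" "\<And>x. x \<in> S \<Longrightarrow> x \<in> U \<Longrightarrow> f x = F x"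
  shows "smooth_near S q f"
  using assms by (auto simp: smooth_near_def smooth_on_open_def)

lemma smooth_near_eventually:
  "smooth_near S q f \<Longrightarrow> eventually (\<lambda>x. smooth_near S x f) (near_in S q)"
  by (auto simp: eventually_near_in smooth_near_def smooth_on_open_def)

lemma smooth_near_cong_ev:
  assumes "smooth_near S q f" "eventually (\<lambda>x. f x = g x) (near_in S q)"
  shows "smooth_near S q g"
proof -
  obtain U F where U: "open U" "q \<in> U" "\<And>k. Ck_on k F U" "\<And>x. x \<in> S \<Longrightarrow> x \<in> U \<Longrightarrow> f x = F x"
    using assms(1) smooth_near_E by metis
  obtain V where V: "open V" "q \<in> V" "\<forall>x\<in>S \<inter> V. f x = g x"
    using assms(2) by (auto simp: eventually_near_in)
  show ?thesis
    by (rule smooth_near_I[of "U \<inter> V" _ F]) (use U V Ck_on_mono[of _ F U "U \<inter> V"] in force)+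
qed

lemma smooth_near_Int_open:
  "open V \<Longrightarrow> q \<in> V \<Longrightarrow> smooth_near (S \<inter> V) q f \<longleftrightarrow> smooth_near S q f"
proof
  assume V: "open V" "q \<in> V" and s: "smooth_near (S \<inter> V) q f"
  obtain U F where U: "open U" "q \<in> U" "\<And>k. Ck_on k F U" "\<And>x. x \<in> S \<inter> V \<Longrightarrow> x \<in> U \<Longrightarrow> f x = F x"
    using s smooth_near_E by metis
  show "smooth_near S q f"
    by (rule smooth_near_I[of "U \<inter> V" _ F]) (use U V Ck_on_mono[of _ F U "U \<inter> V"] in force)+
qed (auto simp: smooth_near_def)

lemma smooth_near_const [simp]: "smooth_near S q (\<lambda>x. c)"
  by (rule smooth_near_I[of UNIV _ "\<lambda>x. c"]) (auto intro: Ck_on_const)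

lemma smooth_near_linear: "bounded_linear L \<Longrightarrow> smooth_near S q L"
  by (rule smooth_near_I[of UNIV _ L]) (auto intro: Ck_on_linear)

lemma smooth_near_linear_comp:
  assumes "bounded_linear L" "smooth_near S q f"
  shows "smooth_near S q (\<lambda>x. L (f x))"
proof -
  obtain U F where U: "open U" "q \<in> U" "\<And>k. Ck_on k F U" "\<And>x. x \<in> S \<Longrightarrow> x \<in> U \<Longrightarrow> f x = F x"
    using assms(2) smooth_near_E by metis
  show ?thesis
    by (rule smooth_near_I[OF U(1,2) Ck_on_linear_comp[OF U(1) assms(1) U(3)]]) (simp add: U(4))
qed

lemma smooth_near_bilinear:
  assumes "bounded_bilinear B" "smooth_near S q f" "smooth_near S q g"
  shows "smooth_near S q (\<lambda>x. B (f x) (g x))"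
proof -
  obtain U F where U: "open U" "q \<in> U" "\<And>k. Ck_on k F U" "\<And>x. x \<in> S \<Longrightarrow> x \<in> U \<Longrightarrow> f x = F x"
    using assms(2) smooth_near_E by metis
  obtain V G where V: "open V" "q \<in> V" "\<And>k. Ck_on k G V" "\<And>x. x \<in> S \<Longrightarrow> x \<in> V \<Longrightarrow> g x = G x"
    using assms(3) smooth_near_E by metis
  have UV: "open (U \<inter> V)" "q \<in> U \<inter> V" "Ck_on k F (U \<inter> V)" "Ck_on k G (U \<inter> V)" for k
    using U V by (auto intro: Ck_on_mono)
  show ?thesis
    by (rule smooth_near_I[OF UV(1,2) Ck_on_bilinear[OF UV(1) assms(1) UV(3,4)]]) (simp add: U(4) V(4))
qed

lemma smooth_near_add:
  assumes "smooth_near S q f" "smooth_near S q g"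
  shows "smooth_near S q (\<lambda>x. f x + g x)"
proof -
  obtain U F where U: "open U" "q \<in> U" "\<And>k. Ck_on k F U" "\<And>x. x \<in> S \<Longrightarrow> x \<in> U \<Longrightarrow> f x = F x"
    using assms(1) smooth_near_E by metis
  obtain V G where V: "open V" "q \<in> V" "\<And>k. Ck_on k G V" "\<And>x. x \<in> S \<Longrightarrow> x \<in> V \<Longrightarrow> g x = G x"
    using assms(2) smooth_near_E by metis
  have UV: "open (U \<inter> V)" "q \<in> U \<inter> V" "Ck_on k F (U \<inter> V)" "Ck_on k G (U \<inter> V)" for k
    using U V by (auto intro: Ck_on_mono)
  show ?thesis
    by (rule smooth_near_I[OF UV(1,2) Ck_on_add[OF UV(1) UV(3,4)]]) (simp add: U(4) V(4))
qed

lemma smooth_near_inverse: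
  fixes f :: "'a::real_normed_vector \<Rightarrow> real"
  assumes "smooth_near S q f" "q \<in> S" "f q \<noteq> 0"
  shows "smooth_near S q (\<lambda>x. inverse (f x))"
proof -
  obtain U F where U: "open U" "q \<in> U" "\<And>k. Ck_on k F U" "\<And>x. x \<in> S \<Longrightarrow> x \<in> U \<Longrightarrow> f x = F x"
    using assms(1) smooth_near_E by metis
  have "continuous_on U F" using U(3)[of 0] by simp
  then have o: "open {x \<in> U. F x \<noteq> 0}"
    using continuous_open_preimage[OF _ U(1), of F "- {0}"] by (simp add: vimage_def Int_def open_Compl)
  show ?thesis
  proof (rule smooth_near_I[OF o])
    have "Ck_on k F {x \<in> U. F x \<noteq> 0}" for k
      by (rule Ck_on_mono[OF U(3)]) auto
    then show "Ck_on k (\<lambda>x. inverse (F x)) {x \<in> U. F x \<noteq> 0}" for k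
      by (intro Ck_on_inverse[OF o]) auto
  qed (use U assms in auto)
qed

lemmas smooth_near_scaleR = smooth_near_bilinear[OF bounded_bilinear_scaleR]
lemmas smooth_near_mult = smooth_near_bilinear[OF bounded_bilinear_mult]
lemmas smooth_near_inner = smooth_near_bilinear[OF bounded_bilinear_inner]

lemma smooth_near_minus: "smooth_near S q f \<Longrightarrow> smooth_near S q (\<lambda>x. - f x)"
  by (rule smooth_near_linear_comp[OF bounded_linear_minus[OF bounded_linear_ident]])

lemma smooth_near_diff:
  "smooth_near S q f \<Longrightarrow> smooth_near S q g \<Longrightarrow> smooth_near S q (\<lambda>x. f x - g x)"
  using smooth_near_add[of S q f "\<lambda>x. - g x"] smooth_near_minus[of S q g] by simp

lemma smooth_near_sum:
  "(\<And>i. i \<in> I \<Longrightarrow> smooth_near S q (f i)) \<Longrightarrow> smooth_near S q (\<lambda>x. \<Sum>i\<in>I. f i x)"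
  by (induction I rule: infinite_finite_induct) (auto intro: smooth_near_add)

lemma smooth_near_divide:
  fixes f g :: "'a::real_normed_vector \<Rightarrow> real"
  assumes "smooth_near S q f" "smooth_near S q g" "q \<in> S" "g q \<noteq> 0"
  shows "smooth_near S q (\<lambda>x. f x / g x)"
  using smooth_near_mult[OF assms(1) smooth_near_inverse[OF assms(2,3,4)]]
  by (simp add: divide_inverse)

lemma smooth_near_Pair:
  assumes "smooth_near S q f" "smooth_near S q g"
  shows "smooth_near S q (\<lambda>x. (f x, g x))"
proof -
  have "bounded_linear (\<lambda>a. (a, 0 :: 'c))" "bounded_linear (\<lambda>b. (0 :: 'b, b))"
    by (intro bounded_linear_Pair bounded_linear_ident bounded_linear_zero)+
  then have "smooth_near S q (\<lambda>x. (f x, 0) + (0, g x))"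
    by (intro smooth_near_add smooth_near_linear_comp[OF _ assms(1)] smooth_near_linear_comp[OF _ assms(2)]) 
  then show ?thesis by simp
qed

subsection \<open>Symmetry of second derivatives\<close>

text \<open>The classical argument for the symmetry of second derivatives: two applications of the mean value
  theorem express the second difference of \<open>F\<close> over the parallelogram with sides \<open>h u\<close>, \<open>h w\<close> through a
  mixed derivative at a nearby point. The left-hand side is symmetric in \<open>u\<close> and \<open>w\<close>.\<close>

lemma second_difference_mean_value:
  fixes F :: "'a::real_normed_vector \<Rightarrow> real"
  assumes "0 < h"
    and dF: "\<And>s t. 0 \<le> s \<Longrightarrow> s \<le> h \<Longrightarrow> 0 \<le> t \<Longrightarrow> t \<le> h \<Longrightarrow>
      (F has_derivative F' (q + s *\<^sub>R u + t *\<^sub>R w)) (at (q + s *\<^sub>R u + t *\<^sub>R w))"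
    and dG: "\<And>s t. 0 \<le> s \<Longrightarrow> s \<le> h \<Longrightarrow> 0 \<le> t \<Longrightarrow> t \<le> h \<Longrightarrow>
      ((\<lambda>x. F' x u) has_derivative G' (q + s *\<^sub>R u + t *\<^sub>R w)) (at (q + s *\<^sub>R u + t *\<^sub>R w))"
  obtains s t where "0 < s" "s < h" "0 < t" "t < h"
    "F (q + h *\<^sub>R u + h *\<^sub>R w) - F (q + h *\<^sub>R u) - F (q + h *\<^sub>R w) + F q
      = h * h * G' (q + s *\<^sub>R u + t *\<^sub>R w) w"
proof -
  define \<phi> where "\<phi> s = F (q + s *\<^sub>R u + h *\<^sub>R w) - F (q + s *\<^sub>R u + 0 *\<^sub>R w)" for s
  have sc: "F' (q + s *\<^sub>R u + t *\<^sub>R w) (d *\<^sub>R u) = d * F' (q + s *\<^sub>R u + t *\<^sub>R w) u"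
    "G' (q + s *\<^sub>R u + t *\<^sub>R w) (d *\<^sub>R w) = d * G' (q + s *\<^sub>R u + t *\<^sub>R w) w"
    if "0 \<le> s" "s \<le> h" "0 \<le> t" "t \<le> h" for s t d
  proof -
    have l: "linear (F' (q + s *\<^sub>R u + t *\<^sub>R w))" "linear (G' (q + s *\<^sub>R u + t *\<^sub>R w))"
      using has_derivative_linear dF[OF that] dG[OF that] by blast+
    show "F' (q + s *\<^sub>R u + t *\<^sub>R w) (d *\<^sub>R u) = d * F' (q + s *\<^sub>R u + t *\<^sub>R w) u"
      "G' (q + s *\<^sub>R u + t *\<^sub>R w) (d *\<^sub>R w) = d * G' (q + s *\<^sub>R u + t *\<^sub>R w) w"
      by (simp_all only: linear_scale[OF l(1)] linear_scale[OF l(2)] real_scaleR_def)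
  qed
  have D1: "((\<lambda>s. F (q + s *\<^sub>R u + t *\<^sub>R w)) has_real_derivative F' (q + s *\<^sub>R u + t *\<^sub>R w) u) (at s)"
    if "0 \<le> s" "s \<le> h" "0 \<le> t" "t \<le> h" for s t
  proof -
    have "((\<lambda>s. q + s *\<^sub>R u + t *\<^sub>R w) has_derivative (\<lambda>d. d *\<^sub>R u)) (at s)"
      by (auto intro!: derivative_eq_intros)
    from diff_chain_at[OF this dF[OF that]] show ?thesis
      using sc[OF that] by (simp add: has_field_derivative_def o_def mult_commute_abs)
  qed
  have "(\<phi> has_real_derivative (F' (q + s *\<^sub>R u + h *\<^sub>R w) u - F' (q + s *\<^sub>R u + 0 *\<^sub>R w) u)) (at s)"
    if "0 \<le> s" "s \<le> h" for s
    unfolding \<phi>_def using that assms(1) by (intro DERIV_diff D1) auto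
  from MVT2[OF assms(1) this] obtain s where s: "0 < s" "s < h"
    "\<phi> h - \<phi> 0 = h * (F' (q + s *\<^sub>R u + h *\<^sub>R w) u - F' (q + s *\<^sub>R u + 0 *\<^sub>R w) u)" by auto
  have "((\<lambda>t. F' (q + s *\<^sub>R u + t *\<^sub>R w) u) has_real_derivative G' (q + s *\<^sub>R u + t *\<^sub>R w) w) (at t)"
    if "0 \<le> t" "t \<le> h" for t
  proof -
    have st: "0 \<le> s" "s \<le> h" using s by auto
    have "((\<lambda>t. q + s *\<^sub>R u + t *\<^sub>R w) has_derivative (\<lambda>d. d *\<^sub>R w)) (at t)"
      by (auto intro!: derivative_eq_intros)
    from diff_chain_at[OF this dG[OF st that]] show ?thesis
      using sc[OF st that] by (simp add: has_field_derivative_def o_def mult_commute_abs)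
  qed
  from MVT2[OF assms(1) this] obtain t where t: "0 < t" "t < h"
    "F' (q + s *\<^sub>R u + h *\<^sub>R w) u - F' (q + s *\<^sub>R u + 0 *\<^sub>R w) u = h * G' (q + s *\<^sub>R u + t *\<^sub>R w) w" by auto
  show ?thesis
    by (rule that[OF s(1,2) t(1,2)]) (use s(3) t(3) in \<open>simp add: \<phi>_def algebra_simps\<close>)
qed

lemma second_derivative_symmetric:
  fixes F :: "'a::real_normed_vector \<Rightarrow> real"
  assumes U: "open U" "q \<in> U" and F: "Ck_on 2 F U"
  shows "frechet_derivative (\<lambda>x. frechet_derivative F (at x) u) (at q) w
       = frechet_derivative (\<lambda>x. frechet_derivative F (at x) w) (at q) u"
proof -
  define H where "H u w x = frechet_derivative (\<lambda>x. frechet_derivative F (at x) u) (at x) w" for u w x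
  have F2: "Ck_on (Suc (Suc 0)) F U" using F by (simp add: numeral_2_eq_2)
  have dF: "(F has_derivative frechet_derivative F (at x)) (at x)" if "x \<in> U" for x
    using Ck_on_SucD[OF F2 that] .
  have dG: "((\<lambda>x. frechet_derivative F (at x) u) has_derivative (\<lambda>w. H u w x)) (at x)" if "x \<in> U" for x u
    using F2 that unfolding H_def Ck_on.simps by (simp add: frechet_derivative_works[symmetric])
  have cont: "isCont (H u w) q" for u w
    using F2 U unfolding H_def Ck_on.simps by (metis continuous_on_eq_continuous_at)
  obtain r where r: "r > 0" "ball q r \<subseteq> U" using U openE by blast
  define K where "K = norm u + norm w + 1"
  have K: "K > 0" unfolding K_def by (smt (verit) norm_ge_zero)
  have "\<bar>H u w q - H w u q\<bar> \<le> 2 * e" if e: "e > 0" for e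
  proof -
    obtain d1 where d1: "d1 > 0" "\<And>x. dist x q < d1 \<Longrightarrow> \<bar>H u w x - H u w q\<bar> < e"
      using cont[of u w] e unfolding continuous_at_eps_delta by (auto simp: dist_real_def)
    obtain d2 where d2: "d2 > 0" "\<And>x. dist x q < d2 \<Longrightarrow> \<bar>H w u x - H w u q\<bar> < e"
      using cont[of w u] e unfolding continuous_at_eps_delta by (auto simp: dist_real_def)
    define d where "d = min r (min d1 d2)"
    define h where "h = d / (2 * K)"
    have d0: "d > 0" using r d1 d2 by (simp add: d_def)
    have h: "h > 0" using d0 K by (simp add: h_def)
    have small: "dist (q + s *\<^sub>R u' + t *\<^sub>R w') q < d"
      if "0 \<le> s" "s \<le> h" "0 \<le> t" "t \<le> h" "norm u' + norm w' + 1 = K" for s t u' w'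
    proof -
      have "dist (q + s *\<^sub>R u' + t *\<^sub>R w') q = norm (s *\<^sub>R u' + t *\<^sub>R w')"
        by (metis add.commute add_diff_cancel_left' dist_norm add.assoc)
      also have "\<dots> \<le> s * norm u' + t * norm w'"
        using that by (intro order.trans[OF norm_triangle_ineq]) auto
      also have "\<dots> \<le> h * norm u' + h * norm w'"
        using that by (intro add_mono mult_right_mono) auto
      also have "\<dots> \<le> h * K" using h that(5) by (simp add: algebra_simps flip: that(5))
      also have "\<dots> = d / 2" using K by (simp add: h_def)
      finally show ?thesis using d0 by simp
    qed
    have inU: "q + s *\<^sub>R u' + t *\<^sub>R w' \<in> U"
      if "0 \<le> s" "s \<le> h" "0 \<le> t" "t \<le> h" "norm u' + norm w' + 1 = K" for s t u' w'
      using small[OF that] r by (auto simp: d_def dist_commute subset_iff)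
    have K1: "norm u + norm w + 1 = K" and K2: "norm w + norm u + 1 = K" by (auto simp: K_def)
    obtain s t where st: "0 < s" "s < h" "0 < t" "t < h"
      "F (q + h *\<^sub>R u + h *\<^sub>R w) - F (q + h *\<^sub>R u) - F (q + h *\<^sub>R w) + F q = h * h * H u w (q + s *\<^sub>R u + t *\<^sub>R w)"
      by (rule second_difference_mean_value[OF h dF dG]) (use inU K1 in auto)
    obtain s' t' where st': "0 < s'" "s' < h" "0 < t'" "t' < h"
      "F (q + h *\<^sub>R w + h *\<^sub>R u) - F (q + h *\<^sub>R w) - F (q + h *\<^sub>R u) + F q = h * h * H w u (q + s' *\<^sub>R w + t' *\<^sub>R u)"
      by (rule second_difference_mean_value[OF h dF dG]) (use inU K2 in auto)
    have "h * h * H u w (q + s *\<^sub>R u + t *\<^sub>R w) = h * h * H w u (q + s' *\<^sub>R w + t' *\<^sub>R u)"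
      using st(5) st'(5) by (simp add: algebra_simps)
    then have eq: "H u w (q + s *\<^sub>R u + t *\<^sub>R w) = H w u (q + s' *\<^sub>R w + t' *\<^sub>R u)"
      using h by simp
    have "\<bar>H u w (q + s *\<^sub>R u + t *\<^sub>R w) - H u w q\<bar> < e"
      by (rule d1(2)) (use small[of s t u w] st K1 in \<open>auto simp: d_def\<close>)
    moreover have "\<bar>H w u (q + s' *\<^sub>R w + t' *\<^sub>R u) - H w u q\<bar> < e"
      by (rule d2(2)) (use small[of s' t' w u] st' K2 in \<open>auto simp: d_def\<close>)
    ultimately show ?thesis using eq by linarith
  qed
  from this[of "\<bar>H u w q - H w u q\<bar> / 4"] have "\<bar>H u w q - H w u q\<bar> = 0"
    by (cases "H u w q = H w u q") auto
  then show ?thesis by (simp add: H_def)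
qed

section \<open>Tangent spaces and derivatives along a hypersurface\<close>

lemma has_derivative_within_transform:
  assumes "(f has_derivative A) (at q within M)" "eventually (\<lambda>x. f x = g x) (near_in M q)" "q \<in> M"
  shows "(g has_derivative A) (at q within M)"
proof -
  obtain V where V: "open V" "q \<in> V" "\<forall>x\<in>M \<inter> V. f x = g x"
    using assms(2) by (auto simp: eventually_near_in)
  obtain d where d: "d > 0" "ball q d \<subseteq> V" using V openE by blast
  show ?thesis
    by (rule has_derivative_transform_within[OF assms(1) d(1) assms(3)])
      (use V d in \<open>auto simp: subset_iff dist_commute\<close>)
qed

locale hypersurface_chart =
  fixes M U :: "(complex^'n) set" and \<rho> :: "complex^'n \<Rightarrow> real"
  assumes chart: "local_defining_function M U \<rho>"
begin

definition d\<rho> :: "complex^'n \<Rightarrow> complex^'n \<Rightarrow> real" where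
  "d\<rho> q v = frechet_derivative \<rho> (at q) v"

lemma open_U: "open U" and Ck_\<rho>: "Ck_on k \<rho> U"
  using chart by (auto simp: local_defining_function_def smooth_on_open_def)

lemma M_iff: "z \<in> U \<Longrightarrow> z \<in> M \<longleftrightarrow> \<rho> z = 0"
  using chart by (auto simp: local_defining_function_def)

lemma d\<rho>: "q \<in> U \<Longrightarrow> (\<rho> has_derivative d\<rho> q) (at q)"
  unfolding d\<rho>_def[abs_def] by (rule Ck_on_SucD[OF Ck_\<rho>])

lemma linear_d\<rho>: "q \<in> U \<Longrightarrow> linear (d\<rho> q)"
  using d\<rho> has_derivative_linear by blast

lemma d\<rho>_nonzero: "q \<in> M \<Longrightarrow> q \<in> U \<Longrightarrow> \<exists>v. d\<rho> q v > 0"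
proof -
  assume q: "q \<in> M" "q \<in> U"
  then obtain v where "d\<rho> q v \<noteq> 0"
    using chart by (force simp: local_defining_function_def d\<rho>_def)
  then show ?thesis using linear_neg[OF linear_d\<rho>[OF q(2)], of v]
    by (metis neg_0_less_iff_less linorder_neqE_linordered_idom)
qed

text \<open>Moving along a vector \<open>n\<close> transversal to the hypersurface changes the sign of the defining function
  near \<open>q + t v\<close>, so the intermediate value theorem yields a point of \<open>M\<close> within distance \<open>e t\<close>. Thus
  every vector annihilated by the differential is a limit of secant directions.\<close>

lemma secant:
  assumes q: "q \<in> M" "q \<in> U" and v: "d\<rho> q v = 0" and e: "e > 0"
  shows "\<exists>d>0. \<forall>t. 0 < t \<and> t < d \<longrightarrow> (\<exists>y\<in>M. norm (y - q - t *\<^sub>R v) \<le> e * t)"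
proof -
  obtain n0 where n0: "d\<rho> q n0 > 0" using d\<rho>_nonzero q by blast
  note lin = linear_d\<rho>[OF q(2)]
  have n0z: "norm n0 > 0" using n0 linear_0[OF lin] by force
  define n where "n = n0 /\<^sub>R norm n0"
  define m where "m = d\<rho> q n"
  have m: "m > 0" using n0 n0z by (simp add: m_def n_def linear_scale[OF lin])
  have n1: "norm n = 1" using n0z by (simp add: n_def)
  define L where "L = norm v + e + 1"
  have L: "L > 0" using e by (simp add: L_def add_nonneg_pos add_pos_pos pos_add_strict)
  \<comment> \<open>Small enough that the error of the linear approximation is at most half of its value \<open>e t m\<close> on the
    relevant scale; \<open>L t\<close> bounds the distance from \<open>q\<close>.\<close>
  define \<eta> where "\<eta> = e * m / (2 * L)"
  have \<eta>: "\<eta> > 0" using e m L by (simp add: \<eta>_def)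
  obtain d1 where d1: "d1 > 0" "\<And>y. norm (y - q) < d1 \<Longrightarrow> \<bar>\<rho> y - \<rho> q - d\<rho> q (y - q)\<bar> \<le> \<eta> * norm (y - q)"
    using d\<rho>[OF q(2)] \<eta> unfolding has_derivative_at_alt by (metis real_norm_def)
  obtain d2 where d2: "d2 > 0" "ball q d2 \<subseteq> U" using open_U q openE by blast
  define d where "d = min d1 d2 / L"
  have "\<exists>y\<in>M. norm (y - q - t *\<^sub>R v) \<le> e * t" if t: "0 < t" "t < d" for t
  proof -
    define y where "y s = q + t *\<^sub>R v + s *\<^sub>R n" for s
    have tL: "t * L < min d1 d2" using t(2) L by (simp add: d_def pos_less_divide_eq)
    have ny: "norm (y s - q) \<le> t * L" if "\<bar>s\<bar> \<le> e * t" for s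
    proof -
      have "norm (y s - q) = norm (t *\<^sub>R v + s *\<^sub>R n)"
        by (simp add: y_def algebra_simps)
      also have "\<dots> \<le> t * norm v + \<bar>s\<bar> * norm n"
        using t norm_triangle_ineq[of "t *\<^sub>R v" "s *\<^sub>R n"] by simp
      also have "\<dots> \<le> t * norm v + e * t" using that n1 by simp
      also have "\<dots> \<le> t * L" using t by (simp add: L_def algebra_simps)
      finally show ?thesis .
    qed
    have yU: "y s \<in> U" if "\<bar>s\<bar> \<le> e * t" for s
      using ny[OF that] tL d2(2) by (auto simp: subset_iff dist_norm norm_minus_commute)
    have dy: "d\<rho> q (y s - q) = s * m" for s
      by (simp add: y_def linear_add[OF lin] linear_scale[OF lin] v m_def)
    have est: "\<bar>\<rho> (y s) - s * m\<bar> \<le> e * t * m / 2" if s: "\<bar>s\<bar> \<le> e * t" for s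
    proof -
      have "\<bar>\<rho> (y s) - \<rho> q - d\<rho> q (y s - q)\<bar> \<le> \<eta> * norm (y s - q)"
        by (rule d1(2)) (use ny[OF s] tL in linarith)
      also have "\<dots> \<le> \<eta> * (t * L)" using ny[OF s] \<eta> by simp
      also have "\<dots> = e * t * m / 2" using L by (simp add: \<eta>_def)
      finally show ?thesis using q M_iff dy by simp
    qed
    have etm: "e * t * m > 0" using e t m by simp
    have et: "e * t > 0" using e t by simp
    have "\<bar>\<rho> (y (- (e * t))) - (- (e * t)) * m\<bar> \<le> e * t * m / 2" using et by (intro est) simp
    from abs_le_D1[OF this] have "\<rho> (y (- (e * t))) \<le> 0" using etm unfolding mult_minus_left by linarith
    moreover have "\<bar>\<rho> (y (e * t)) - e * t * m\<bar> \<le> e * t * m / 2" using et by (intro est) simp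
    from abs_le_D2[OF this] have "0 \<le> \<rho> (y (e * t))" using etm by linarith
    moreover have "continuous_on {- (e * t)..e * t} (\<lambda>s. \<rho> (y s))"
    proof (rule continuous_on_compose2[of U \<rho>])
      show "continuous_on U \<rho>" using Ck_\<rho>[of 0] by simp
      show "continuous_on {- (e * t)..e * t} y" unfolding y_def by (intro continuous_intros)
    qed (use yU in auto)
    ultimately obtain s where s: "- (e * t) \<le> s" "s \<le> e * t" "\<rho> (y s) = 0"
      using IVT'[of "\<lambda>s. \<rho> (y s)" "- (e * t)" 0 "e * t"] et by auto
    then have "y s \<in> M" using yU M_iff by (auto simp: abs_le_iff)
    moreover have "norm (y s - q - t *\<^sub>R v) \<le> e * t" using s n1 by (simp add: y_def abs_le_iff)
    ultimately show ?thesis by blast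
  qed
  moreover have "d > 0" using d1 d2 L by (simp add: d_def)
  ultimately show ?thesis by blast
qed

text \<open>A derivative within \<open>M\<close> is determined on limits of secant directions. This makes the derivatives
  within \<open>M\<close> that occur in brackets and in \<open>vderiv\<close> well defined on tangent vectors.\<close>

lemma derivative_within_unique:
  fixes f :: "complex^'n \<Rightarrow> 'b::real_normed_vector"
  assumes q: "q \<in> M" "q \<in> U" and v: "d\<rho> q v = 0"
    and A: "(f has_derivative A) (at q within M)" and B: "(f has_derivative B) (at q within M)"
  shows "A v = B v"
proof -
  define D where "D x = A x - B x" for x
  have "((\<lambda>x. f x - f x) has_derivative D) (at q within M)"
    unfolding D_def by (intro has_derivative_diff A B)
  then have D: "((\<lambda>x. 0 :: 'b) has_derivative D) (at q within M)" by simp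
  obtain C where C: "C > 0" "\<And>x. norm (D x) \<le> norm x * C"
    using bounded_linear.pos_bounded[OF has_derivative_bounded_linear[OF D]] by blast
  have lin: "linear D" using D has_derivative_linear by blast
  have "norm (D v) \<le> e * (norm v + e + C)" if e: "e > 0" for e
  proof -
    obtain d1 where d1: "d1 > 0" "\<And>y. y \<in> M \<Longrightarrow> norm (y - q) < d1 \<Longrightarrow> norm (D (y - q)) \<le> e * norm (y - q)"
      using D e unfolding has_derivative_within_alt by fastforce
    obtain d2 where d2: "d2 > 0" "\<And>t. 0 < t \<Longrightarrow> t < d2 \<Longrightarrow> \<exists>y\<in>M. norm (y - q - t *\<^sub>R v) \<le> e * t"
      using secant[OF q v e] by blast
    define K where "K = norm v + e + 1"
    have K: "K > 0" using e by (simp add: K_def add_nonneg_pos add_pos_pos pos_add_strict)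
    define t where "t = min d2 (d1 / K) / 2"
    have t: "0 < t" "t < d2" "t * K < d1"
      using d1 d2 K by (auto simp: t_def min_def field_simps)
    obtain y where y: "y \<in> M" "norm (y - q - t *\<^sub>R v) \<le> e * t" using d2(2) t by blast
    have "norm (y - q) \<le> norm (t *\<^sub>R v) + norm (y - q - t *\<^sub>R v)" by (metis norm_triangle_sub)
    then have ny: "norm (y - q) \<le> t * (norm v + e)" using y t by (simp add: algebra_simps)
    moreover have "t * (norm v + e) \<le> t * K" using t by (simp add: K_def)
    ultimately have "norm (D (y - q)) \<le> e * norm (y - q)" using t by (intro d1 y) linarith
    also have "\<dots> \<le> e * (t * (norm v + e))" using ny e by simp
    finally have a: "norm (D (y - q)) \<le> e * (t * (norm v + e))" .
    have "norm (D (y - q - t *\<^sub>R v)) \<le> e * t * C"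
      using C(2)[of "y - q - t *\<^sub>R v"] y(2) C(1) by (meson mult_right_mono order.trans less_imp_le)
    moreover have "D (t *\<^sub>R v) = D (y - q) - D (y - q - t *\<^sub>R v)"
      by (simp flip: linear_diff[OF lin])
    then have "norm (D (t *\<^sub>R v)) \<le> norm (D (y - q)) + norm (D (y - q - t *\<^sub>R v))"
      using norm_triangle_ineq4 by simp
    ultimately have "norm (D (t *\<^sub>R v)) \<le> e * (t * (norm v + e)) + e * t * C"
      using a by linarith
    then have "t * norm (D v) \<le> t * (e * (norm v + e + C))"
      using t by (simp add: linear_scale[OF lin] algebra_simps)
    then show ?thesis using t by simp
  qed
  note small = this
  have "norm (D v) \<le> 0"
  proof (rule tendsto_lowerbound)
    show "((\<lambda>e. e * (norm v + e + C)) \<longlongrightarrow> 0) (at_right 0)"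
      by (auto intro!: tendsto_eq_intros)
    show "\<forall>\<^sub>F e in at_right 0. norm (D v) \<le> e * (norm v + e + C)"
      using small by (auto simp: eventually_at_filter)
  qed auto
  then show ?thesis by (simp add: D_def)
qed

text \<open>One defining function suffices to compute the tangent space: any other one vanishes on \<open>M\<close>, so its
  differential kills limits of secant directions.\<close>

lemma tangent_space_eq:
  assumes q: "q \<in> M" "q \<in> U"
  shows "tangent_space M q = {v. d\<rho> q v = 0}"
proof safe
  fix v assume "v \<in> tangent_space M q"
  then show "d\<rho> q v = 0" using q chart by (auto simp: tangent_space_def d\<rho>_def)
next
  fix v assume v: "d\<rho> q v = 0"
  have "frechet_derivative \<sigma> (at q) v = 0" if "q \<in> V" "local_defining_function M V \<sigma>" for V \<sigma>
  proof -
    interpret V: hypersurface_chart M V \<sigma> using that(2) by unfold_locales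
    have "(\<sigma> has_derivative V.d\<rho> q) (at q within M)"
      using V.d\<rho>[OF that(1)] has_derivative_at_withinI by blast
    moreover have "(\<sigma> has_derivative (\<lambda>v. 0)) (at q within M)"
      by (rule has_derivative_within_transform[OF has_derivative_const[of 0]])
        (use V.M_iff V.open_U q that in \<open>auto simp: eventually_near_in\<close>)
    ultimately have "V.d\<rho> q v = 0" by (rule derivative_within_unique[OF q v])
    then show ?thesis by (simp add: V.d\<rho>_def)
  qed
  then show "v \<in> tangent_space M q" unfolding tangent_space_def by blast
qed

end

text \<open>The directional derivative underlying \<open>vderiv\<close>; it sees the field only through its value at the
  point.\<close>

definition cderiv :: "(complex^'n) set \<Rightarrow> (complex^'n \<Rightarrow> complex) \<Rightarrow> complex^'n \<Rightarrow> 'n cxvec \<Rightarrow> complex" where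
  "cderiv M f q w = frechet_derivative f (at q within M) (fst w)
     + \<i> * frechet_derivative f (at q within M) (snd w)"

lemma vderiv_eq_cderiv: "vderiv M X f q = cderiv M f q (X q)"
  by (simp add: vderiv_def cderiv_def)

locale hypersurface =
  fixes M :: "(complex^'n) set"
  assumes hyp: "smooth_real_hypersurface M"
begin

lemma chart_at:
  assumes "q \<in> M" obtains U \<rho> where "q \<in> U" "hypersurface_chart M U \<rho>"
  using hyp assms unfolding smooth_real_hypersurface_def hypersurface_chart_def by blast

lemma frechet_within:
  assumes "q \<in> M" "(f has_derivative A) (at q within M)" "v \<in> tangent_space M q"
  shows "frechet_derivative f (at q within M) v = A v"
proof -
  obtain U \<rho> where c: "q \<in> U" "hypersurface_chart M U \<rho>" using chart_at assms by blast
  interpret hypersurface_chart M U \<rho> by fact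
  have "(f has_derivative frechet_derivative f (at q within M)) (at q within M)"
    using assms(2) by (auto simp: differentiable_def simp flip: frechet_derivative_works)
  then show ?thesis
    using derivative_within_unique[OF assms(1) c(1) _ _ assms(2)] assms(3)
      tangent_space_eq[OF assms(1) c(1)] by auto
qed

lemma smooth_near_has_derivative:
  assumes "q \<in> M" "smooth_near M q f"
  shows "(f has_derivative frechet_derivative f (at q within M)) (at q within M)"
proof -
  obtain U F where U: "open U" "q \<in> U" "\<And>k. Ck_on k F U" "\<And>x. x \<in> M \<Longrightarrow> x \<in> U \<Longrightarrow> f x = F x"
    using assms(2) smooth_near_E by metis
  have "(F has_derivative frechet_derivative F (at q)) (at q within M)"
    using Ck_on_SucD[OF U(3,2)] has_derivative_at_withinI by blast
  then have "(f has_derivative frechet_derivative F (at q)) (at q within M)"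
    by (rule has_derivative_within_transform) (use U assms in \<open>auto simp: eventually_near_in\<close>)
  then show ?thesis by (auto simp: differentiable_def simp flip: frechet_derivative_works)
qed

lemma linear_frechet_within:
  "q \<in> M \<Longrightarrow> smooth_near M q f \<Longrightarrow> linear (frechet_derivative f (at q within M))"
  using smooth_near_has_derivative has_derivative_linear by blast

lemma frechet_within_cong:
  assumes "q \<in> M" "eventually (\<lambda>x. f x = g x) (near_in M q)"
  shows "frechet_derivative f (at q within M) = frechet_derivative g (at q within M)"
proof -
  have "(f has_derivative A) (at q within M) \<longleftrightarrow> (g has_derivative A) (at q within M)" for A
    using has_derivative_within_transform[of f A q M g] has_derivative_within_transform[of g A q M f]
      assms by (auto simp: eq_commute)
  then show ?thesis by (simp add: frechet_derivative_def)
qed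

lemma frechet_within_bilinear:
  assumes "q \<in> M" "smooth_near M q f" "smooth_near M q g" "v \<in> tangent_space M q" "bounded_bilinear B"
  shows "frechet_derivative (\<lambda>x. B (f x) (g x)) (at q within M) v
    = B (f q) (frechet_derivative g (at q within M) v) + B (frechet_derivative f (at q within M) v) (g q)"
  by (rule frechet_within[OF assms(1) bounded_bilinear.FDERIV[OF assms(5)] assms(4)])
    (intro smooth_near_has_derivative assms)+

lemma frechet_within_linear_comp:
  assumes "q \<in> M" "smooth_near M q f" "v \<in> tangent_space M q" "bounded_linear L"
  shows "frechet_derivative (\<lambda>x. L (f x)) (at q within M) v = L (frechet_derivative f (at q within M) v)"
  by (rule frechet_within[OF assms(1) bounded_linear.has_derivative[OF assms(4)] assms(3)])
    (intro smooth_near_has_derivative assms)+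

lemma frechet_within_add:
  assumes "q \<in> M" "smooth_near M q f" "smooth_near M q g" "v \<in> tangent_space M q"
  shows "frechet_derivative (\<lambda>x. f x + g x) (at q within M) v
    = frechet_derivative f (at q within M) v + frechet_derivative g (at q within M) v"
  by (rule frechet_within[OF assms(1) has_derivative_add assms(4)])
    (intro smooth_near_has_derivative assms)+

lemma frechet_within_const:
  assumes "q \<in> M" "v \<in> tangent_space M q"
  shows "frechet_derivative (\<lambda>x. c) (at q within M) v = 0"
  by (rule frechet_within[OF assms(1) has_derivative_const assms(2)])

lemma CT_D: "w \<in> CT M q \<Longrightarrow> fst w \<in> tangent_space M q" "w \<in> CT M q \<Longrightarrow> snd w \<in> tangent_space M q"
  by (auto simp: CT_def)

lemma cderiv_cong:
  "q \<in> M \<Longrightarrow> eventually (\<lambda>x. f x = g x) (near_in M q) \<Longrightarrow> cderiv M f q w = cderiv M g q w"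
  by (simp add: cderiv_def frechet_within_cong[of q f g])

lemma cderiv_mult:
  assumes "q \<in> M" "smooth_near M q f" "smooth_near M q g" "w \<in> CT M q"
  shows "cderiv M (\<lambda>x. f x * g x) q w = cderiv M f q w * g q + f q * cderiv M g q w"
  by (simp add: cderiv_def frechet_within_bilinear[OF assms(1-3) CT_D(1)[OF assms(4)] bounded_bilinear_mult]
      frechet_within_bilinear[OF assms(1-3) CT_D(2)[OF assms(4)] bounded_bilinear_mult] algebra_simps)

lemma cderiv_add:
  assumes "q \<in> M" "smooth_near M q f" "smooth_near M q g" "w \<in> CT M q"
  shows "cderiv M (\<lambda>x. f x + g x) q w = cderiv M f q w + cderiv M g q w"
  by (simp add: cderiv_def frechet_within_add[OF assms(1-3) CT_D(1)[OF assms(4)]]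
      frechet_within_add[OF assms(1-3) CT_D(2)[OF assms(4)]] algebra_simps)

lemma cderiv_const: "q \<in> M \<Longrightarrow> w \<in> CT M q \<Longrightarrow> cderiv M (\<lambda>x. c) q w = 0"
  by (simp add: cderiv_def frechet_within_const CT_D)

lemma cderiv_cmult:
  assumes "q \<in> M" "smooth_near M q f" "w \<in> CT M q"
  shows "cderiv M (\<lambda>x. c * f x) q w = c * cderiv M f q w"
  using cderiv_mult[OF assms(1) smooth_near_const assms(2,3)] cderiv_const[OF assms(1,3)] by simp

lemma cderiv_sum:
  assumes "q \<in> M" "\<And>i. i \<in> I \<Longrightarrow> smooth_near M q (f i)" "w \<in> CT M q"
  shows "cderiv M (\<lambda>x. \<Sum>i\<in>I. f i x) q w = (\<Sum>i\<in>I. cderiv M (f i) q w)"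
  using assms(2)
proof (induction I rule: infinite_finite_induct)
  case (insert x F)
  then show ?case using assms by (simp add: cderiv_add smooth_near_sum)
qed (use assms in \<open>simp_all add: cderiv_const\<close>)

lemma cderiv_cnj:
  assumes "q \<in> M" "smooth_near M q f" "w \<in> CT M q"
  shows "cderiv M (\<lambda>x. cnj (f x)) q w = cnj (cderiv M f q (cconj w))"
proof -
  have "linear (frechet_derivative f (at q within M))"
    using linear_frechet_within assms by blast
  then show ?thesis
    using frechet_within_linear_comp[OF assms(1,2) CT_D(1)[OF assms(3)] bounded_linear_cnj]
      frechet_within_linear_comp[OF assms(1,2) CT_D(2)[OF assms(3)] bounded_linear_cnj]
    by (simp add: cderiv_def cconj_def linear_neg)
qed

lemma cderiv_add_vec:
  assumes "q \<in> M" "smooth_near M q f"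
  shows "cderiv M f q (w + w') = cderiv M f q w + cderiv M f q w'"
  using linear_add[OF linear_frechet_within[OF assms]] by (simp add: cderiv_def algebra_simps)

lemma cderiv_cscale:
  assumes "q \<in> M" "smooth_near M q f"
  shows "cderiv M f q (cscale c w) = c * cderiv M f q w"
proof -
  note l = linear_frechet_within[OF assms]
  have "c = complex_of_real (Re c) + \<i> * complex_of_real (Im c)" by (rule complex_eq)
  then obtain a b where c: "c = complex_of_real a + \<i> * complex_of_real b" by blast
  have sc: "frechet_derivative f (at q within M) (r *\<^sub>R v)
      = complex_of_real r * frechet_derivative f (at q within M) v" for r v
    by (simp only: linear_scale[OF l]) (simp only: scaleR_conv_of_real)
  show ?thesis unfolding c
    by (simp add: cderiv_def cscale_def linear_diff[OF l] linear_add[OF l] sc algebra_simps)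
qed

lemma cderiv_smooth_extension:
  assumes U: "open U" "x \<in> M" "x \<in> U" "\<And>k. Ck_on k F U" "\<And>x. x \<in> M \<Longrightarrow> x \<in> U \<Longrightarrow> f x = F x"
    and w: "w \<in> CT M x"
  shows "cderiv M f x w = frechet_derivative F (at x) (fst w) + \<i> * frechet_derivative F (at x) (snd w)"
proof -
  have "(F has_derivative frechet_derivative F (at x)) (at x within M)"
    using Ck_on_SucD[OF U(4,3)] has_derivative_at_withinI by blast
  then have d: "(f has_derivative frechet_derivative F (at x)) (at x within M)"
    by (rule has_derivative_within_transform) (use U in \<open>auto simp: eventually_near_in\<close>)
  show ?thesis
    by (simp add: cderiv_def frechet_within[OF U(2) d CT_D(1)[OF w]] frechet_within[OF U(2) d CT_D(2)[OF w]])
qed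

text \<open>Where \<open>f\<close> has a smooth extension \<open>F\<close>, the derivative is a combination of partial derivatives of \<open>F\<close>
  with smooth coefficients, namely the components of \<open>X\<close>.\<close>

lemma smooth_near_vderiv:
  assumes "q \<in> M" "smooth_near M q f" "smooth_near M q X" "eventually (\<lambda>x. X x \<in> CT M x) (near_in M q)"
  shows "smooth_near M q (vderiv M X f)"
proof -
  obtain U F where U: "open U" "q \<in> U" "\<And>k. Ck_on k F U" "\<And>x. x \<in> M \<Longrightarrow> x \<in> U \<Longrightarrow> f x = F x"
    using assms(2) smooth_near_E by metis
  let ?F = "\<lambda>x. frechet_derivative F (at x)"
  have s: "smooth_near M q (\<lambda>x. ?F x b)" for b
  proof (rule smooth_near_I[OF U(1,2)])
    show "Ck_on k (\<lambda>x. ?F x b) U" for k using U(3)[of "Suc k"] by simp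
  qed simp
  have X: "smooth_near M q (\<lambda>x. fst (X x))" "smooth_near M q (\<lambda>x. snd (X x))"
    by (rule smooth_near_linear_comp[OF bounded_linear_fst assms(3)]
        smooth_near_linear_comp[OF bounded_linear_snd assms(3)])+
  have "smooth_near M q (\<lambda>x. (\<Sum>b\<in>Basis. (fst (X x) \<bullet> b) *\<^sub>R ?F x b)
      + \<i> * (\<Sum>b\<in>Basis. (snd (X x) \<bullet> b) *\<^sub>R ?F x b))"
    by (intro smooth_near_add smooth_near_sum smooth_near_scaleR smooth_near_inner smooth_near_mult
        smooth_near_const X s)
  then show ?thesis
  proof (rule smooth_near_cong_ev)
    have "eventually (\<lambda>x. x \<in> M \<and> x \<in> U) (near_in M q)" using U by (auto simp: eventually_near_in)
    then show "eventually (\<lambda>x. (\<Sum>b\<in>Basis. (fst (X x) \<bullet> b) *\<^sub>R ?F x b)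
      + \<i> * (\<Sum>b\<in>Basis. (snd (X x) \<bullet> b) *\<^sub>R ?F x b) = vderiv M X f x) (near_in M q)"
      using assms(4)
    proof eventually_elim
      case (elim x)
      have l: "linear (?F x)"
        using Ck_on_SucD[OF U(3)] elim has_derivative_linear by blast
      have "(\<Sum>b\<in>Basis. (v \<bullet> b) *\<^sub>R ?F x b) = ?F x v" for v
      proof -
        have "?F x (\<Sum>b\<in>Basis. (v \<bullet> b) *\<^sub>R b) = (\<Sum>b\<in>Basis. (v \<bullet> b) *\<^sub>R ?F x b)"
          by (simp only: linear_sum[OF l] linear_scale[OF l])
        then show ?thesis by (simp only: euclidean_representation)
      qed
      then show ?case unfolding vderiv_eq_cderiv
        using cderiv_smooth_extension[OF U(1) _ _ U(3,4)] elim by simp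
    qed
  qed
qed

definition ct_field :: "complex^'n \<Rightarrow> (complex^'n \<Rightarrow> 'n cxvec) \<Rightarrow> bool" where
  "ct_field q X \<longleftrightarrow> smooth_near M q X \<and> eventually (\<lambda>x. X x \<in> CT M x) (near_in M q)"

lemma local_section_iff:
  "local_section M p E L \<longleftrightarrow>
    (smooth_near M p L \<and> eventually (\<lambda>x. L x \<in> E x) (near_in M p))" if "p \<in> M"
proof
  assume "local_section M p E L"
  then obtain U where U: "open U" "p \<in> U" "smooth_along (M \<inter> U) L" "\<forall>q\<in>M \<inter> U. L q \<in> E q"
    by (auto simp: local_section_def)
  then show "smooth_near M p L \<and> eventually (\<lambda>x. L x \<in> E x) (near_in M p)"
    using that smooth_near_Int_open[OF U(1,2)] by (auto simp: smooth_along_iff eventually_near_in)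
next
  assume L: "smooth_near M p L \<and> eventually (\<lambda>x. L x \<in> E x) (near_in M p)"
  then have "eventually (\<lambda>x. L x \<in> E x \<and> smooth_near M x L) (near_in M p)"
    using smooth_near_eventually[of M p L] by (auto intro: eventually_conj)
  then obtain U where U: "open U" "p \<in> U" "\<forall>x\<in>M \<inter> U. L x \<in> E x \<and> smooth_near M x L"
    by (auto simp: eventually_near_in)
  then show "local_section M p E L"
    using smooth_near_Int_open[OF U(1)] unfolding local_section_def smooth_along_iff by blast
qed

lemma ct_field_iff: "q \<in> M \<Longrightarrow> ct_field q X \<longleftrightarrow> local_section M q (CT M) X"
  by (simp add: local_section_iff ct_field_def)

lemma ct_field_at: "q \<in> M \<Longrightarrow> ct_field q X \<Longrightarrow> X q \<in> CT M q"
  using eventually_near_in_self ct_field_def by metis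

lemma ct_field_eventually: "ct_field q X \<Longrightarrow> eventually (\<lambda>x. ct_field x X) (near_in M q)"
  using smooth_near_eventually[of M q X] eventually_eventually_near_in[where S = M and q = q]
  unfolding ct_field_def by (simp add: eventually_conj_iff)

lemma smooth_near_vderiv': "q \<in> M \<Longrightarrow> smooth_near M q f \<Longrightarrow> ct_field q X \<Longrightarrow> smooth_near M q (vderiv M X f)"
  using smooth_near_vderiv by (simp add: ct_field_def)

lemma vderiv_mult:
  assumes "q \<in> M" "smooth_near M q f" "smooth_near M q g" "ct_field q X"
  shows "vderiv M X (\<lambda>x. f x * g x) q = vderiv M X f q * g q + f q * vderiv M X g q"
  unfolding vderiv_eq_cderiv using assms by (intro cderiv_mult ct_field_at)

lemma vderiv_add:
  assumes "q \<in> M" "smooth_near M q f" "smooth_near M q g" "ct_field q X"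
  shows "vderiv M X (\<lambda>x. f x + g x) q = vderiv M X f q + vderiv M X g q"
  unfolding vderiv_eq_cderiv using assms by (intro cderiv_add ct_field_at)

lemma vderiv_sum:
  assumes "q \<in> M" "\<And>i. i \<in> I \<Longrightarrow> smooth_near M q (f i)" "ct_field q X"
  shows "vderiv M X (\<lambda>x. \<Sum>i\<in>I. f i x) q = (\<Sum>i\<in>I. vderiv M X (f i) q)"
  unfolding vderiv_eq_cderiv using assms by (intro cderiv_sum ct_field_at)

lemma vderiv_const: "q \<in> M \<Longrightarrow> ct_field q X \<Longrightarrow> vderiv M X (\<lambda>x. c) q = 0"
  unfolding vderiv_eq_cderiv by (intro cderiv_const ct_field_at)

lemma vderiv_cong:
  "q \<in> M \<Longrightarrow> eventually (\<lambda>x. f x = g x) (near_in M q) \<Longrightarrow> vderiv M X f q = vderiv M X g q"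
  unfolding vderiv_eq_cderiv by (rule cderiv_cong)

lemma vderiv_cong_ev:
  assumes "eventually (\<lambda>x. f x = g x) (near_in M q)"
  shows "eventually (\<lambda>x. vderiv M X f x = vderiv M X g x) (near_in M q)"
  using eventually_eventually_near_in[OF assms] eventually_near_in_mem
  by eventually_elim (simp add: vderiv_eq_cderiv cderiv_cong)

lemma vderiv_mult_ev:
  assumes "smooth_near M q f" "smooth_near M q g" "ct_field q X"
  shows "eventually (\<lambda>x. vderiv M X (\<lambda>x. f x * g x) x = vderiv M X f x * g x + f x * vderiv M X g x) (near_in M q)"
  using smooth_near_eventually[OF assms(1)] smooth_near_eventually[OF assms(2)]
    ct_field_eventually[OF assms(3)] eventually_near_in_mem
  by eventually_elim (simp add: vderiv_mult)

lemma vderiv_sum_ev: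
  assumes "finite I" "\<And>i. i \<in> I \<Longrightarrow> smooth_near M q (f i)" "ct_field q X"
  shows "eventually (\<lambda>x. vderiv M X (\<lambda>x. \<Sum>i\<in>I. f i x) x = (\<Sum>i\<in>I. vderiv M X (f i) x)) (near_in M q)"
proof -
  have "eventually (\<lambda>x. \<forall>i\<in>I. smooth_near M x (f i)) (near_in M q)"
    using assms(2) by (intro eventually_ball_finite assms(1) ballI smooth_near_eventually)
  then show ?thesis using ct_field_eventually[OF assms(3)] eventually_near_in_mem
    by eventually_elim (simp add: vderiv_sum)
qed

lemma vderiv2_cong:
  assumes "q \<in> M" "eventually (\<lambda>x. f x = g x) (near_in M q)"
  shows "vderiv M Y (vderiv M X f) q = vderiv M Y (vderiv M X g) q"
  by (rule vderiv_cong[OF assms(1) vderiv_cong_ev[OF assms(2)]])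

lemma vderiv2_mult:
  assumes q: "q \<in> M" and f: "smooth_near M q f" and g: "smooth_near M q g"
    and X: "ct_field q X" and Y: "ct_field q Y"
  shows "vderiv M Y (vderiv M X (\<lambda>x. f x * g x)) q =
    vderiv M Y (vderiv M X f) q * g q + vderiv M X f q * vderiv M Y g q
    + vderiv M Y f q * vderiv M X g q + f q * vderiv M Y (vderiv M X g) q"
proof -
  have s: "smooth_near M q (vderiv M X f)" "smooth_near M q (vderiv M X g)"
    by (rule smooth_near_vderiv'[OF q f X] smooth_near_vderiv'[OF q g X])+
  have "vderiv M Y (vderiv M X (\<lambda>x. f x * g x)) q
      = vderiv M Y (\<lambda>x. vderiv M X f x * g x + f x * vderiv M X g x) q"
    by (rule vderiv_cong[OF q vderiv_mult_ev[OF f g X]])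
  also have "\<dots> = vderiv M Y (\<lambda>x. vderiv M X f x * g x) q + vderiv M Y (\<lambda>x. f x * vderiv M X g x) q"
    by (rule vderiv_add[OF q smooth_near_mult[OF s(1) g] smooth_near_mult[OF f s(2)] Y])
  finally show ?thesis
    by (simp add: vderiv_mult[OF q s(1) g Y] vderiv_mult[OF q f s(2) Y])
qed

lemma vderiv2_sum:
  assumes q: "q \<in> M" and I: "finite I" and f: "\<And>i. i \<in> I \<Longrightarrow> smooth_near M q (f i)"
    and X: "ct_field q X" and Y: "ct_field q Y"
  shows "vderiv M Y (vderiv M X (\<lambda>x. \<Sum>i\<in>I. f i x)) q = (\<Sum>i\<in>I. vderiv M Y (vderiv M X (f i)) q)"
proof -
  have "vderiv M Y (vderiv M X (\<lambda>x. \<Sum>i\<in>I. f i x)) q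
      = vderiv M Y (\<lambda>x. \<Sum>i\<in>I. vderiv M X (f i) x) q"
    by (rule vderiv_cong[OF q vderiv_sum_ev[OF I f X]])
  also have "\<dots> = (\<Sum>i\<in>I. vderiv M Y (vderiv M X (f i)) q)"
    by (rule vderiv_sum[OF q _ Y]) (rule smooth_near_vderiv'[OF q f X])
  finally show ?thesis .
qed

lemma vderiv2_add:
  assumes q: "q \<in> M" and "smooth_near M q f" "smooth_near M q g" "ct_field q X" "ct_field q Y"
  shows "vderiv M Y (vderiv M X (\<lambda>x. f x + g x)) q
    = vderiv M Y (vderiv M X f) q + vderiv M Y (vderiv M X g) q"
  using vderiv2_sum[OF q, of "UNIV :: bool set" "\<lambda>b. if b then f else g" X Y] assms
  by (simp add: UNIV_bool add.commute)

lemma vderiv2_cmult: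
  assumes q: "q \<in> M" and f: "smooth_near M q f" and X: "ct_field q X" and Y: "ct_field q Y"
  shows "vderiv M Y (vderiv M X (\<lambda>x. c * f x)) q = c * vderiv M Y (vderiv M X f) q"
proof -
  have "eventually (\<lambda>x. vderiv M X (\<lambda>x. c) x = 0) (near_in M q)"
    using ct_field_eventually[OF X] eventually_near_in_mem
    by eventually_elim (simp add: vderiv_const)
  then have "vderiv M Y (vderiv M X (\<lambda>x. c)) q = 0"
    using vderiv_cong[OF q, of "vderiv M X (\<lambda>x. c)" "\<lambda>x. 0" Y] vderiv_const[OF q Y] by simp
  then show ?thesis
    using vderiv2_mult[OF q smooth_near_const f X Y, of c] vderiv_const[OF q X, of c]
      vderiv_const[OF q Y, of c] by simp
qed

end

section \<open>The Levi form in a chart\<close>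

lemma linear_J: "linear J"
  by (rule linearI) (simp_all add: J_def vec_eq_iff algebra_simps)

lemmas J_add = linear_add[OF linear_J] and J_diff = linear_diff[OF linear_J]
  and J_neg = linear_neg[OF linear_J] and J_scaleR = linear_scale[OF linear_J]
  and J_zero = linear_0[OF linear_J]

lemma bounded_linear_J: "bounded_linear J"
  using linear_J linear_conv_bounded_linear by blast

lemma J_J [simp]: "J (J v) = - v"
  by (simp add: J_def vec_eq_iff flip: mult.assoc)

lemma inner_J_self: "v \<bullet> J v = 0"
  by (simp add: J_def inner_vec_def inner_complex_def mult.commute)

lemma complex_scale_J: "c *s a = Re c *\<^sub>R a + Im c *\<^sub>R J a"
proof -
  have "c * z = Re c *\<^sub>R z + Im c *\<^sub>R (\<i> * z)" for z :: complex
    by (simp add: complex_eq_iff)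
  then show ?thesis by (simp add: J_def vec_eq_iff)
qed

locale levi_chart = hypersurface M + hypersurface_chart M U \<rho>
  for M U :: "(complex^'n) set" and \<rho>
begin

definition grad :: "complex^'n \<Rightarrow> complex^'n" where
  "grad q = (\<Sum>b\<in>Basis. d\<rho> q b *\<^sub>R b)"

definition grad_sq :: "complex^'n \<Rightarrow> real" where
  "grad_sq q = grad q \<bullet> grad q"

definition Hess :: "complex^'n \<Rightarrow> complex^'n \<Rightarrow> complex^'n \<Rightarrow> real" where
  "Hess q u w = frechet_derivative (\<lambda>x. d\<rho> x w) (at q) u"

lemma d\<rho>_inner: "q \<in> U \<Longrightarrow> d\<rho> q v = grad q \<bullet> v"
proof -
  assume q: "q \<in> U"
  have "d\<rho> q (\<Sum>b\<in>Basis. (v \<bullet> b) *\<^sub>R b) = (\<Sum>b\<in>Basis. (v \<bullet> b) * d\<rho> q b)"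
    by (simp add: linear_sum[OF linear_d\<rho>[OF q]] linear_scale[OF linear_d\<rho>[OF q]])
  then show ?thesis
    unfolding euclidean_representation by (simp add: grad_def inner_sum_left inner_commute[of v] mult.commute)
qed

lemma grad_sq_pos: "q \<in> M \<Longrightarrow> q \<in> U \<Longrightarrow> grad_sq q > 0"
  using d\<rho>_nonzero[of q] d\<rho>_inner[of q] by (auto simp: grad_sq_def)

lemma d\<rho>_grad: "q \<in> U \<Longrightarrow> d\<rho> q (grad q) = grad_sq q" "q \<in> U \<Longrightarrow> d\<rho> q (J (grad q)) = 0"
  by (simp_all add: d\<rho>_inner grad_sq_def inner_J_self)

lemma d\<rho>_lin:
  assumes "q \<in> U"
  shows "d\<rho> q (u + v) = d\<rho> q u + d\<rho> q v" "d\<rho> q (u - v) = d\<rho> q u - d\<rho> q v"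
    "d\<rho> q (- v) = - d\<rho> q v" "d\<rho> q (r *\<^sub>R v) = r * d\<rho> q v"
  using assms by (simp_all add: d\<rho>_inner inner_simps)

lemma near_U: "q \<in> U \<Longrightarrow> eventually (\<lambda>x. x \<in> M \<and> x \<in> U) (near_in M q)"
  using open_U by (auto simp: eventually_near_in)

lemma Ck_d\<rho>: "Ck_on k (\<lambda>x. d\<rho> x v) U"
  using Ck_\<rho>[of "Suc k"] by (simp add: d\<rho>_def)

lemma Ck_Hess: "Ck_on k (\<lambda>x. Hess x u w) U"
  using Ck_d\<rho>[of "Suc k"] by (simp add: Hess_def)

lemma smooth_d\<rho>_const: "q \<in> U \<Longrightarrow> smooth_near M q (\<lambda>x. d\<rho> x v)"
  by (rule smooth_near_I[OF open_U _ Ck_d\<rho>]) auto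

lemma smooth_Hess_const: "q \<in> U \<Longrightarrow> smooth_near M q (\<lambda>x. Hess x u w)"
  by (rule smooth_near_I[OF open_U _ Ck_Hess]) auto

lemma smooth_grad: "q \<in> U \<Longrightarrow> smooth_near M q grad"
  unfolding grad_def[abs_def]
  by (intro smooth_near_sum smooth_near_scaleR smooth_d\<rho>_const smooth_near_const)

lemma smooth_grad_sq: "q \<in> U \<Longrightarrow> smooth_near M q grad_sq"
  unfolding grad_sq_def[abs_def] by (intro smooth_near_inner smooth_grad)

lemma smooth_J: "smooth_near M q a \<Longrightarrow> smooth_near M q (\<lambda>x. J (a x))"
  by (rule smooth_near_linear_comp[OF bounded_linear_J])

lemma smooth_d\<rho>:
  assumes "q \<in> U" "smooth_near M q a" shows "smooth_near M q (\<lambda>x. d\<rho> x (a x))"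
proof (rule smooth_near_cong_ev)
  show "smooth_near M q (\<lambda>x. grad x \<bullet> a x)" by (intro smooth_near_inner smooth_grad assms)
  show "eventually (\<lambda>x. grad x \<bullet> a x = d\<rho> x (a x)) (near_in M q)"
    using near_U[OF assms(1)] by eventually_elim (simp add: d\<rho>_inner)
qed

lemma Hess_sym: "q \<in> U \<Longrightarrow> Hess q u w = Hess q w u"
  using second_derivative_symmetric[OF open_U _ Ck_\<rho>, of q w u] by (simp add: Hess_def d\<rho>_def)

lemma has_derivative_Hess: "q \<in> U \<Longrightarrow> ((\<lambda>x. d\<rho> x w) has_derivative (\<lambda>u. Hess q u w)) (at q)"
  unfolding Hess_def by (rule Ck_on_SucD[OF Ck_d\<rho>])

lemma linear_Hess: "q \<in> U \<Longrightarrow> linear (\<lambda>u. Hess q u w)" "q \<in> U \<Longrightarrow> linear (Hess q u)"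
proof -
  assume q: "q \<in> U"
  show l: "linear (\<lambda>u. Hess q u w)" for w
    by (rule has_derivative_linear[OF has_derivative_Hess[OF q]])
  have "Hess q u = (\<lambda>w. Hess q w u)" using Hess_sym[OF q] by blast
  then show "linear (Hess q u)" using l by simp
qed

lemma Hess_lin:
  assumes "q \<in> U"
  shows "Hess q (u + v) w = Hess q u w + Hess q v w" "Hess q w (u + v) = Hess q w u + Hess q w v"
    "Hess q (- u) w = - Hess q u w" "Hess q w (- u) = - Hess q w u"
    "Hess q (r *\<^sub>R u) w = r * Hess q u w" "Hess q w (r *\<^sub>R u) = r * Hess q w u"
  using linear_add[OF linear_Hess(1)[OF assms]] linear_add[OF linear_Hess(2)[OF assms]]
    linear_neg[OF linear_Hess(1)[OF assms]] linear_neg[OF linear_Hess(2)[OF assms]]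
    linear_scale[OF linear_Hess(1)[OF assms]] linear_scale[OF linear_Hess(2)[OF assms]]
  by simp_all

lemma smooth_Hess:
  assumes q: "q \<in> U" and a: "smooth_near M q a" and b: "smooth_near M q b"
  shows "smooth_near M q (\<lambda>x. Hess x (a x) (b x))"
proof (rule smooth_near_cong_ev)
  show "smooth_near M q (\<lambda>x. \<Sum>i\<in>Basis. (a x \<bullet> i) * (\<Sum>j\<in>Basis. (b x \<bullet> j) * Hess x i j))"
    by (intro smooth_near_sum smooth_near_mult smooth_near_inner smooth_Hess_const q a b smooth_near_const)
  show "eventually (\<lambda>x. (\<Sum>i\<in>Basis. (a x \<bullet> i) * (\<Sum>j\<in>Basis. (b x \<bullet> j) * Hess x i j)) = Hess x (a x) (b x))
     (near_in M q)"
    using near_U[OF q]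
  proof eventually_elim
    case (elim x)
    have 1: "(\<Sum>j\<in>Basis. (v \<bullet> j) * Hess x i j) = Hess x i v" for v i
    proof -
      have "Hess x i (\<Sum>j\<in>Basis. (v \<bullet> j) *\<^sub>R j) = (\<Sum>j\<in>Basis. (v \<bullet> j) * Hess x i j)"
        using elim by (simp only: linear_sum[OF linear_Hess(2)] Hess_lin)
      then show ?thesis by (simp only: euclidean_representation)
    qed
    have "(\<Sum>i\<in>Basis. (v \<bullet> i) * Hess x i w) = Hess x v w" for v w
      using 1[of v w] Hess_sym[of x] elim by simp
    then show ?case by (simp only: 1)
  qed
qed

text \<open>The orthogonal projections to the complex tangent space and to the tangent space: \<open>grad q\<close> and
  \<open>J (grad q)\<close> are orthogonal and span the complex line normal to the complex tangent space. They turn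
  arbitrary vector valued functions into sections.\<close>

definition hproj :: "complex^'n \<Rightarrow> complex^'n \<Rightarrow> complex^'n" where
  "hproj q a = a - (d\<rho> q a / grad_sq q) *\<^sub>R grad q + (d\<rho> q (J a) / grad_sq q) *\<^sub>R J (grad q)"

definition tproj :: "complex^'n \<Rightarrow> complex^'n \<Rightarrow> complex^'n" where
  "tproj q a = a - (d\<rho> q a / grad_sq q) *\<^sub>R grad q"

lemma tangent_iff: "q \<in> M \<Longrightarrow> q \<in> U \<Longrightarrow> v \<in> tangent_space M q \<longleftrightarrow> d\<rho> q v = 0"
  using tangent_space_eq by blast

lemma H_iff: "q \<in> M \<Longrightarrow> q \<in> U \<Longrightarrow> v \<in> complex_tangent_space M q \<longleftrightarrow> d\<rho> q v = 0 \<and> d\<rho> q (J v) = 0"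
  by (simp add: complex_tangent_space_def tangent_iff)

lemma tproj_tangent: "q \<in> M \<Longrightarrow> q \<in> U \<Longrightarrow> tproj q a \<in> tangent_space M q"
  using grad_sq_pos[of q] by (simp add: tangent_iff tproj_def d\<rho>_lin d\<rho>_grad)

lemma tproj_id: "q \<in> M \<Longrightarrow> q \<in> U \<Longrightarrow> v \<in> tangent_space M q \<Longrightarrow> tproj q v = v"
  by (simp add: tangent_iff tproj_def)

lemma hproj_H: "q \<in> M \<Longrightarrow> q \<in> U \<Longrightarrow> hproj q a \<in> complex_tangent_space M q"
  using grad_sq_pos[of q] by (simp add: H_iff hproj_def d\<rho>_lin d\<rho>_grad J_add J_diff J_scaleR)

lemma hproj_id: "q \<in> M \<Longrightarrow> q \<in> U \<Longrightarrow> v \<in> complex_tangent_space M q \<Longrightarrow> hproj q v = v"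
  by (simp add: H_iff hproj_def)

lemma linear_hproj: "q \<in> U \<Longrightarrow> linear (hproj q)"
  by (rule linearI) (simp_all add: hproj_def d\<rho>_lin J_add J_scaleR algebra_simps add_divide_distrib)

lemma linear_tproj: "q \<in> U \<Longrightarrow> linear (tproj q)"
  by (rule linearI) (simp_all add: tproj_def d\<rho>_lin algebra_simps add_divide_distrib)

lemma hproj_J: "q \<in> U \<Longrightarrow> hproj q (J a) = J (hproj q a)"
  by (simp add: hproj_def d\<rho>_lin J_add J_diff J_scaleR)

lemma smooth_hproj:
  assumes q: "q \<in> M" "q \<in> U" and a: "smooth_near M q a"
  shows "smooth_near M q (\<lambda>x. hproj x (a x))"
proof -
  have "grad_sq q \<noteq> 0" using grad_sq_pos[OF q] by simp
  then show ?thesis unfolding hproj_def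
    using q by (intro smooth_near_add smooth_near_diff smooth_near_scaleR smooth_near_divide smooth_d\<rho>
      smooth_J smooth_grad smooth_grad_sq a) auto
qed

lemma smooth_tproj:
  assumes q: "q \<in> M" "q \<in> U" and a: "smooth_near M q a"
  shows "smooth_near M q (\<lambda>x. tproj x (a x))"
proof -
  have "grad_sq q \<noteq> 0" using grad_sq_pos[OF q] by simp
  then show ?thesis unfolding tproj_def
    using q by (intro smooth_near_diff smooth_near_scaleR smooth_near_divide smooth_d\<rho>
      smooth_grad smooth_grad_sq a) auto
qed

subsection \<open>Vectors of type (1,0)\<close>

lemma H10_iff: "w \<in> H10 M q \<longleftrightarrow> fst w \<in> complex_tangent_space M q \<and> snd w = - J (fst w)"
  if q: "q \<in> M" "q \<in> U"
proof -
  have 1: "snd w = - J (fst w) \<longleftrightarrow> J (fst w) = - snd w \<and> J (snd w) = fst w"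
    by (metis J_J J_neg minus_minus)
  have 2: "- J (fst w) \<in> complex_tangent_space M q" if "fst w \<in> complex_tangent_space M q"
    using that q by (simp add: H_iff d\<rho>_lin J_neg)
  have "w \<in> H10 M q \<longleftrightarrow> fst w \<in> complex_tangent_space M q \<and> snd w \<in> complex_tangent_space M q
      \<and> J (fst w) = - snd w \<and> J (snd w) = fst w"
    by (simp add: H10_def CH_def cscale_def mem_Times_iff)
  then show ?thesis using 1 2 by metis
qed

lemma H01_iff: "w \<in> H01 M q \<longleftrightarrow> fst w \<in> complex_tangent_space M q \<and> snd w = J (fst w)"
  if q: "q \<in> M" "q \<in> U"
proof -
  have "w \<in> H01 M q \<longleftrightarrow> cconj w \<in> H10 M q"
    by (force simp: H01_def cconj_def image_iff)
  then show ?thesis using H10_iff[OF q, of "cconj w"] by (simp add: cconj_def)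
qed

text \<open>The Levi form in this chart, up to constant factors: the hermitian part of the Hessian of the defining
  function. Composing with the projection makes it a form on all of the ambient space, so that it can
  be evaluated on constant vectors and depends smoothly on the base point.\<close>

definition levi :: "complex^'n \<Rightarrow> complex^'n \<Rightarrow> complex^'n \<Rightarrow> complex" where
  "levi q a b = complex_of_real (Hess q (hproj q a) (hproj q b) + Hess q (J (hproj q a)) (J (hproj q b)))
     + \<i> * complex_of_real (Hess q (hproj q a) (J (hproj q b)) - Hess q (J (hproj q a)) (hproj q b))"

lemma levi_lin:
  assumes "q \<in> U"
  shows "levi q (a + a') b = levi q a b + levi q a' b" "levi q b (a + a') = levi q b a + levi q b a'"
    "levi q (r *\<^sub>R a) b = r * levi q a b" "levi q b (r *\<^sub>R a) = r * levi q b a"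
    "levi q (J a) b = \<i> * levi q a b" "levi q b (J a) = - \<i> * levi q b a"
  using assms by (simp_all add: levi_def Hess_lin J_add J_scaleR hproj_J complex_eq_iff algebra_simps
      linear_add[OF linear_hproj] linear_scale[OF linear_hproj])

lemma levi_complex_scale:
  assumes "q \<in> U"
  shows "levi q (c *s a) b = c * levi q a b" "levi q b (c *s a) = cnj c * levi q b a"
  using assms by (simp_all add: complex_scale_J levi_lin complex_eq_iff algebra_simps)

lemma levi_herm: "q \<in> U \<Longrightarrow> levi q b a = cnj (levi q a b)"
  by (simp add: levi_def complex_eq_iff Hess_sym)

lemma levi_diff: "q \<in> U \<Longrightarrow> levi q (a - a') b = levi q a b - levi q a' b"
  "q \<in> U \<Longrightarrow> levi q b (a - a') = levi q b a - levi q b a'"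
  using levi_lin(1)[of q "a - a'" a' b] levi_lin(2)[of q b "a - a'" a'] by simp_all

lemma levi_hproj: "q \<in> M \<Longrightarrow> q \<in> U \<Longrightarrow> levi q (hproj q a) b = levi q a b"
  "q \<in> M \<Longrightarrow> q \<in> U \<Longrightarrow> levi q a (hproj q b) = levi q a b"
  using hproj_id[OF _ _ hproj_H] by (simp_all add: levi_def)

lemma smooth_levi:
  assumes q: "q \<in> M" "q \<in> U" and a: "smooth_near M q a" and b: "smooth_near M q b"
  shows "smooth_near M q (\<lambda>x. levi x (a x) (b x))"
  unfolding levi_def
  by (intro smooth_near_add smooth_near_mult smooth_near_const
      smooth_near_linear_comp[OF bounded_linear_of_real]
      smooth_near_diff smooth_Hess smooth_J smooth_hproj q a b)

lemma levi_expand: "q \<in> U \<Longrightarrow> levi q a b = (\<Sum>i\<in>Basis. complex_of_real (a \<bullet> i) * levi q i b)"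
  "q \<in> U \<Longrightarrow> levi q b a = (\<Sum>i\<in>Basis. complex_of_real (a \<bullet> i) * levi q b i)"
proof -
  assume q: "q \<in> U"
  have l: "linear (\<lambda>a. levi q a b)" "linear (levi q b)"
    using q by (auto intro!: linearI simp: levi_lin scaleR_conv_of_real[where 'a = complex])
  have "levi q (\<Sum>i\<in>Basis. (a \<bullet> i) *\<^sub>R i) b = (\<Sum>i\<in>Basis. complex_of_real (a \<bullet> i) * levi q i b)"
    "levi q b (\<Sum>i\<in>Basis. (a \<bullet> i) *\<^sub>R i) = (\<Sum>i\<in>Basis. complex_of_real (a \<bullet> i) * levi q b i)"
    using q by (simp_all only: linear_sum[OF l(1)] linear_sum[OF l(2)] levi_lin)
  then show "levi q a b = (\<Sum>i\<in>Basis. complex_of_real (a \<bullet> i) * levi q i b)"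
    "levi q b a = (\<Sum>i\<in>Basis. complex_of_real (a \<bullet> i) * levi q b i)"
    by (simp_all only: euclidean_representation)
qed

subsection \<open>Contact forms\<close>

text \<open>A tangent vector transversal to the complex tangent space, normalised by \<open>d\<rho> q (J (\<xi> q)) = 1\<close>.\<close>

definition \<xi> :: "complex^'n \<Rightarrow> complex^'n" where
  "\<xi> q = (- 1 / grad_sq q) *\<^sub>R J (grad q)"

lemma \<xi>: "q \<in> M \<Longrightarrow> q \<in> U \<Longrightarrow> d\<rho> q (\<xi> q) = 0" "q \<in> M \<Longrightarrow> q \<in> U \<Longrightarrow> d\<rho> q (J (\<xi> q)) = 1"
  using grad_sq_pos[of q] by (simp_all add: \<xi>_def d\<rho>_lin d\<rho>_grad J_scaleR J_neg)

lemma smooth_\<xi>: "q \<in> M \<Longrightarrow> q \<in> U \<Longrightarrow> smooth_near M q \<xi>"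
  unfolding \<xi>_def[abs_def] using grad_sq_pos[of q]
  by (intro smooth_near_scaleR smooth_near_divide smooth_near_const smooth_J smooth_grad_sq smooth_grad) auto

text \<open>Every contact form is a multiple of \<open>v \<mapsto> d\<rho> (J v)\<close> on tangent vectors; this is the multiple.\<close>

definition contact_coeff :: "(complex^'n \<Rightarrow> (complex^'n) \<Rightarrow>\<^sub>L real) \<Rightarrow> complex^'n \<Rightarrow> real" where
  "contact_coeff \<theta> q = blinfun_apply (\<theta> q) (\<xi> q)"

lemma contact_form_eq:
  assumes q: "q \<in> M" "q \<in> U" and \<theta>: "contact_form M \<theta>" and v: "v \<in> tangent_space M q"
  shows "blinfun_apply (\<theta> q) v = contact_coeff \<theta> q * d\<rho> q (J v)"
proof -
  have "v - d\<rho> q (J v) *\<^sub>R \<xi> q \<in> complex_tangent_space M q"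
    using v q by (simp add: H_iff tangent_iff d\<rho>_lin J_diff J_scaleR \<xi>)
  then have "blinfun_apply (\<theta> q) (v - d\<rho> q (J v) *\<^sub>R \<xi> q) = 0"
    using \<theta> q by (simp add: contact_form_def)
  then show ?thesis by (simp add: blinfun.diff_right blinfun.scaleR_right contact_coeff_def)
qed

lemma smooth_contact_coeff:
  assumes "q \<in> M" "q \<in> U" "contact_form M \<theta>" shows "smooth_near M q (contact_coeff \<theta>)"
  unfolding contact_coeff_def[abs_def]
  by (rule smooth_near_bilinear[OF bounded_bilinear_blinfun_apply])
    (use assms smooth_\<xi> in \<open>auto simp: contact_form_def smooth_along_iff\<close>)

text \<open>Differentiating the equation \<open>d\<rho> (b) = 0\<close> along the hypersurface. This is how the derivatives of
  vector fields are eliminated from the bracket.\<close>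

lemma d\<rho>_derivative_of_tangent:
  assumes q: "q \<in> M" "q \<in> U" and b: "smooth_near M q b" and u: "u \<in> tangent_space M q"
    and ev: "eventually (\<lambda>x. d\<rho> x (b x) = 0) (near_in M q)"
  shows "d\<rho> q (frechet_derivative b (at q within M) u) = - Hess q u (b q)"
proof -
  have "eventually (\<lambda>x. grad x \<bullet> b x = 0) (near_in M q)"
    using ev near_U[OF q(2)] by eventually_elim (simp add: d\<rho>_inner)
  from frechet_within_cong[OF q(1) this]
  have "frechet_derivative (\<lambda>x. grad x \<bullet> b x) (at q within M) u = 0"
    using frechet_within_const[OF q(1) u] by simp
  then have "grad q \<bullet> frechet_derivative b (at q within M) u
      + frechet_derivative grad (at q within M) u \<bullet> b q = 0"
    using frechet_within_bilinear[OF q(1) smooth_grad[OF q(2)] b u bounded_bilinear_inner] by simp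
  moreover have "frechet_derivative grad (at q within M) u \<bullet> b q = Hess q u (b q)"
  proof -
    have "frechet_derivative grad (at q within M) u \<bullet> b q
        = frechet_derivative (\<lambda>x. grad x \<bullet> b q) (at q within M) u"
      by (rule frechet_within_linear_comp[OF q(1) smooth_grad[OF q(2)] u
            bounded_linear_inner_left, symmetric])
    also have "\<dots> = frechet_derivative (\<lambda>x. d\<rho> x (b q)) (at q within M) u"
    proof -
      have "eventually (\<lambda>x. grad x \<bullet> b q = d\<rho> x (b q)) (near_in M q)"
        using near_U[OF q(2)] by eventually_elim (simp add: d\<rho>_inner)
      then show ?thesis using frechet_within_cong[OF q(1)] by metis
    qed
    also have "\<dots> = Hess q u (b q)"
      by (rule frechet_within[OF q(1) has_derivative_at_withinI[OF has_derivative_Hess[OF q(2)]] u])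
    finally show ?thesis .
  qed
  ultimately show ?thesis using q by (simp add: d\<rho>_inner)
qed

lemma frechet_of_type:
  assumes q: "q \<in> M" "q \<in> U" and X: "smooth_near M q X" and u: "u \<in> tangent_space M q"
    and ev: "eventually (\<lambda>x. snd (X x) = s *\<^sub>R J (fst (X x))) (near_in M q)"
  shows "frechet_derivative X (at q within M) u
    = (frechet_derivative (\<lambda>x. fst (X x)) (at q within M) u,
       s *\<^sub>R J (frechet_derivative (\<lambda>x. fst (X x)) (at q within M) u))"
proof -
  have L: "bounded_linear (\<lambda>v. (v, s *\<^sub>R J v))"
    by (intro bounded_linear_Pair bounded_linear_ident bounded_linear_const_scaleR bounded_linear_J)
  have "eventually (\<lambda>x. X x = (fst (X x), s *\<^sub>R J (fst (X x)))) (near_in M q)"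
    using ev by eventually_elim (simp add: prod_eq_iff)
  from frechet_within_cong[OF q(1) this]
  show ?thesis
    using frechet_within_linear_comp[OF q(1) smooth_near_linear_comp[OF bounded_linear_fst X] u L] by simp
qed

text \<open>For \<open>X = (a, - J a)\<close> and \<open>Y = (b, J b)\<close> the bracket is \<open>(\<beta> - \<alpha>, J (\<beta> + \<alpha>))\<close>, where \<open>\<beta>\<close> involves
  derivatives of \<open>b\<close> and \<open>\<alpha>\<close> derivatives of \<open>a\<close>. Differentiating the equations that say that \<open>a\<close> and
  \<open>b\<close> lie in the complex tangent space expresses \<open>d\<rho>\<close> and \<open>d\<rho> \<circ> J\<close> of these vectors by the Hessian.
  Its symmetry shows that the bracket is tangent, so that the contact form may be replaced by a
  multiple of \<open>d\<rho> \<circ> J\<close>.\<close>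

theorem contact_bracket_eq:
  assumes q: "q \<in> M" "q \<in> U" and \<theta>: "contact_form M \<theta>"
    and X: "smooth_near M q X" and XH: "eventually (\<lambda>x. X x \<in> H10 M x) (near_in M q)"
    and Y: "smooth_near M q Y" and YH: "eventually (\<lambda>x. Y x \<in> H01 M x) (near_in M q)"
  shows "contact_bracket M \<theta> X Y q = 2 * \<i> * contact_coeff \<theta> q * levi q (fst (X q)) (fst (Y q))"
proof -
  define a where "a = fst (X q)"
  define b where "b = fst (Y q)"
  define Da where "Da = frechet_derivative (\<lambda>x. fst (X x)) (at q within M)"
  define Db where "Db = frechet_derivative (\<lambda>x. fst (Y x)) (at q within M)"
  have aS: "smooth_near M q (\<lambda>x. fst (X x))" and bS: "smooth_near M q (\<lambda>x. fst (Y x))"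
    using smooth_near_linear_comp[OF bounded_linear_fst] X Y by blast+
  have lin: "linear Da" "linear Db"
    unfolding Da_def Db_def using linear_frechet_within q aS bS by blast+
  have evX: "eventually (\<lambda>x. fst (X x) \<in> complex_tangent_space M x \<and> snd (X x) = - J (fst (X x))
      \<and> d\<rho> x (fst (X x)) = 0 \<and> d\<rho> x (J (fst (X x))) = 0) (near_in M q)"
    using XH near_U[OF q(2)] by eventually_elim (simp add: H10_iff H_iff)
  have evY: "eventually (\<lambda>x. fst (Y x) \<in> complex_tangent_space M x \<and> snd (Y x) = J (fst (Y x))
      \<and> d\<rho> x (fst (Y x)) = 0 \<and> d\<rho> x (J (fst (Y x))) = 0) (near_in M q)"
    using YH near_U[OF q(2)] by eventually_elim (simp add: H01_iff H_iff)
  have Xq: "X q = (a, - J a)" and Yq: "Y q = (b, J b)"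
    and aH: "a \<in> complex_tangent_space M q" and bH: "b \<in> complex_tangent_space M q"
    using eventually_near_in_self[OF evX q(1)] eventually_near_in_self[OF evY q(1)]
    by (auto simp: a_def b_def prod_eq_iff)
  have tan: "a \<in> tangent_space M q" "J a \<in> tangent_space M q" "- J a \<in> tangent_space M q"
    "b \<in> tangent_space M q" "J b \<in> tangent_space M q"
    using aH bH q by (auto simp: H_iff tangent_iff d\<rho>_lin)
  have DX: "frechet_derivative X (at q within M) u = (Da u, - J (Da u))" if "u \<in> tangent_space M q" for u
    using frechet_of_type[OF q X that, of "-1"] evX by (simp add: Da_def eventually_conj_iff)
  have DY: "frechet_derivative Y (at q within M) u = (Db u, J (Db u))" if "u \<in> tangent_space M q" for u
    using frechet_of_type[OF q Y that, of 1] evY by (simp add: Db_def eventually_conj_iff)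
  have FJ: "frechet_derivative (\<lambda>x. J (fst (X x))) (at q within M) u = J (Da u)"
    "frechet_derivative (\<lambda>x. J (fst (Y x))) (at q within M) u = J (Db u)"
    if "u \<in> tangent_space M q" for u
    unfolding Da_def Db_def
    by (rule frechet_within_linear_comp[OF q(1) _ that bounded_linear_J], fact)+
  have da: "d\<rho> q (Da u) = - Hess q u a" "d\<rho> q (J (Da u)) = - Hess q u (J a)"
    if u: "u \<in> tangent_space M q" for u
    using d\<rho>_derivative_of_tangent[OF q aS u] d\<rho>_derivative_of_tangent[OF q smooth_J[OF aS] u] evX FJ[OF u]
    by (simp_all add: Da_def a_def eventually_conj_iff)
  have db: "d\<rho> q (Db u) = - Hess q u b" "d\<rho> q (J (Db u)) = - Hess q u (J b)"
    if u: "u \<in> tangent_space M q" for u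
    using d\<rho>_derivative_of_tangent[OF q bS u] d\<rho>_derivative_of_tangent[OF q smooth_J[OF bS] u] evY FJ[OF u]
    by (simp_all add: Db_def b_def eventually_conj_iff)
  define \<alpha> where "\<alpha> = Da b + J (Da (J b))"
  define \<beta> where "\<beta> = Db a + J (Db (J a))"
  have "field_deriv M X Y q = (\<beta>, J \<beta>)"
    using tan DY by (simp add: field_deriv_def Xq cscale_def \<beta>_def linear_neg[OF lin(2)] J_add J_neg)
  moreover have "field_deriv M Y X q = (\<alpha>, - J \<alpha>)"
    using tan DX by (simp add: field_deriv_def Yq cscale_def \<alpha>_def J_add J_neg)
  ultimately have br: "bracket M X Y q = (\<beta> - \<alpha>, J (\<beta> + \<alpha>))"
    by (simp add: bracket_def J_add)
  have d\<alpha>: "d\<rho> q \<alpha> = - Hess q b a - Hess q (J b) (J a)" "d\<rho> q (J \<alpha>) = - Hess q b (J a) + Hess q (J b) a"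
    using q tan da by (simp_all add: \<alpha>_def d\<rho>_lin J_add)
  have d\<beta>: "d\<rho> q \<beta> = - Hess q a b - Hess q (J a) (J b)" "d\<rho> q (J \<beta>) = - Hess q a (J b) + Hess q (J a) b"
    using q tan db by (simp_all add: \<beta>_def d\<rho>_lin J_add)
  note sym = Hess_sym[OF q(2), of b] Hess_sym[OF q(2), of "J b"]
  have t1: "\<beta> - \<alpha> \<in> tangent_space M q" "J (\<beta> + \<alpha>) \<in> tangent_space M q"
    using q d\<alpha> d\<beta> sym by (simp_all add: tangent_iff d\<rho>_lin J_add)
  have "contact_bracket M \<theta> X Y q
      = contact_coeff \<theta> q * (complex_of_real (d\<rho> q (J (\<beta> - \<alpha>))) + \<i> * d\<rho> q (J (J (\<beta> + \<alpha>))))"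
    using contact_form_eq[OF q \<theta> t1(1)] contact_form_eq[OF q \<theta> t1(2)]
    by (simp add: contact_bracket_def br cpair_def algebra_simps)
  also have "\<dots> = 2 * \<i> * contact_coeff \<theta> q * levi q a b"
  proof -
    have e1: "d\<rho> q (J (\<beta> - \<alpha>)) = 2 * (Hess q (J a) b - Hess q a (J b))"
      using q d\<alpha> d\<beta> sym by (simp add: d\<rho>_lin J_diff)
    have e2: "d\<rho> q (J (J (\<beta> + \<alpha>))) = 2 * (Hess q a b + Hess q (J a) (J b))"
      using q d\<alpha> d\<beta> sym by (simp add: d\<rho>_lin)
    show ?thesis unfolding e1 e2 levi_def hproj_id[OF q aH] hproj_id[OF q bH]
      by (simp add: complex_eq_iff algebra_simps)
  qed
  finally show ?thesis by (simp add: a_def b_def)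
qed

end

subsection \<open>A global contact form\<close>

text \<open>Passing to another local defining function multiplies the differential by a factor, which
  cancels here; so the local formula gives a form on all of the hypersurface.\<close>

definition chart_form :: "(complex^'n \<Rightarrow> real) \<Rightarrow> complex^'n \<Rightarrow> complex^'n \<Rightarrow> complex^'n \<Rightarrow> real" where
  "chart_form \<rho> e q v = frechet_derivative \<rho> (at q) e * frechet_derivative \<rho> (at q) (J v)
     / (\<Sum>b\<in>Basis. (frechet_derivative \<rho> (at q) b)\<^sup>2)"

context hypersurface
begin

lemma chart_form_unique:
  assumes q: "q \<in> M" "q \<in> U" "q \<in> V" and "hypersurface_chart M U \<rho>" "hypersurface_chart M V \<sigma>"
  shows "chart_form \<rho> e q v = chart_form \<sigma> e q v"
proof -
  interpret U: hypersurface_chart M U \<rho> by fact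
  interpret V: hypersurface_chart M V \<sigma> by fact
  obtain n where n: "U.d\<rho> q n > 0" using U.d\<rho>_nonzero q by blast
  define t where "t = V.d\<rho> q n / U.d\<rho> q n"
  note lU = U.linear_d\<rho>[OF q(2)] and lV = V.linear_d\<rho>[OF q(3)]
  have eq: "V.d\<rho> q w = t * U.d\<rho> q w" for w
  proof -
    have "U.d\<rho> q (w - (U.d\<rho> q w / U.d\<rho> q n) *\<^sub>R n) = 0"
      using n by (simp add: linear_diff[OF lU] linear_scale[OF lU])
    then have "V.d\<rho> q (w - (U.d\<rho> q w / U.d\<rho> q n) *\<^sub>R n) = 0"
      using U.tangent_space_eq[OF q(1,2)] V.tangent_space_eq[OF q(1,3)] by blast
    then show ?thesis by (simp add: linear_diff[OF lV] linear_scale[OF lV] t_def)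
  qed
  have "t \<noteq> 0" using V.d\<rho>_nonzero[OF q(1,3)] eq by auto
  have s: "(\<Sum>b\<in>Basis. (V.d\<rho> q b)\<^sup>2) = t\<^sup>2 * (\<Sum>b\<in>Basis. (U.d\<rho> q b)\<^sup>2)"
    by (simp add: eq power_mult_distrib sum_distrib_left)
  have "chart_form \<sigma> e q v = V.d\<rho> q e * V.d\<rho> q (J v) / (\<Sum>b\<in>Basis. (V.d\<rho> q b)\<^sup>2)"
    by (simp add: chart_form_def V.d\<rho>_def)
  also have "\<dots> = U.d\<rho> q e * U.d\<rho> q (J v) / (\<Sum>b\<in>Basis. (U.d\<rho> q b)\<^sup>2)"
    unfolding s eq[of e] eq[of "J v"] using \<open>t \<noteq> 0\<close> by (simp add: power2_eq_square)
  also have "\<dots> = chart_form \<rho> e q v"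
    by (simp add: chart_form_def U.d\<rho>_def)
  finally show ?thesis by simp
qed

definition global_contact_form :: "complex^'n \<Rightarrow> complex^'n \<Rightarrow> (complex^'n) \<Rightarrow>\<^sub>L real" where
  "global_contact_form e q = (\<Sum>b\<in>Basis. chart_form (SOME \<rho>. \<exists>U. q \<in> U \<and> hypersurface_chart M U \<rho>) e q b
     *\<^sub>R blinfun_inner_left b)"

end

context levi_chart
begin

lemma global_contact_form_apply:
  assumes q: "q \<in> M" "q \<in> U"
  shows "global_contact_form e q = (\<Sum>b\<in>Basis. (d\<rho> q e * d\<rho> q (J b) / grad_sq q) *\<^sub>R blinfun_inner_left b)"
    and "blinfun_apply (global_contact_form e q) v = d\<rho> q e * d\<rho> q (J v) / grad_sq q"
proof -
  have "\<exists>\<rho> U. q \<in> U \<and> hypersurface_chart M U \<rho>" using q hypersurface_chart_axioms by blast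
  from someI_ex[OF this] obtain V where
    "q \<in> V" "hypersurface_chart M V (SOME \<rho>. \<exists>U. q \<in> U \<and> hypersurface_chart M U \<rho>)" by blast
  then have "chart_form (SOME \<rho>. \<exists>U. q \<in> U \<and> hypersurface_chart M U \<rho>) e q b = chart_form \<rho> e q b" for b
    using chart_form_unique q hypersurface_chart_axioms by blast
  moreover have "grad_sq q = (\<Sum>b\<in>Basis. (d\<rho> q b)\<^sup>2)"
    using q by (simp add: grad_sq_def euclidean_inner[of "grad q" "grad q"] d\<rho>_inner power2_eq_square)
  ultimately show 1: "global_contact_form e q = (\<Sum>b\<in>Basis. (d\<rho> q e * d\<rho> q (J b) / grad_sq q) *\<^sub>R blinfun_inner_left b)"
    by (simp add: global_contact_form_def chart_form_def d\<rho>_def)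
  have l: "linear (\<lambda>v. d\<rho> q e * d\<rho> q (J v) / grad_sq q)"
    using q by (intro linearI) (simp_all add: d\<rho>_lin J_add J_scaleR algebra_simps add_divide_distrib)
  have "blinfun_apply (global_contact_form e q) v = (\<Sum>b\<in>Basis. (v \<bullet> b) *\<^sub>R (d\<rho> q e * d\<rho> q (J b) / grad_sq q))"
    by (simp add: 1 blinfun.sum_left blinfun.scaleR_left inner_commute mult.commute)
  also have "\<dots> = d\<rho> q e * d\<rho> q (J (\<Sum>b\<in>Basis. (v \<bullet> b) *\<^sub>R b)) / grad_sq q"
    by (simp only: linear_sum[OF l] linear_scale[OF l])
  also have "\<dots> = d\<rho> q e * d\<rho> q (J v) / grad_sq q" by (simp only: euclidean_representation)
  finally show "blinfun_apply (global_contact_form e q) v = d\<rho> q e * d\<rho> q (J v) / grad_sq q" .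
qed

lemma smooth_global_contact_form: "q \<in> M \<Longrightarrow> q \<in> U \<Longrightarrow> smooth_near M q (global_contact_form e)"
proof (rule smooth_near_cong_ev)
  assume q: "q \<in> M" "q \<in> U"
  have "grad_sq q \<noteq> 0" using grad_sq_pos[OF q] by simp
  then show "smooth_near M q (\<lambda>x. \<Sum>b\<in>Basis. (d\<rho> x e * d\<rho> x (J b) / grad_sq x) *\<^sub>R blinfun_inner_left b)"
    using q by (intro smooth_near_sum smooth_near_scaleR smooth_near_const smooth_near_divide smooth_near_mult
      smooth_d\<rho>_const smooth_grad_sq) auto
  show "eventually (\<lambda>x. (\<Sum>b\<in>Basis. (d\<rho> x e * d\<rho> x (J b) / grad_sq x) *\<^sub>R blinfun_inner_left b) = global_contact_form e x) (near_in M q)"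
    using near_U[OF q(2)] by eventually_elim (simp add: global_contact_form_apply)
qed

lemma global_contact_form_grad: "q \<in> M \<Longrightarrow> q \<in> U \<Longrightarrow> contact_coeff (global_contact_form (grad q)) q = 1"
  using grad_sq_pos[of q] by (simp add: contact_coeff_def global_contact_form_apply(2) d\<rho>_grad \<xi>)

end

lemma (in hypersurface) contact_form_global: "contact_form M (global_contact_form e)"
  unfolding contact_form_def smooth_along_iff
proof safe
  fix q assume q: "q \<in> M"
  obtain U \<rho> where c: "q \<in> U" "hypersurface_chart M U \<rho>" using chart_at q by blast
  interpret levi_chart M U \<rho> using c(2) by (intro levi_chart.intro hypersurface_axioms)
  show "smooth_near M q (global_contact_form e)" using smooth_global_contact_form q c by blast
  show "blinfun_apply (global_contact_form e q) v = 0" if "v \<in> complex_tangent_space M q" for v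
    using that q c(1) by (simp add: global_contact_form_apply(2) H_iff)
qed

section \<open>Tensors with values in the quotient bundle\<close>

text \<open>Complex linearity, including closure of the domain under the operations, as the tensors are
  undefined outside their domains.\<close>

definition clin_on :: "'n cxvec set \<Rightarrow> ('n::finite cxvec \<Rightarrow> complex) \<Rightarrow> bool" where
  "clin_on S f \<longleftrightarrow> (\<forall>x\<in>S. \<forall>y\<in>S. x + y \<in> S \<and> f (x + y) = f x + f y) \<and>
     (\<forall>c. \<forall>x\<in>S. cscale c x \<in> S \<and> f (cscale c x) = c * f x)"

locale point_chart = levi_chart M U \<rho> for M U :: "(complex^'n) set" and \<rho> +
  fixes p :: "complex^'n"
  assumes p: "p \<in> M" "p \<in> U"
begin

text \<open>A contact form on all of \<open>M\<close> with coefficient \<open>1\<close> at \<open>p\<close>; pairing with it identifies the quotient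
  with the complex numbers. The inverse of this identification is \<open>\<kappa>\<close>.\<close>

definition \<theta>p :: "complex^'n \<Rightarrow> (complex^'n) \<Rightarrow>\<^sub>L real" where
  "\<theta>p = global_contact_form (grad p)"

lemma contact_\<theta>p: "contact_form M \<theta>p" and contact_coeff_\<theta>p: "contact_coeff \<theta>p p = 1"
  using contact_form_global global_contact_form_grad[OF p] by (simp_all add: \<theta>p_def)

definition \<phi> :: "'n cxvec \<Rightarrow> complex" where
  "\<phi> w = complex_of_real (d\<rho> p (J (fst w))) + \<i> * complex_of_real (d\<rho> p (J (snd w)))"

definition \<kappa> :: "complex \<Rightarrow> 'n cxvec set" where
  "\<kappa> z = {w \<in> CT M p. \<phi> w = z}"

lemma CT_iff: "w \<in> CT M p \<longleftrightarrow> d\<rho> p (fst w) = 0 \<and> d\<rho> p (snd w) = 0"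
  by (simp add: CT_def mem_Times_iff tangent_iff p)

lemma CT_closed: "v \<in> CT M p \<Longrightarrow> w \<in> CT M p \<Longrightarrow> v + w \<in> CT M p"
  "v \<in> CT M p \<Longrightarrow> cscale c v \<in> CT M p" "v \<in> CT M p \<Longrightarrow> cconj v \<in> CT M p"
  by (simp_all add: CT_iff cscale_def cconj_def d\<rho>_lin p)

lemma \<phi>_lin: "\<phi> (v + w) = \<phi> v + \<phi> w" "\<phi> (cscale c v) = c * \<phi> v"
  by (simp_all add: \<phi>_def cscale_def d\<rho>_lin p J_add J_diff J_scaleR complex_eq_iff algebra_simps)

lemma CQ_rel_eq: "CQ_rel M p = {(v, w). v \<in> CT M p \<and> w \<in> CT M p \<and> \<phi> v = \<phi> w}"
proof -
  have "v - w \<in> CH M p \<longleftrightarrow> \<phi> v = \<phi> w" if "v \<in> CT M p" "w \<in> CT M p" for v w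
    using that by (auto simp: CH_def mem_Times_iff H_iff p CT_iff d\<rho>_lin J_diff \<phi>_def complex_eq_iff)
  then show ?thesis by (auto simp: CQ_rel_def)
qed

lemma CQ_rel_image: "v \<in> CT M p \<Longrightarrow> CQ_rel M p `` {v} = \<kappa> (\<phi> v)"
  by (auto simp: CQ_rel_eq \<kappa>_def)

lemma \<phi>_surj: "\<exists>v\<in>CT M p. \<phi> v = z"
  by (rule bexI[of _ "(Re z *\<^sub>R \<xi> p, Im z *\<^sub>R \<xi> p)"])
    (simp_all add: \<phi>_def CT_iff d\<rho>_lin J_scaleR \<xi> p complex_eq_iff)

lemma CQ_eq: "CQ M p = range \<kappa>"
proof -
  have "CQ M p = (\<lambda>v. CQ_rel M p `` {v}) ` CT M p" by (auto simp: CQ_def quotient_def)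
  also have "\<dots> = (\<lambda>v. \<kappa> (\<phi> v)) ` CT M p" by (intro image_cong CQ_rel_image) auto
  also have "\<dots> = range \<kappa>" using \<phi>_surj by (auto simp: image_iff) metis
  finally show ?thesis .
qed

lemma CQ_zero_eq: "CQ_zero M p = \<kappa> 0"
proof -
  have "0 \<in> CT M p" "\<phi> 0 = 0"
    using d\<rho>_lin(4)[OF p(2), of 0 0] by (simp_all add: CT_iff \<phi>_def J_zero)
  then show ?thesis using CQ_rel_image[of 0] by (simp add: CQ_zero_def)
qed

lemma CQ_add_\<kappa>: "CQ_add M p (\<kappa> y) (\<kappa> z) = \<kappa> (y + z)"
proof -
  have 1: "CQ_rel M p `` {a + b} = \<kappa> (y + z)" if "a \<in> \<kappa> y" "b \<in> \<kappa> z" for a b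
    using that CQ_rel_image[OF CT_closed(1)] by (simp add: \<kappa>_def \<phi>_lin)
  obtain a b where "a \<in> \<kappa> y" "b \<in> \<kappa> z" using \<phi>_surj by (fastforce simp: \<kappa>_def)
  then show ?thesis unfolding CQ_add_def using 1 by blast
qed

lemma CQ_scale_\<kappa>: "CQ_scale M p c (\<kappa> z) = \<kappa> (c * z)"
proof -
  have 1: "CQ_rel M p `` {cscale c a} = \<kappa> (c * z)" if "a \<in> \<kappa> z" for a
    using that CQ_rel_image[OF CT_closed(2)] by (simp add: \<kappa>_def \<phi>_lin)
  obtain a where "a \<in> \<kappa> z" using \<phi>_surj by (fastforce simp: \<kappa>_def)
  then show ?thesis unfolding CQ_scale_def using 1 by blast
qed

lemma CQ_pair_\<kappa>:
  fixes z :: complex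
  assumes "contact_form M \<theta>" shows "CQ_pair (\<theta> p) (\<kappa> z) = contact_coeff \<theta> p * z"
proof -
  have "cpair (\<theta> p) w = contact_coeff \<theta> p * \<phi> w" if "w \<in> CT M p" for w
    using contact_form_eq[OF p assms CT_D(1)[OF that]] contact_form_eq[OF p assms CT_D(2)[OF that]]
    by (simp add: cpair_def \<phi>_def algebra_simps)
  then have 1: "cpair (\<theta> p) w = contact_coeff \<theta> p * z" if "w \<in> \<kappa> z" for w
    using that by (simp add: \<kappa>_def)
  obtain a where a: "a \<in> \<kappa> z" using \<phi>_surj by (fastforce simp: \<kappa>_def)
  have "cpair (\<theta> p) ` \<kappa> z = {contact_coeff \<theta> p * z}"
    using 1 imageI[OF a, of "cpair (\<theta> p)"] 1[OF a] by auto
  then show ?thesis by (simp add: CQ_pair_def)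
qed

lemma CQ_pair_\<theta>p: "CQ_pair (\<theta>p p) (\<kappa> z) = z"
  by (simp add: CQ_pair_\<kappa> contact_\<theta>p contact_coeff_\<theta>p)

lemma \<kappa>_inject [simp]: "\<kappa> y = \<kappa> z \<longleftrightarrow> y = z"
  using CQ_pair_\<theta>p by metis

lemma CQ_eqI:
  assumes "A \<in> CQ M p" "CQ_pair (\<theta>p p) A = z" shows "A = \<kappa> z"
  using assms CQ_pair_\<theta>p by (auto simp: CQ_eq)

lemma CQ_linear_on_\<kappa>:
  assumes "clin_on S f" "\<And>x. x \<in> S \<Longrightarrow> g x = \<kappa> (f x)"
  shows "CQ_linear_on M p S g"
  using assms by (simp add: CQ_linear_on_def clin_on_def CQ_add_\<kappa> CQ_scale_\<kappa>)

lemma tensor2I: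
  assumes "\<And>b. b \<in> B \<Longrightarrow> clin_on A (\<lambda>x. f x b)" "\<And>a. a \<in> A \<Longrightarrow> clin_on B (f a)"
  shows "tensor2 M p A B (restrict (\<lambda>(a, b). \<kappa> (f a b)) (A \<times> B))"
  unfolding tensor2_def
proof (intro conjI ballI)
  show "CQ_linear_on M p A (\<lambda>x. restrict (\<lambda>(a, b). \<kappa> (f a b)) (A \<times> B) (x, b))" if "b \<in> B" for b
    by (rule CQ_linear_on_\<kappa>[OF assms(1)[OF that]]) (simp add: that)
  show "CQ_linear_on M p B (\<lambda>x. restrict (\<lambda>(a, b). \<kappa> (f a b)) (A \<times> B) (a, x))" if "a \<in> A" for a
    by (rule CQ_linear_on_\<kappa>[OF assms(2)[OF that]]) (simp add: that)
qed (auto simp: CQ_eq)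

lemma tensor3I:
  assumes "\<And>b c. b \<in> B \<Longrightarrow> c \<in> C \<Longrightarrow> clin_on A (\<lambda>x. f x b c)"
    "\<And>a c. a \<in> A \<Longrightarrow> c \<in> C \<Longrightarrow> clin_on B (\<lambda>x. f a x c)"
    "\<And>a b. a \<in> A \<Longrightarrow> b \<in> B \<Longrightarrow> clin_on C (f a b)"
  shows "tensor3 M p A B C (restrict (\<lambda>(a, b, c). \<kappa> (f a b c)) (A \<times> B \<times> C))" (is "tensor3 M p A B C ?t")
  unfolding tensor3_def
proof (intro conjI ballI)
  show "CQ_linear_on M p A (\<lambda>x. ?t (x, b, c))" if "b \<in> B" "c \<in> C" for b c
    by (rule CQ_linear_on_\<kappa>[OF assms(1)[OF that]]) (simp add: that)
  show "CQ_linear_on M p B (\<lambda>x. ?t (a, x, c))" if "a \<in> A" "c \<in> C" for a c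
    by (rule CQ_linear_on_\<kappa>[OF assms(2)[OF that]]) (simp add: that)
  show "CQ_linear_on M p C (\<lambda>x. ?t (a, b, x))" if "a \<in> A" "b \<in> B" for a b
    by (rule CQ_linear_on_\<kappa>[OF assms(3)[OF that]]) (simp add: that)
qed (auto simp: CQ_eq)

lemma tensor4I:
  assumes "\<And>b c d. b \<in> B \<Longrightarrow> c \<in> C \<Longrightarrow> d \<in> D \<Longrightarrow> clin_on A (\<lambda>x. f x b c d)"
    "\<And>a c d. a \<in> A \<Longrightarrow> c \<in> C \<Longrightarrow> d \<in> D \<Longrightarrow> clin_on B (\<lambda>x. f a x c d)"
    "\<And>a b d. a \<in> A \<Longrightarrow> b \<in> B \<Longrightarrow> d \<in> D \<Longrightarrow> clin_on C (\<lambda>x. f a b x d)"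
    "\<And>a b c. a \<in> A \<Longrightarrow> b \<in> B \<Longrightarrow> c \<in> C \<Longrightarrow> clin_on D (f a b c)"
  shows "tensor4 M p A B C D (restrict (\<lambda>(a, b, c, d). \<kappa> (f a b c d)) (A \<times> B \<times> C \<times> D))"
    (is "tensor4 M p A B C D ?t")
  unfolding tensor4_def
proof (intro conjI ballI)
  show "CQ_linear_on M p A (\<lambda>x. ?t (x, b, c, d))" if "b \<in> B" "c \<in> C" "d \<in> D" for b c d
    by (rule CQ_linear_on_\<kappa>[OF assms(1)[OF that]]) (simp add: that)
  show "CQ_linear_on M p B (\<lambda>x. ?t (a, x, c, d))" if "a \<in> A" "c \<in> C" "d \<in> D" for a c d
    by (rule CQ_linear_on_\<kappa>[OF assms(2)[OF that]]) (simp add: that)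
  show "CQ_linear_on M p C (\<lambda>x. ?t (a, b, x, d))" if "a \<in> A" "b \<in> B" "d \<in> D" for a b d
    by (rule CQ_linear_on_\<kappa>[OF assms(3)[OF that]]) (simp add: that)
  show "CQ_linear_on M p D (\<lambda>x. ?t (a, b, c, x))" if "a \<in> A" "b \<in> B" "c \<in> C" for a b c
    by (rule CQ_linear_on_\<kappa>[OF assms(4)[OF that]]) (simp add: that)
qed (auto simp: CQ_eq)

subsection \<open>Extending vectors to fields\<close>

definition field10 :: "(complex^'n \<Rightarrow> complex^'n) \<Rightarrow> complex^'n \<Rightarrow> 'n cxvec" where
  "field10 a q = (hproj q (a q), - J (hproj q (a q)))"

definition fieldT :: "'n cxvec \<Rightarrow> complex^'n \<Rightarrow> 'n cxvec" where
  "fieldT w q = (tproj q (fst w), tproj q (snd w))"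

lemma field10_section:
  assumes "smooth_near M p a" shows "local_section M p (H10 M) (field10 a)"
  unfolding local_section_iff[OF p(1)]
proof
  show "smooth_near M p (field10 a)"
    unfolding field10_def[abs_def]
    by (intro smooth_near_Pair smooth_near_minus smooth_J smooth_hproj p assms)
  show "eventually (\<lambda>x. field10 a x \<in> H10 M x) (near_in M p)"
    using near_U[OF p(2)] by eventually_elim (simp add: H10_iff hproj_H field10_def)
qed

lemma ct_fieldT: "ct_field p (fieldT w)"
  unfolding ct_field_def
proof
  show "smooth_near M p (fieldT w)"
    unfolding fieldT_def[abs_def] by (intro smooth_near_Pair smooth_tproj p smooth_near_const)
  show "eventually (\<lambda>x. fieldT w x \<in> CT M x) (near_in M p)"
    using near_U[OF p(2)] by eventually_elim (simp add: CT_def tproj_tangent fieldT_def)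
qed

lemma fieldT_at: "w \<in> CT M p \<Longrightarrow> fieldT w p = w"
  by (simp add: fieldT_def tproj_id p CT_D prod_eq_iff)

lemma local_section_fieldT: "local_section M p (CT M) (fieldT w)"
  using ct_fieldT ct_field_iff p by blast

lemma field10_at: "a p \<in> complex_tangent_space M p \<Longrightarrow> field10 a p = (a p, - J (a p))"
  by (simp add: field10_def hproj_id p)

lemma cconj_cconj [simp]: "cconj (cconj w) = w"
  by (simp add: cconj_def)

lemma H01_cconj: "q \<in> M \<Longrightarrow> q \<in> U \<Longrightarrow> cconj w \<in> H10 M q \<longleftrightarrow> w \<in> H01 M q"
  by (simp add: H10_iff H01_iff cconj_def)

lemma bounded_linear_cconj: "bounded_linear (cconj :: 'n cxvec \<Rightarrow> 'n cxvec)"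
  unfolding cconj_def
  by (intro bounded_linear_Pair bounded_linear_fst bounded_linear_minus bounded_linear_snd)

lemma section01_iff: "local_section M p (H01 M) L \<longleftrightarrow> local_section M p (H10 M) (cconj \<circ> L)"
proof -
  have "smooth_near M p (cconj \<circ> L) \<longleftrightarrow> smooth_near M p L"
    using smooth_near_linear_comp[OF bounded_linear_cconj, of M p L]
      smooth_near_linear_comp[OF bounded_linear_cconj, of M p "cconj \<circ> L"] by (auto simp: o_def)
  moreover have "eventually (\<lambda>x. cconj (L x) \<in> H10 M x) (near_in M p) \<longleftrightarrow>
      eventually (\<lambda>x. L x \<in> H01 M x) (near_in M p)"
    by (rule eventually_subst) (use near_U[OF p(2)] in eventually_elim, simp add: H01_cconj)
  ultimately show ?thesis by (simp add: local_section_iff[OF p(1)])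
qed

lemma section_fst: "local_section M p E L \<Longrightarrow> smooth_near M p (\<lambda>x. fst (L x))"
  using smooth_near_linear_comp[OF bounded_linear_fst] local_section_iff[OF p(1)] by blast

lemma section_at: "local_section M p E L \<Longrightarrow> L p \<in> E p"
  using local_section_iff[OF p(1)] eventually_near_in_self[OF _ p(1)] by metis

lemma contact_bracket_near:
  assumes "contact_form M \<theta>" "local_section M p (H10 M) L2" "local_section M p (H01 M) L1"
  shows "eventually (\<lambda>x. contact_bracket M \<theta> L2 L1 x
     = (2 * \<i> * contact_coeff \<theta> x) * levi x (fst (L2 x)) (fst (L1 x))) (near_in M p)"
proof -
  have L: "smooth_near M p L2" "eventually (\<lambda>x. L2 x \<in> H10 M x) (near_in M p)"
    "smooth_near M p L1" "eventually (\<lambda>x. L1 x \<in> H01 M x) (near_in M p)"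
    using assms local_section_iff[OF p(1)] by auto
  show ?thesis
    using near_U[OF p(2)] smooth_near_eventually[OF L(1)] eventually_eventually_near_in[OF L(2)]
      smooth_near_eventually[OF L(3)] eventually_eventually_near_in[OF L(4)]
    by eventually_elim (simp add: contact_bracket_eq assms(1))
qed

lemma contact_bracket_at:
  assumes "contact_form M \<theta>" "local_section M p (H10 M) L2" "local_section M p (H01 M) L1"
  shows "contact_bracket M \<theta> L2 L1 p = 2 * \<i> * contact_coeff \<theta> p * levi p (fst (L2 p)) (fst (L1 p))"
  using eventually_near_in_self[OF contact_bracket_near[OF assms] p(1)] .

subsection \<open>The Levi form and its kernel\<close>

lemma cscale10: "w \<in> H10 M p \<Longrightarrow> fst (cscale c w) = c *s fst w"
  "w \<in> H01 M p \<Longrightarrow> fst (cscale c w) = cnj c *s fst w"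
  by (simp_all add: H10_iff H01_iff p cscale_def complex_scale_J)

lemma H_closed:
  "v \<in> complex_tangent_space M p \<Longrightarrow> w \<in> complex_tangent_space M p \<Longrightarrow> v + w \<in> complex_tangent_space M p"
  "v \<in> complex_tangent_space M p \<Longrightarrow> c *s v \<in> complex_tangent_space M p"
  by (simp_all add: H_iff p d\<rho>_lin J_add J_scaleR complex_scale_J)

lemma H10_closed: "v \<in> H10 M p \<Longrightarrow> w \<in> H10 M p \<Longrightarrow> v + w \<in> H10 M p" "v \<in> H10 M p \<Longrightarrow> cscale c v \<in> H10 M p"
  "v \<in> H01 M p \<Longrightarrow> w \<in> H01 M p \<Longrightarrow> v + w \<in> H01 M p" "v \<in> H01 M p \<Longrightarrow> cscale c v \<in> H01 M p"
proof -
  show "v \<in> H10 M p \<Longrightarrow> w \<in> H10 M p \<Longrightarrow> v + w \<in> H10 M p" "v \<in> H01 M p \<Longrightarrow> w \<in> H01 M p \<Longrightarrow> v + w \<in> H01 M p"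
    by (simp_all add: H10_iff H01_iff p H_closed J_add)
  show "cscale c v \<in> H10 M p" if v: "v \<in> H10 M p"
    unfolding H10_iff[OF p] cscale10(1)[OF v] using v
    by (simp add: H10_iff p H_closed) (simp add: cscale_def complex_scale_J J_add J_diff J_scaleR)
  show "cscale c v \<in> H01 M p" if v: "v \<in> H01 M p"
    unfolding H01_iff[OF p] cscale10(2)[OF v] using v
    by (simp add: H01_iff p H_closed) (simp add: cscale_def complex_scale_J J_add J_diff J_scaleR)
qed

text \<open>The formula has the defining property by \<open>contact_bracket_at\<close>. It is the only solution because every
  vector extends to a section and the pairing with \<open>\<theta>p\<close> is injective.\<close>

lemma levi_form_eq:
  "levi_form M p = restrict (\<lambda>(x, y). \<kappa> (- 2 * levi p (fst x) (fst y))) (H10 M p \<times> H01 M p)"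
  unfolding levi_form_def
proof (rule the_equality)
  show "tensor2 M p (H10 M p) (H01 M p) (restrict (\<lambda>(x, y). \<kappa> (- 2 * levi p (fst x) (fst y))) (H10 M p \<times> H01 M p)) \<and>
     (\<forall>L2 L1 \<theta>. local_section M p (H10 M) L2 \<and> local_section M p (H01 M) L1 \<and>
        contact_form M \<theta> \<longrightarrow>
        CQ_pair (\<theta> p) (restrict (\<lambda>(x, y). \<kappa> (- 2 * levi p (fst x) (fst y))) (H10 M p \<times> H01 M p) (L2 p, L1 p))
          = \<i> * contact_bracket M \<theta> L2 L1 p)"
  proof (intro conjI allI impI tensor2I)
    show "clin_on (H10 M p) (\<lambda>x. - 2 * levi p (fst x) (fst b))" for b
      by (auto simp: clin_on_def H10_closed cscale10 levi_lin levi_complex_scale p)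
    show "clin_on (H01 M p) (\<lambda>y. - 2 * levi p (fst a) (fst y))" for a
      by (auto simp: clin_on_def H10_closed cscale10 levi_lin levi_complex_scale p)
    show "CQ_pair (\<theta> p) (restrict (\<lambda>(x, y). \<kappa> (- 2 * levi p (fst x) (fst y))) (H10 M p \<times> H01 M p) (L2 p, L1 p))
          = \<i> * contact_bracket M \<theta> L2 L1 p"
      if "local_section M p (H10 M) L2 \<and> local_section M p (H01 M) L1 \<and> contact_form M \<theta>" for L2 L1 \<theta>
      using that section_at[of "H10 M" L2] section_at[of "H01 M" L1]
      by (simp add: CQ_pair_\<kappa> contact_bracket_at complex_eq_iff)
  qed
next
  fix \<tau> assume \<tau>: "tensor2 M p (H10 M p) (H01 M p) \<tau> \<and>
     (\<forall>L2 L1 \<theta>. local_section M p (H10 M) L2 \<and> local_section M p (H01 M) L1 \<and> contact_form M \<theta> \<longrightarrow>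
        CQ_pair (\<theta> p) (\<tau> (L2 p, L1 p)) = \<i> * contact_bracket M \<theta> L2 L1 p)"
  show "\<tau> = restrict (\<lambda>(x, y). \<kappa> (- 2 * levi p (fst x) (fst y))) (H10 M p \<times> H01 M p)"
  proof (rule extensionalityI[of _ "H10 M p \<times> H01 M p"])
    show "\<tau> \<in> extensional (H10 M p \<times> H01 M p)"
      using \<tau> by (auto simp: tensor2_def PiE_def)
    fix t assume t: "t \<in> H10 M p \<times> H01 M p"
    obtain x y where xy: "t = (x, y)" "x \<in> H10 M p" "y \<in> H01 M p" using t by auto
    let ?X = "field10 (\<lambda>q. fst x)" and ?Y = "cconj \<circ> field10 (\<lambda>q. fst y)"
    have s: "local_section M p (H10 M) ?X" "local_section M p (H01 M) ?Y"
      using field10_section[OF smooth_near_const] by (simp_all add: section01_iff o_def)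
    have v: "?X p = x" "?Y p = y"
      using xy by (auto simp: field10_at H10_iff H01_iff p cconj_def prod_eq_iff)
    have "CQ_pair (\<theta>p p) (\<tau> (x, y)) = \<i> * contact_bracket M \<theta>p ?X ?Y p"
      using \<tau> s contact_\<theta>p v by metis
    also have "\<dots> = - 2 * levi p (fst x) (fst y)"
      unfolding contact_bracket_at[OF contact_\<theta>p s] v contact_coeff_\<theta>p by (simp add: complex_eq_iff)
    finally have "CQ_pair (\<theta>p p) (\<tau> t) = - 2 * levi p (fst x) (fst y)" unfolding xy(1) .
    moreover have "\<tau> t \<in> CQ M p"
      using \<tau> t unfolding tensor2_def by (blast dest: PiE_mem)
    ultimately have "\<tau> t = \<kappa> (- 2 * levi p (fst x) (fst y))" by (intro CQ_eqI)
    then show "\<tau> t = restrict (\<lambda>(x, y). \<kappa> (- 2 * levi p (fst x) (fst y))) (H10 M p \<times> H01 M p) t"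
      using t by (simp add: xy(1))
  qed (rule restrict_extensional)
qed

text \<open>The Levi kernel at \<open>p\<close>, seen in the complex tangent space through \<open>a \<mapsto> (a, - J a)\<close>.\<close>

definition levi_null :: "(complex^'n) set" where
  "levi_null = {a \<in> complex_tangent_space M p. \<forall>u. levi p a u = 0}"

lemma levi_null_right: "a \<in> levi_null \<Longrightarrow> levi p u a = 0"
  using levi_herm[OF p(2), of u a] by (simp add: levi_null_def)

lemma levi_null_closed: "a \<in> levi_null \<Longrightarrow> b \<in> levi_null \<Longrightarrow> a + b \<in> levi_null" "a \<in> levi_null \<Longrightarrow> c *s a \<in> levi_null"
  by (simp_all add: levi_null_def H_closed levi_lin levi_complex_scale p)

lemma K10_iff: "w \<in> K10 M p \<longleftrightarrow> fst w \<in> levi_null \<and> snd w = - J (fst w)"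
proof -
  have u: "(hproj p u, - J (hproj p u)) \<in> H10 M p" for u
    by (simp add: H10_iff hproj_H p)
  have "(\<forall>u\<in>H10 M p. levi_form M p (w, cconj u) = CQ_zero M p) \<longleftrightarrow> (\<forall>u. levi p (fst w) u = 0)"
    if w: "w \<in> H10 M p"
  proof -
    have "levi_form M p (w, cconj u) = CQ_zero M p \<longleftrightarrow> levi p (fst w) (fst u) = 0" if "u \<in> H10 M p" for u
      using w that H01_cconj[OF p, of "cconj u"] by (simp add: levi_form_eq CQ_zero_eq) (simp add: cconj_def)
    then show ?thesis using u levi_hproj(2)[OF p, of "fst w"] by (metis fst_conv)
  qed
  then show ?thesis by (auto simp: K10_def levi_null_def H10_iff p)
qed

lemma K01_iff: "w \<in> K01 M p \<longleftrightarrow> fst w \<in> levi_null \<and> snd w = J (fst w)"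
proof -
  have "w \<in> K01 M p \<longleftrightarrow> cconj w \<in> K10 M p"
    by (auto simp: K01_def intro!: image_eqI[of w cconj "cconj w"])
  also have "\<dots> \<longleftrightarrow> fst w \<in> levi_null \<and> snd w = J (fst w)"
    unfolding K10_iff by (simp add: cconj_def)
  finally show ?thesis .
qed

lemma K_H: "w \<in> K10 M p \<Longrightarrow> w \<in> H10 M p" "w \<in> K01 M p \<Longrightarrow> w \<in> H01 M p"
  by (simp_all add: K10_iff K01_iff H10_iff H01_iff p levi_null_def)

lemma K_closed: "v \<in> K10 M p \<Longrightarrow> w \<in> K10 M p \<Longrightarrow> v + w \<in> K10 M p" "v \<in> K10 M p \<Longrightarrow> cscale c v \<in> K10 M p"
  "v \<in> K01 M p \<Longrightarrow> w \<in> K01 M p \<Longrightarrow> v + w \<in> K01 M p" "v \<in> K01 M p \<Longrightarrow> cscale c v \<in> K01 M p"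
proof -
  show "v + w \<in> K10 M p" if "v \<in> K10 M p" "w \<in> K10 M p"
    using that unfolding K10_iff by (simp add: J_add levi_null_closed)
  show "v + w \<in> K01 M p" if "v \<in> K01 M p" "w \<in> K01 M p"
    using that unfolding K01_iff by (simp add: J_add levi_null_closed)
  show "cscale c v \<in> K10 M p" if v: "v \<in> K10 M p"
  proof -
    have h: "v \<in> H10 M p" by (rule K_H(1)[OF v])
    show ?thesis using H10_closed(2)[OF h] v unfolding K10_iff H10_iff[OF p] cscale10(1)[OF h]
      by (simp add: levi_null_closed)
  qed
  show "cscale c v \<in> K01 M p" if v: "v \<in> K01 M p"
  proof -
    have h: "v \<in> H01 M p" by (rule K_H(2)[OF v])
    show ?thesis using H10_closed(4)[OF h] v unfolding K01_iff H01_iff[OF p] cscale10(2)[OF h]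
      by (simp add: levi_null_closed)
  qed
qed

end

section \<open>Derivatives of sums of products\<close>

context hypersurface
begin

lemma cderiv_sum_products_zero:
  assumes q: "q \<in> M" and w: "w \<in> CT M q"
    and z: "\<And>i. i \<in> I \<Longrightarrow> smooth_near M q (z i)" and g: "\<And>i. i \<in> I \<Longrightarrow> smooth_near M q (g i)"
    and g0: "\<And>i. i \<in> I \<Longrightarrow> g i q = 0"
    and zd: "\<And>i. i \<in> I \<Longrightarrow> z i q = 0 \<or> cderiv M (g i) q w = 0"
  shows "cderiv M (\<lambda>x. \<Sum>i\<in>I. z i x * g i x) q w = 0"
proof -
  have "cderiv M (\<lambda>x. \<Sum>i\<in>I. z i x * g i x) q w = (\<Sum>i\<in>I. cderiv M (\<lambda>x. z i x * g i x) q w)"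
    using z g by (intro cderiv_sum q w smooth_near_mult)
  also have "\<dots> = 0"
    using cderiv_mult[OF q z g w] g0 zd by (intro sum.neutral) force
  finally show ?thesis .
qed

text \<open>Each of the four terms of the second order Leibniz rule contains a factor that vanishes: the value of
  \<open>z\<close>, or the value or a first derivative of \<open>g\<close>.\<close>

lemma vderiv2_sum_products_zero:
  assumes q: "q \<in> M" and X: "ct_field q X" and Y: "ct_field q Y" and I: "finite I"
    and z: "\<And>i. i \<in> I \<Longrightarrow> smooth_near M q (z i)" and g: "\<And>i. i \<in> I \<Longrightarrow> smooth_near M q (g i)"
    and z0: "\<And>i. i \<in> I \<Longrightarrow> z i q = 0" and g0: "\<And>i. i \<in> I \<Longrightarrow> g i q = 0"
    and gX: "\<And>i. i \<in> I \<Longrightarrow> cderiv M (g i) q (X q) = 0" and gY: "\<And>i. i \<in> I \<Longrightarrow> cderiv M (g i) q (Y q) = 0"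
  shows "vderiv M Y (vderiv M X (\<lambda>x. \<Sum>i\<in>I. z i x * g i x)) q = 0"
proof -
  have "vderiv M Y (vderiv M X (\<lambda>x. \<Sum>i\<in>I. z i x * g i x)) q
      = (\<Sum>i\<in>I. vderiv M Y (vderiv M X (\<lambda>x. z i x * g i x)) q)"
    using z g by (intro vderiv2_sum q I X Y smooth_near_mult)
  also have "\<dots> = 0"
  proof (rule sum.neutral, rule ballI)
    fix i assume i: "i \<in> I"
    show "vderiv M Y (vderiv M X (\<lambda>x. z i x * g i x)) q = 0"
      unfolding vderiv2_mult[OF q z[OF i] g[OF i] X Y]
      using z0[OF i] g0[OF i] gX[OF i] gY[OF i] by (simp add: vderiv_eq_cderiv[of M _ "g i"])
  qed
  finally show ?thesis .
qed

lemma vderiv2_cmult_zero: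
  assumes q: "q \<in> M" and X: "ct_field q X" and Y: "ct_field q Y"
    and c: "smooth_near M q c" and f: "smooth_near M q f"
    and "f q = 0" "cderiv M f q (X q) = 0" "cderiv M f q (Y q) = 0"
  shows "vderiv M Y (vderiv M X (\<lambda>x. c x * f x)) q = c q * vderiv M Y (vderiv M X f) q"
  unfolding vderiv2_mult[OF q c f X Y] using assms(6-8) by (simp add: vderiv_eq_cderiv[of M _ f])

end

text \<open>The component of \<open>r\<close> orthogonal to the range lies in the kernel by symmetry, hence it is orthogonal to
  \<open>r\<close>, hence it is zero.\<close>

lemma symmetric_range:
  fixes T :: "'a::euclidean_space \<Rightarrow> 'a"
  assumes "linear T" and sym: "\<And>x y. T x \<bullet> y = x \<bullet> T y"
    and ker: "\<And>t. T t = 0 \<Longrightarrow> r \<bullet> t = 0"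
  shows "\<exists>x. T x = r"
proof -
  obtain y z where yz: "y \<in> span (range T)" "\<And>w. w \<in> span (range T) \<Longrightarrow> orthogonal z w" "r = y + z"
    using orthogonal_subspace_decomp_exists[of "range T" r] by metis
  have s: "span (range T) = range T"
    using linear_subspace_image[OF assms(1) subspace_UNIV] by (simp add: span_eq_iff)
  have "T z \<bullet> T z = 0" using yz(2)[of "T (T z)"] s sym[of z "T z"] by (simp add: orthogonal_def)
  then have "T z = 0" by simp
  then have "r \<bullet> z = 0" by (rule ker)
  moreover have "y \<bullet> z = 0" using yz(2)[OF yz(1)] by (simp add: orthogonal_def inner_commute)
  ultimately have "z = 0" using yz(3) by (simp add: inner_add_left)
  then show ?thesis using yz s by auto
qed

context point_chart
begin

section \<open>The cubic tensor\<close>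

lemma smooth_levi_p: "smooth_near M p a \<Longrightarrow> smooth_near M p b \<Longrightarrow> smooth_near M p (\<lambda>x. levi x (a x) (b x))"
  by (rule smooth_levi[OF p])

lemma smooth_coord: "smooth_near M p z \<Longrightarrow> smooth_near M p (\<lambda>x. complex_of_real (z x \<bullet> i))"
  by (intro smooth_near_linear_comp[OF bounded_linear_of_real] smooth_near_inner smooth_near_const)

lemma levi_expand_near:
  "eventually (\<lambda>x. levi x (z x) (b x) = (\<Sum>i\<in>Basis. complex_of_real (z x \<bullet> i) * levi x i (b x))) (near_in M p)"
  "eventually (\<lambda>x. levi x (b x) (z x) = (\<Sum>i\<in>Basis. complex_of_real (z x \<bullet> i) * levi x (b x) i)) (near_in M p)"
  by (rule eventually_mono[OF near_U[OF p(2)]], rule levi_expand, simp)+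

lemma cderiv_levi_herm:
  assumes b: "smooth_near M p b" and w: "w \<in> CT M p"
  shows "cderiv M (\<lambda>x. levi x (b x) i) p w = cnj (cderiv M (\<lambda>x. levi x i (b x)) p (cconj w))"
proof -
  have "eventually (\<lambda>x. levi x (b x) i = cnj (levi x i (b x))) (near_in M p)"
    using near_U[OF p(2)] by eventually_elim (simp add: levi_herm[of _ _ i])
  from cderiv_cong[OF p(1) this] show ?thesis
    using cderiv_cnj[OF p(1) smooth_levi_p[OF smooth_near_const b] w] by simp
qed

text \<open>In coordinates the function is a sum of products of two functions that both vanish at \<open>p\<close>.\<close>

lemma cderiv_levi_vanishing:
  assumes "smooth_near M p z" "smooth_near M p b" "z p = 0" "w \<in> CT M p"
  shows "(\<forall>i. levi p i (b p) = 0) \<Longrightarrow> cderiv M (\<lambda>x. levi x (z x) (b x)) p w = 0"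
    and "(\<forall>i. levi p (b p) i = 0) \<Longrightarrow> cderiv M (\<lambda>x. levi x (b x) (z x)) p w = 0"
proof -
  show "cderiv M (\<lambda>x. levi x (z x) (b x)) p w = 0" if "\<forall>i. levi p i (b p) = 0"
    unfolding cderiv_cong[OF p(1) levi_expand_near(1)] using assms that
    by (intro cderiv_sum_products_zero p smooth_coord smooth_levi_p smooth_near_const) auto
  show "cderiv M (\<lambda>x. levi x (b x) (z x)) p w = 0" if "\<forall>i. levi p (b p) i = 0"
    unfolding cderiv_cong[OF p(1) levi_expand_near(2)] using assms that
    by (intro cderiv_sum_products_zero p smooth_coord smooth_levi_p smooth_near_const) auto
qed

text \<open>Why the cubic tensor is well defined: changing \<open>a\<close> or \<open>b\<close> by a function that vanishes at \<open>p\<close> does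
  not affect the derivative as long as the values at \<open>p\<close> lie in the Levi kernel.\<close>

lemma cderiv_levi_kernel:
  assumes a: "smooth_near M p a" "a p \<in> levi_null" and b: "smooth_near M p b" "b p \<in> levi_null" and w: "w \<in> CT M p"
  shows "cderiv M (\<lambda>x. levi x (a x) (b x)) p w = cderiv M (\<lambda>x. levi x (a p) (b p)) p w"
proof -
  have "eventually (\<lambda>x. levi x (a x) (b x) = levi x (a x - a p) (b x) + (levi x (a p) (b x - b p) + levi x (a p) (b p))) (near_in M p)"
    using near_U[OF p(2)] by eventually_elim (simp add: levi_diff)
  from cderiv_cong[OF p(1) this, of w]
  have "cderiv M (\<lambda>x. levi x (a x) (b x)) p w = cderiv M (\<lambda>x. levi x (a x - a p) (b x)) p w
      + (cderiv M (\<lambda>x. levi x (a p) (b x - b p)) p w + cderiv M (\<lambda>x. levi x (a p) (b p)) p w)"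
    using a b by (simp add: cderiv_add p w smooth_levi_p smooth_near_add smooth_near_diff)
  moreover have "cderiv M (\<lambda>x. levi x (a x - a p) (b x)) p w = 0"
    using a b w by (intro cderiv_levi_vanishing(1) smooth_near_diff) (auto simp: levi_null_right)
  moreover have "cderiv M (\<lambda>x. levi x (a p) (b x - b p)) p w = 0"
    using a b w by (intro cderiv_levi_vanishing(2) smooth_near_diff) (auto simp: levi_null_def)
  ultimately show ?thesis by simp
qed

definition cubic :: "'n cxvec \<Rightarrow> 'n cxvec \<Rightarrow> 'n cxvec \<Rightarrow> complex" where
  "cubic x y z = - 2 * cderiv M (\<lambda>q. levi q (fst y) (fst z)) p x"

lemma cderiv_levi_lin:
  assumes w: "w \<in> CT M p" and "smooth_near M p a" "smooth_near M p a'" "smooth_near M p b"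
  shows "cderiv M (\<lambda>q. levi q (a q + a' q) (b q)) p w = cderiv M (\<lambda>q. levi q (a q) (b q)) p w + cderiv M (\<lambda>q. levi q (a' q) (b q)) p w"
    "cderiv M (\<lambda>q. levi q (b q) (a q + a' q)) p w = cderiv M (\<lambda>q. levi q (b q) (a q)) p w + cderiv M (\<lambda>q. levi q (b q) (a' q)) p w"
    "cderiv M (\<lambda>q. levi q (c *s a q) (b q)) p w = c * cderiv M (\<lambda>q. levi q (a q) (b q)) p w"
    "cderiv M (\<lambda>q. levi q (b q) (c *s a q)) p w = cnj c * cderiv M (\<lambda>q. levi q (b q) (a q)) p w"
proof -
  have "eventually (\<lambda>q. levi q (a q + a' q) (b q) = levi q (a q) (b q) + levi q (a' q) (b q)) (near_in M p)"
    "eventually (\<lambda>q. levi q (b q) (a q + a' q) = levi q (b q) (a q) + levi q (b q) (a' q)) (near_in M p)"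
    "eventually (\<lambda>q. levi q (c *s a q) (b q) = c * levi q (a q) (b q)) (near_in M p)"
    "eventually (\<lambda>q. levi q (b q) (c *s a q) = cnj c * levi q (b q) (a q)) (near_in M p)"
    by (rule eventually_mono[OF near_U[OF p(2)]], simp add: levi_lin levi_complex_scale)+
  note e = this[THEN cderiv_cong[OF p(1)]]
  show "cderiv M (\<lambda>q. levi q (a q + a' q) (b q)) p w = cderiv M (\<lambda>q. levi q (a q) (b q)) p w + cderiv M (\<lambda>q. levi q (a' q) (b q)) p w"
    unfolding e using assms by (intro cderiv_add p smooth_levi_p)
  show "cderiv M (\<lambda>q. levi q (b q) (a q + a' q)) p w = cderiv M (\<lambda>q. levi q (b q) (a q)) p w + cderiv M (\<lambda>q. levi q (b q) (a' q)) p w"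
    unfolding e using assms by (intro cderiv_add p smooth_levi_p)
  show "cderiv M (\<lambda>q. levi q (c *s a q) (b q)) p w = c * cderiv M (\<lambda>q. levi q (a q) (b q)) p w"
    unfolding e using assms by (intro cderiv_cmult p smooth_levi_p)
  show "cderiv M (\<lambda>q. levi q (b q) (c *s a q)) p w = cnj c * cderiv M (\<lambda>q. levi q (b q) (a q)) p w"
    unfolding e using assms by (intro cderiv_cmult p smooth_levi_p)
qed

lemma smooth_bracket_factor:
  assumes "contact_form M \<theta>" shows "smooth_near M p (\<lambda>x. 2 * \<i> * complex_of_real (contact_coeff \<theta> x))"
  by (intro smooth_near_mult smooth_near_const smooth_near_linear_comp[OF bounded_linear_of_real]
      smooth_contact_coeff[OF p assms])

lemma cderiv_contact_bracket:
  assumes \<theta>: "contact_form M \<theta>" and L: "local_section M p (H10 M) L2" "local_section M p (H01 M) L1"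
    and w: "w \<in> CT M p" and 0: "levi p (fst (L2 p)) (fst (L1 p)) = 0"
  shows "cderiv M (contact_bracket M \<theta> L2 L1) p w
    = 2 * \<i> * contact_coeff \<theta> p * cderiv M (\<lambda>x. levi x (fst (L2 x)) (fst (L1 x))) p w"
  unfolding cderiv_cong[OF p(1) contact_bracket_near[OF \<theta> L]]
    cderiv_mult[OF p(1) smooth_bracket_factor[OF \<theta>] smooth_levi_p[OF section_fst[OF L(1)] section_fst[OF L(2)]] w]
  using 0 by simp

text \<open>Vectors in the Levi kernel may be differentiated as constant vectors, by \<open>cderiv_levi_kernel\<close>, and the
  contact coefficient is not differentiated because \<open>levi\<close> vanishes at \<open>p\<close> on them.\<close>

theorem cubic_tensor_eq:
  "cubic_tensor M p = restrict (\<lambda>(x, y, z). \<kappa> (cubic x y z)) (CT M p \<times> K10 M p \<times> K01 M p)" (is "_ = ?t")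
  unfolding cubic_tensor_def
proof (rule the_equality)
  show "tensor3 M p (CT M p) (K10 M p) (K01 M p) ?t \<and>
     (\<forall>L3 L2 L1 \<theta>. local_section M p (CT M) L3 \<and>
        local_section M p (H10 M) L2 \<and> local_section M p (H10 M) (cconj \<circ> L1) \<and>
        L2 p \<in> K10 M p \<and> cconj (L1 p) \<in> K10 M p \<and> contact_form M \<theta> \<longrightarrow>
        CQ_pair (\<theta> p) (?t (L3 p, L2 p, L1 p)) = \<i> * vderiv M L3 (contact_bracket M \<theta> L2 L1) p)"
  proof (intro conjI allI impI tensor3I)
    show "clin_on (CT M p) (\<lambda>x. cubic x b c)" for b c
      using smooth_levi_p[OF smooth_near_const smooth_near_const]
      by (auto simp: clin_on_def CT_closed cubic_def cderiv_add_vec cderiv_cscale p algebra_simps)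
    show "clin_on (K10 M p) (\<lambda>x. cubic a x c)" if "a \<in> CT M p" for a c
      using that cderiv_levi_lin(1,3)[OF that smooth_near_const smooth_near_const smooth_near_const]
      by (auto simp: clin_on_def K_closed K_H cubic_def cscale10 algebra_simps)
    show "clin_on (K01 M p) (cubic a b)" if "a \<in> CT M p" for a b
      using that cderiv_levi_lin(2,4)[OF that smooth_near_const smooth_near_const smooth_near_const]
      by (auto simp: clin_on_def K_closed K_H cubic_def cscale10 algebra_simps)
    fix L3 L2 L1 \<theta>
    assume L: "local_section M p (CT M) L3 \<and>
        local_section M p (H10 M) L2 \<and> local_section M p (H10 M) (cconj \<circ> L1) \<and>
        L2 p \<in> K10 M p \<and> cconj (L1 p) \<in> K10 M p \<and> contact_form M \<theta>"
    have L1: "local_section M p (H01 M) L1" using L section01_iff by blast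
    have K1: "L1 p \<in> K01 M p" using L by (force simp: K01_def image_iff)
    have w: "L3 p \<in> CT M p" using L section_at[of "CT M"] by blast
    have k: "fst (L2 p) \<in> levi_null" "fst (L1 p) \<in> levi_null" using L K1 K10_iff K01_iff by auto
    have z: "levi p (fst (L2 p)) (fst (L1 p)) = 0" using k by (simp add: levi_null_right)
    have "vderiv M L3 (contact_bracket M \<theta> L2 L1) p
      = 2 * \<i> * contact_coeff \<theta> p * cderiv M (\<lambda>x. levi x (fst (L2 p)) (fst (L1 p))) p (L3 p)"
      unfolding vderiv_eq_cderiv using cderiv_contact_bracket[of \<theta> L2 L1, OF _ _ L1 w z] L
        cderiv_levi_kernel[OF section_fst[of "H10 M" L2] k(1) section_fst[OF L1] k(2) w] by simp
    then show "CQ_pair (\<theta> p) (?t (L3 p, L2 p, L1 p)) = \<i> * vderiv M L3 (contact_bracket M \<theta> L2 L1) p"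
      using L K1 w by (simp add: CQ_pair_\<kappa> cubic_def complex_eq_iff)
  qed
next
  fix \<tau> assume \<tau>: "tensor3 M p (CT M p) (K10 M p) (K01 M p) \<tau> \<and>
     (\<forall>L3 L2 L1 \<theta>. local_section M p (CT M) L3 \<and>
        local_section M p (H10 M) L2 \<and> local_section M p (H10 M) (cconj \<circ> L1) \<and>
        L2 p \<in> K10 M p \<and> cconj (L1 p) \<in> K10 M p \<and> contact_form M \<theta> \<longrightarrow>
        CQ_pair (\<theta> p) (\<tau> (L3 p, L2 p, L1 p)) = \<i> * vderiv M L3 (contact_bracket M \<theta> L2 L1) p)"
  show "\<tau> = ?t"
  proof (rule extensionalityI[of _ "CT M p \<times> K10 M p \<times> K01 M p"])
    show "\<tau> \<in> extensional (CT M p \<times> K10 M p \<times> K01 M p)"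
      using \<tau> by (auto simp: tensor3_def PiE_def)
    fix t assume t: "t \<in> CT M p \<times> K10 M p \<times> K01 M p"
    obtain x y z where xyz: "t = (x, y, z)" "x \<in> CT M p" "y \<in> K10 M p" "z \<in> K01 M p" using t by auto
    let ?X = "field10 (\<lambda>q. fst y)" and ?Y = "cconj \<circ> field10 (\<lambda>q. fst z)"
    have s: "local_section M p (H10 M) ?X" "local_section M p (H01 M) ?Y" "local_section M p (H10 M) (cconj \<circ> ?Y)"
      using field10_section[OF smooth_near_const] by (simp_all add: section01_iff o_def)
    have v: "?X p = y" "?Y p = z"
      using K_H(1)[OF xyz(3)] K_H(2)[OF xyz(4)] by (auto simp: field10_at H10_iff H01_iff p cconj_def prod_eq_iff)
    have k: "fst y \<in> levi_null" "fst z \<in> levi_null" using xyz K10_iff K01_iff by auto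
    have ck: "cconj (?Y p) \<in> K10 M p" unfolding v(2) using xyz(4) by (auto simp: K01_def)
    have z: "levi p (fst (?X p)) (fst (?Y p)) = 0" unfolding v using k by (simp add: levi_null_right)
    have "CQ_pair (\<theta>p p) (\<tau> (fieldT x p, ?X p, ?Y p)) = \<i> * vderiv M (fieldT x) (contact_bracket M \<theta>p ?X ?Y) p"
      using \<tau> s(1,3) ck contact_\<theta>p v(1) xyz(3) local_section_fieldT by metis
    also have "vderiv M (fieldT x) (contact_bracket M \<theta>p ?X ?Y) p
      = 2 * \<i> * cderiv M (\<lambda>q. levi q (fst (?X q)) (fst (?Y q))) p x"
      unfolding vderiv_eq_cderiv fieldT_at[OF xyz(2)]
        cderiv_contact_bracket[OF contact_\<theta>p s(1,2) xyz(2) z] contact_coeff_\<theta>p by simp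
    also have "cderiv M (\<lambda>q. levi q (fst (?X q)) (fst (?Y q))) p x = cderiv M (\<lambda>q. levi q (fst y) (fst z)) p x"
      using cderiv_levi_kernel[OF section_fst[OF s(1)] _ section_fst[OF s(2)] _ xyz(2)] k unfolding v by blast
    finally have "CQ_pair (\<theta>p p) (\<tau> t) = cubic x y z"
      unfolding xyz(1) fieldT_at[OF xyz(2)] v cubic_def by (simp add: complex_eq_iff)
    moreover have "\<tau> t \<in> CQ M p"
      using \<tau> t unfolding tensor3_def by (blast dest: PiE_mem)
    ultimately have "\<tau> t = \<kappa> (cubic x y z)" by (intro CQ_eqI)
    then show "\<tau> t = ?t t" using t by (simp add: xyz(1))
  qed (rule restrict_extensional)
qed

section \<open>Fields in the Levi kernel to first order\<close>

text \<open>The condition of being in the Levi kernel up to \<open>w\<close>-order 1, tested on constant vectors \<open>i\<close> and free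
  of brackets and contact forms.\<close>

definition kernel_jet :: "'n cxvec \<Rightarrow> (complex^'n \<Rightarrow> complex^'n) \<Rightarrow> bool" where
  "kernel_jet w b \<longleftrightarrow> (\<forall>i. levi p i (b p) = 0 \<and> cderiv M (\<lambda>q. levi q i (b q)) p w = 0)"

lemma kernel_jet_levi_null: "kernel_jet w b \<Longrightarrow> b p \<in> complex_tangent_space M p \<Longrightarrow> b p \<in> levi_null"
  unfolding kernel_jet_def levi_null_def using levi_herm[OF p(2), of "b p"] by simp

lemma kernel_jet_closed:
  assumes w: "w \<in> CT M p" and b: "smooth_near M p b" "kernel_jet w b"
  shows "kernel_jet w (\<lambda>q. c *s b q)"
    and "smooth_near M p b' \<Longrightarrow> kernel_jet w b' \<Longrightarrow> kernel_jet w (\<lambda>q. b q + b' q)"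
  using b cderiv_levi_lin[OF w b(1) _ smooth_near_const] cderiv_levi_lin[OF w b(1) b(1) smooth_near_const]
  by (auto simp: kernel_jet_def levi_lin levi_complex_scale p)

text \<open>A section of type \<open>(1,0)\<close> is a combination of projected constant vectors, and products with
  coefficient functions do not matter for functions whose value and derivative vanish.\<close>

lemma vorder1_iff_kernel_jet:
  assumes L: "local_section M p (H10 M) L" and v: "v \<in> CT M p"
  shows "levi_kernel_vorder1 M p v L \<longleftrightarrow> kernel_jet v (\<lambda>q. fst (L q))"
proof
  have L': "local_section M p (H01 M) (cconj \<circ> L)" using L by (simp add: section01_iff o_def)
  have fL: "fst ((cconj \<circ> L) q) = fst (L q)" for q by (simp add: cconj_def)
  have bS: "smooth_near M p (\<lambda>q. fst (L q))" using section_fst[OF L] .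
  {
    assume K: "levi_kernel_vorder1 M p v L"
    show "kernel_jet v (\<lambda>q. fst (L q))"
      unfolding kernel_jet_def
    proof (intro allI)
      fix i
      let ?X = "field10 (\<lambda>q. i)"
      have s: "local_section M p (H10 M) ?X" by (rule field10_section[OF smooth_near_const])
      have "contact_bracket M \<theta>p ?X (cconj \<circ> L) p = 0 \<and>
          vderiv M (fieldT v) (contact_bracket M \<theta>p ?X (cconj \<circ> L)) p = 0"
        using K s contact_\<theta>p local_section_fieldT fieldT_at[OF v] unfolding levi_kernel_vorder1_def by blast
      then have c: "contact_bracket M \<theta>p ?X (cconj \<circ> L) p = 0"
          "cderiv M (contact_bracket M \<theta>p ?X (cconj \<circ> L)) p v = 0"
        by (simp_all add: vderiv_eq_cderiv fieldT_at[OF v])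
      have 0: "levi p (fst (?X p)) (fst ((cconj \<circ> L) p)) = 0"
        using c(1) unfolding contact_bracket_at[OF contact_\<theta>p s L'] contact_coeff_\<theta>p by simp
      have d: "cderiv M (\<lambda>x. levi x (fst (?X x)) (fst ((cconj \<circ> L) x))) p v = 0"
        using c(2) unfolding cderiv_contact_bracket[OF contact_\<theta>p s L' v 0] contact_coeff_\<theta>p by simp
      have ev: "eventually (\<lambda>x. levi x (fst (?X x)) (fst ((cconj \<circ> L) x)) = levi x i (fst (L x))) (near_in M p)"
        using near_U[OF p(2)] by eventually_elim (simp add: field10_def levi_hproj cconj_def)
      have "cderiv M (\<lambda>x. levi x i (fst (L x))) p v = 0"
        using d unfolding cderiv_cong[OF p(1) ev] .
      moreover have "levi p i (fst (L p)) = 0"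
        using 0 by (simp add: field10_def levi_hproj cconj_def p)
      ultimately show "levi p i (fst (L p)) = 0 \<and> cderiv M (\<lambda>q. levi q i (fst (L q))) p v = 0" by blast
    qed
  }
  {
    assume K: "kernel_jet v (\<lambda>q. fst (L q))"
    show "levi_kernel_vorder1 M p v L"
      unfolding levi_kernel_vorder1_def
    proof (intro allI impI)
      fix L1 L2 \<theta>
      assume A: "local_section M p (H10 M) L1 \<and> local_section M p (CT M) L2 \<and> L2 p = v \<and> contact_form M \<theta>"
      then have s: "local_section M p (H10 M) L1" and \<theta>: "contact_form M \<theta>" by auto
      have 0: "levi p (fst (L1 p)) (fst ((cconj \<circ> L) p)) = 0"
        using K by (simp add: kernel_jet_def cconj_def)
      have "cderiv M (\<lambda>x. levi x (fst (L1 x)) (fst (L x))) p v = 0"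
        unfolding cderiv_cong[OF p(1) levi_expand_near(1)]
        using K section_fst[OF s] bS
        by (intro cderiv_sum_products_zero p v smooth_coord smooth_levi_p smooth_near_const)
          (auto simp: kernel_jet_def)
      then have "cderiv M (contact_bracket M \<theta> L1 (cconj \<circ> L)) p v = 0"
        unfolding cderiv_contact_bracket[OF \<theta> s L' v 0] fL by simp
      then show "contact_bracket M \<theta> L1 (cconj \<circ> L) p = 0 \<and> vderiv M L2 (contact_bracket M \<theta> L1 (cconj \<circ> L)) p = 0"
        using A 0 by (simp add: contact_bracket_at[OF \<theta> s L'] vderiv_eq_cderiv)
    qed
  }
qed

lemma order1_iff_kernel_jet:
  assumes L: "local_section M p (H10 M) L"
  shows "levi_kernel_order1 M p L \<longleftrightarrow> (\<forall>v\<in>CT M p. kernel_jet v (\<lambda>q. fst (L q)))"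
proof -
  have "levi_kernel_order1 M p L \<longleftrightarrow> (\<forall>v\<in>CT M p. levi_kernel_vorder1 M p v L)"
    unfolding levi_kernel_order1_def levi_kernel_vorder1_def using section_at[of "CT M"] by blast
  then show ?thesis using vorder1_iff_kernel_jet[OF L] by simp
qed

end

locale cubic_flat_point = point_chart M U \<rho> p for M U :: "(complex^'n) set" and \<rho> p +
  assumes cubic_zero: "\<And>x y z. x \<in> CT M p \<Longrightarrow> y \<in> K10 M p \<Longrightarrow> z \<in> K01 M p \<Longrightarrow> cubic x y z = 0"
begin

lemma cderiv_levi_null:
  assumes "w \<in> CT M p" "a \<in> levi_null" "b \<in> levi_null" shows "cderiv M (\<lambda>q. levi q a b) p w = 0"
  using cubic_zero[OF assms(1), of "(a, - J a)" "(b, J b)"] assms by (simp add: K10_iff K01_iff cubic_def)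

text \<open>The equation for \<open>x\<close> is complex linear in \<open>i\<close>, so its real part suffices; there it has a symmetric
  operator \<open>T\<close>, given by the real part of the Levi form. Solvability is orthogonality of the right-hand
  side to the kernel of \<open>T\<close>, which consists of vectors projecting to the Levi kernel, and there the
  right-hand side is, up to a factor, the real part of a value of the cubic tensor.\<close>

lemma kernel_field_exists_direction:
  assumes v: "v \<in> levi_null" and u: "u \<in> tangent_space M p"
  shows "\<exists>x. \<forall>i. frechet_derivative (\<lambda>q. levi q i v) (at p within M) u + levi p i x = 0"
proof -
  define \<beta> where "\<beta> i = frechet_derivative (\<lambda>q. levi q i v) (at p within M) u" for i
  have uC: "(u, 0) \<in> CT M p" using u d\<rho>_lin(4)[OF p(2), of 0 0] by (simp add: CT_iff tangent_iff p)
  have \<beta>: "\<beta> i = cderiv M (\<lambda>q. levi q i v) p (u, 0)" for i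
    using linear_0[OF linear_frechet_within[OF p(1) smooth_levi_p[OF smooth_near_const smooth_near_const]]]
    by (simp add: \<beta>_def cderiv_def)
  note s = smooth_near_const
  have \<beta>_lin: "\<beta> (i + j) = \<beta> i + \<beta> j" "\<beta> (c *s i) = c * \<beta> i" for i j c
    unfolding \<beta> using cderiv_levi_lin[OF uC s s s] by simp_all
  have \<beta>r: "\<beta> (r *\<^sub>R i) = r * \<beta> i" for r i
    using \<beta>_lin(2)[of "complex_of_real r" i] by (simp add: complex_scale_J)
  have \<beta>J: "\<beta> (J i) = \<i> * \<beta> i" for i
    using \<beta>_lin(2)[of \<i> i] by (simp add: J_def)
  define T where "T x = (\<Sum>b\<in>Basis. Re (levi p b x) *\<^sub>R b)" for x
  define r where "r = (\<Sum>b\<in>Basis. Re (\<beta> b) *\<^sub>R b)"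
  have ib: "(\<Sum>b\<in>Basis. g b *\<^sub>R b) \<bullet> i = g i" if "linear g" for g :: "complex^'n \<Rightarrow> real" and i
  proof -
    have "g (\<Sum>b\<in>Basis. (i \<bullet> b) *\<^sub>R b) = (\<Sum>b\<in>Basis. (i \<bullet> b) * g b)"
      by (simp only: linear_sum[OF that] linear_scale[OF that] real_scaleR_def)
    then show ?thesis unfolding euclidean_representation
      by (simp add: inner_sum_left inner_commute[of i] mult.commute)
  qed
  have Ti: "T x \<bullet> i = Re (levi p i x)" for x i
    unfolding T_def by (rule ib) (auto intro!: linearI simp: levi_lin p)
  have ri: "r \<bullet> i = Re (\<beta> i)" for i
    unfolding r_def by (rule ib) (auto intro!: linearI simp: \<beta>_lin(1) \<beta>r)
  have "\<exists>x. T x = - r"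
  proof (rule symmetric_range)
    show "linear T"
      by (rule linearI) (auto simp: T_def levi_lin p scaleR_left_distrib sum.distrib scaleR_sum_right)
    show "T x \<bullet> y = x \<bullet> T y" for x y
      using levi_herm[OF p(2), of x y] Ti[of x y] Ti[of y x] by (simp add: inner_commute)
    fix t assume t: "T t = 0"
    have re: "Re (levi p i t) = 0" for i using Ti[of t i] t by simp
    \<comment> \<open>Testing with \<open>J i\<close> in place of \<open>i\<close> gives the imaginary part.\<close>
    have z: "levi p i t = 0" for i
      using re[of i] re[of "J i"] by (simp add: levi_lin p complex_eq_iff)
    have "levi p t i = 0" for i using levi_herm[OF p(2), of t i] z[of i] by simp
    then have h: "hproj p t \<in> levi_null" by (simp add: levi_null_def hproj_H p levi_hproj)
    have "\<beta> t = cderiv M (\<lambda>q. levi q (hproj q t) v) p (u, 0)"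
    proof -
      have "eventually (\<lambda>q. levi q t v = levi q (hproj q t) v) (near_in M p)"
        using near_U[OF p(2)] by eventually_elim (simp add: levi_hproj)
      from cderiv_cong[OF p(1) this] show ?thesis by (simp add: \<beta>)
    qed
    also have "\<dots> = cderiv M (\<lambda>q. levi q (hproj p t) v) p (u, 0)"
      by (rule cderiv_levi_kernel[OF smooth_hproj[OF p s] h s v uC])
    also have "\<dots> = 0" by (rule cderiv_levi_null[OF uC h v])
    finally show "- r \<bullet> t = 0" by (simp add: ri)
  qed
  then obtain x where x: "T x = - r" by blast
  have re: "Re (\<beta> i + levi p i x) = 0" for i
    using Ti[of x i] ri[of i] x by simp
  have "\<beta> i + levi p i x = 0" for i
    using re[of i] re[of "J i"] by (simp add: \<beta>J levi_lin p complex_eq_iff)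
  then show ?thesis unfolding \<beta>_def by blast
qed

text \<open>The field is sought in the form \<open>b q = v + A (q - p)\<close> with \<open>A\<close> real linear. Vanishing of the
  derivative of \<open>levi q i (b q)\<close> along \<open>u\<close> is a linear equation for \<open>A u\<close>, solvable for each tangent
  vector \<open>u\<close>; solutions for the projected basis vectors are extended linearly.\<close>

theorem kernel_field_exists:
  assumes v: "v \<in> levi_null"
  shows "\<exists>b. smooth_near M p b \<and> b p = v \<and> (\<forall>w\<in>CT M p. kernel_jet w b)"
proof -
  let ?D = "\<lambda>i. frechet_derivative (\<lambda>q. levi q i v) (at p within M)"
  note s = smooth_near_const
  have lD: "linear (?D i)" for i by (rule linear_frechet_within[OF p(1) smooth_levi_p[OF s s]])
  obtain X where X: "\<And>j i. ?D i (tproj p j) + levi p i (X j) = 0"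
    using kernel_field_exists_direction[OF v tproj_tangent[OF p]] by metis
  define A where "A y = (\<Sum>j\<in>Basis. (y \<bullet> j) *\<^sub>R X j)" for y
  have linA: "linear A"
    by (rule linearI) (auto simp: A_def inner_add_left scaleR_left_distrib sum.distrib scaleR_sum_right)
  then have bA: "bounded_linear A" by (simp add: linear_conv_bounded_linear)
  define b where "b q = v + A (q - p)" for q
  have As: "smooth_near M p (\<lambda>q. A (q - p))"
    by (rule smooth_near_linear_comp[OF bA smooth_near_diff[OF smooth_near_linear[OF bounded_linear_ident] s]])
  then have bs: "smooth_near M p b" unfolding b_def[abs_def] by (intro smooth_near_add s)
  have bp: "b p = v" by (simp add: b_def linear_0[OF linA])
  have DA: "frechet_derivative (\<lambda>q. levi q i (A (q - p))) (at p within M) u = levi p i (A u)"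
    if u: "u \<in> tangent_space M p" for i u
  proof -
    have d: "frechet_derivative (\<lambda>q. complex_of_real (A (q - p) \<bullet> j)) (at p within M) u = complex_of_real (A u \<bullet> j)" for j
    proof (rule frechet_within[OF p(1) _ u])
      have "((\<lambda>q. complex_of_real (A q \<bullet> j) - complex_of_real (A p \<bullet> j)) has_derivative (\<lambda>u. complex_of_real (A u \<bullet> j) - 0)) (at p within M)"
        by (intro has_derivative_diff has_derivative_const bounded_linear_imp_has_derivative
            bounded_linear_compose[OF bounded_linear_of_real bounded_linear_compose[OF bounded_linear_inner_left bA]])
      then show "((\<lambda>q. complex_of_real (A (q - p) \<bullet> j)) has_derivative (\<lambda>u. complex_of_real (A u \<bullet> j))) (at p within M)"
        by (simp add: linear_diff[OF linA] inner_diff_left)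
    qed
    have uC: "(u, 0) \<in> CT M p" using u d\<rho>_lin(4)[OF p(2), of 0 0] by (simp add: CT_iff tangent_iff p)
    have c: "cderiv M f p (u, 0) = frechet_derivative f (at p within M) u" if "smooth_near M p f" for f
      using linear_0[OF linear_frechet_within[OF p(1) that]] by (simp add: cderiv_def)
    have "frechet_derivative (\<lambda>q. levi q i (A (q - p))) (at p within M) u = cderiv M (\<lambda>q. levi q i (A (q - p))) p (u, 0)"
      by (rule c[symmetric]) (intro smooth_levi_p s As)
    also have "\<dots> = (\<Sum>j\<in>Basis. cderiv M (\<lambda>q. complex_of_real (A (q - p) \<bullet> j) * levi q i j) p (u, 0))"
      unfolding cderiv_cong[OF p(1) levi_expand_near(2)]
      by (intro cderiv_sum p uC smooth_near_mult smooth_coord As smooth_levi_p s)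
    also have "\<dots> = (\<Sum>j\<in>Basis. complex_of_real (A u \<bullet> j) * levi p i j)"
    proof (rule sum.cong[OF refl])
      fix j
      show "cderiv M (\<lambda>q. complex_of_real (A (q - p) \<bullet> j) * levi q i j) p (u, 0) = complex_of_real (A u \<bullet> j) * levi p i j"
        unfolding cderiv_mult[OF p(1) smooth_coord[OF As] smooth_levi_p[OF s s] uC] c[OF smooth_coord[OF As]] d
        by (simp add: linear_0[OF linA])
    qed
    also have "\<dots> = levi p i (A u)" by (rule levi_expand(2)[OF p(2), symmetric])
    finally show ?thesis .
  qed
  have Db: "frechet_derivative (\<lambda>q. levi q i (b q)) (at p within M) u = 0" if u: "u \<in> tangent_space M p" for i u
  proof -
    have "eventually (\<lambda>q. levi q i (b q) = levi q i v + levi q i (A (q - p))) (near_in M p)"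
      using near_U[OF p(2)] by eventually_elim (simp add: b_def levi_lin)
    from frechet_within_cong[OF p(1) this]
    have "frechet_derivative (\<lambda>q. levi q i (b q)) (at p within M) u = ?D i u + levi p i (A u)"
      using frechet_within_add[OF p(1) smooth_levi_p[OF s s] smooth_levi_p[OF s As] u] DA[OF u] by simp
    also have "?D i u = (\<Sum>j\<in>Basis. (u \<bullet> j) *\<^sub>R ?D i (tproj p j))"
    proof -
      have "u = tproj p (\<Sum>j\<in>Basis. (u \<bullet> j) *\<^sub>R j)"
        unfolding euclidean_representation using tproj_id[OF p u] by simp
      also have "\<dots> = (\<Sum>j\<in>Basis. (u \<bullet> j) *\<^sub>R tproj p j)"
        by (simp only: linear_sum[OF linear_tproj[OF p(2)]] linear_scale[OF linear_tproj[OF p(2)]])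
      finally have "?D i u = ?D i (\<Sum>j\<in>Basis. (u \<bullet> j) *\<^sub>R tproj p j)" by simp
      then show ?thesis by (simp only: linear_sum[OF lD] linear_scale[OF lD])
    qed
    also have "levi p i (A u) = (\<Sum>j\<in>Basis. (u \<bullet> j) *\<^sub>R levi p i (X j))"
    proof -
      have l: "linear (levi p i)" by (auto intro!: linearI simp: levi_lin p scaleR_conv_of_real[where 'a = complex])
      show ?thesis unfolding A_def by (simp only: linear_sum[OF l] linear_scale[OF l])
    qed
    also have "(\<Sum>j\<in>Basis. (u \<bullet> j) *\<^sub>R ?D i (tproj p j)) + (\<Sum>j\<in>Basis. (u \<bullet> j) *\<^sub>R levi p i (X j)) = 0"
      unfolding sum.distrib[symmetric] scaleR_add_right[symmetric] X by simp
    finally show ?thesis .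
  qed
  have "kernel_jet w b" if "w \<in> CT M p" for w
    using Db CT_D[OF that] v by (simp add: kernel_jet_def cderiv_def bp levi_null_right)
  then show ?thesis using bs bp by blast
qed

section \<open>The quartic tensor\<close>

definition jet_ext :: "complex^'n \<Rightarrow> complex^'n \<Rightarrow> complex^'n" where
  "jet_ext a = (SOME b. smooth_near M p b \<and> b p = a \<and> (\<forall>w\<in>CT M p. kernel_jet w b))"

lemma jet_ext: "a \<in> levi_null \<Longrightarrow> smooth_near M p (jet_ext a)" "a \<in> levi_null \<Longrightarrow> jet_ext a p = a"
  "a \<in> levi_null \<Longrightarrow> w \<in> CT M p \<Longrightarrow> kernel_jet w (jet_ext a)"
  using someI_ex[OF kernel_field_exists, of a] unfolding jet_ext_def by blast+

text \<open>The functions chosen in \<open>jet_ext\<close> and the projected constant fields serve as representatives; other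
  choices give the same number by \<open>vderiv2_levi_eq_quartic\<close>.\<close>

definition quartic :: "'n cxvec \<Rightarrow> 'n cxvec \<Rightarrow> complex^'n \<Rightarrow> complex^'n \<Rightarrow> complex" where
  "quartic x y a b = vderiv M (fieldT x) (vderiv M (fieldT y) (\<lambda>q. levi q (jet_ext a q) (jet_ext b q))) p"

text \<open>The second order analogue of \<open>cderiv_levi_vanishing\<close>. In the first slot the jet conditions in the two
  given directions enter directly; in the second slot hermitian symmetry replaces a direction by its
  conjugate, hence the condition for all directions.\<close>

lemma vderiv2_levi_vanishing:
  assumes X: "ct_field p X" and Y: "ct_field p Y" and z: "smooth_near M p z" "z p = 0" and b: "smooth_near M p b"
  shows "kernel_jet (X p) b \<Longrightarrow> kernel_jet (Y p) b \<Longrightarrow> vderiv M Y (vderiv M X (\<lambda>q. levi q (z q) (b q))) p = 0"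
    and "\<forall>w\<in>CT M p. kernel_jet w b \<Longrightarrow> vderiv M Y (vderiv M X (\<lambda>q. levi q (b q) (z q))) p = 0"
proof -
  assume "kernel_jet (X p) b" "kernel_jet (Y p) b"
  then show "vderiv M Y (vderiv M X (\<lambda>q. levi q (z q) (b q))) p = 0"
    unfolding vderiv2_cong[OF p(1) levi_expand_near(1)] using z
    by (intro vderiv2_sum_products_zero p X Y smooth_coord smooth_levi_p b smooth_near_const)
      (auto simp: kernel_jet_def)
next
  assume k: "\<forall>w\<in>CT M p. kernel_jet w b"
  have 0: "cderiv M (\<lambda>x. levi x (b x) i) p w = 0" if w: "w \<in> CT M p" for w i
    using cderiv_levi_herm[OF b w] k CT_closed(3)[OF w] by (simp add: kernel_jet_def)
  have 1: "levi p (b p) i = 0" for i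
    using k CT_closed(3) ct_field_at[OF p(1) X] levi_herm[OF p(2), of "b p" i] by (force simp: kernel_jet_def)
  show "vderiv M Y (vderiv M X (\<lambda>q. levi q (b q) (z q))) p = 0"
    unfolding vderiv2_cong[OF p(1) levi_expand_near(2)] using z 0 1 ct_field_at[OF p(1)] X Y
    by (intro vderiv2_sum_products_zero p X Y smooth_coord smooth_levi_p b smooth_near_const) auto
qed

text \<open>The field \<open>X\<close> is a combination of projected constant fields with coefficients \<open>c\<close>. Derivatives of these
  coefficients are multiplied by first derivatives of \<open>f\<close> at \<open>p\<close>, which vanish. So the result depends
  on \<open>X\<close> only through its value at \<open>p\<close>, and linearly.\<close>

lemma vderiv2_expand:
  assumes X: "ct_field p X" and Y: "ct_field p Y" and f: "smooth_near M p f"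
    and df: "\<And>w. w \<in> CT M p \<Longrightarrow> cderiv M f p w = 0"
  shows "vderiv M Y (vderiv M X f) p = (\<Sum>j\<in>Basis.
    (complex_of_real (fst (X p) \<bullet> j) + \<i> * complex_of_real (snd (X p) \<bullet> j)) * vderiv M Y (vderiv M (fieldT (j, 0)) f) p)"
proof -
  define c where "c j q = complex_of_real (fst (X q) \<bullet> j) + \<i> * complex_of_real (snd (X q) \<bullet> j)" for j q
  have XS: "smooth_near M p X" using X by (simp add: ct_field_def)
  have cS: "smooth_near M p (c j)" for j
    unfolding c_def[abs_def]
    by (intro smooth_near_add smooth_near_mult smooth_near_const smooth_coord
        smooth_near_linear_comp[OF bounded_linear_fst XS] smooth_near_linear_comp[OF bounded_linear_snd XS])
  have "eventually (\<lambda>q. vderiv M X f q = (\<Sum>j\<in>Basis. c j q * vderiv M (fieldT (j, 0)) f q)) (near_in M p)"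
    using near_U[OF p(2)] smooth_near_eventually[OF f] ct_field_eventually[OF X]
  proof eventually_elim
    case (elim q)
    have w: "X q \<in> CT M q" using elim ct_field_at by blast
    have l: "linear (frechet_derivative f (at q within M))" using elim linear_frechet_within by blast
    have lt: "linear (tproj q)" using elim linear_tproj by blast
    have e: "frechet_derivative f (at q within M) u
        = (\<Sum>j\<in>Basis. complex_of_real (u \<bullet> j) * frechet_derivative f (at q within M) (tproj q j))"
      if u: "u \<in> tangent_space M q" for u
    proof -
      have "u = tproj q (\<Sum>j\<in>Basis. (u \<bullet> j) *\<^sub>R j)"
        unfolding euclidean_representation using tproj_id[OF _ _ u] elim by simp
      also have "\<dots> = (\<Sum>j\<in>Basis. (u \<bullet> j) *\<^sub>R tproj q j)"
        by (simp only: linear_sum[OF lt] linear_scale[OF lt])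
      finally have "frechet_derivative f (at q within M) u
          = frechet_derivative f (at q within M) (\<Sum>j\<in>Basis. (u \<bullet> j) *\<^sub>R tproj q j)" by simp
      also have "\<dots> = (\<Sum>j\<in>Basis. (u \<bullet> j) *\<^sub>R frechet_derivative f (at q within M) (tproj q j))"
        by (simp only: linear_sum[OF l] linear_scale[OF l])
      finally show ?thesis by (simp only: scaleR_conv_of_real[where 'a = complex])
    qed
    show ?case
      unfolding vderiv_eq_cderiv cderiv_def e[OF CT_D(1)[OF w]] e[OF CT_D(2)[OF w]]
      by (simp add: c_def fieldT_def linear_0[OF lt] linear_0[OF l] sum_distrib_left sum.distrib
          algebra_simps)
  qed
  from vderiv_cong[OF p(1) this, of Y]
  have "vderiv M Y (vderiv M X f) p = vderiv M Y (\<lambda>q. \<Sum>j\<in>Basis. c j q * vderiv M (fieldT (j, 0)) f q) p" .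
  also have "\<dots> = (\<Sum>j\<in>Basis. vderiv M Y (\<lambda>q. c j q * vderiv M (fieldT (j, 0)) f q) p)"
    by (intro vderiv_sum p Y smooth_near_mult cS smooth_near_vderiv' ct_fieldT f)
  also have "\<dots> = (\<Sum>j\<in>Basis. c j p * vderiv M Y (vderiv M (fieldT (j, 0)) f) p)"
  proof (rule sum.cong[OF refl])
    fix j
    have "vderiv M (fieldT (j, 0)) f p = 0"
      unfolding vderiv_eq_cderiv by (rule df[OF ct_field_at[OF p(1) ct_fieldT]])
    then show "vderiv M Y (\<lambda>q. c j q * vderiv M (fieldT (j, 0)) f q) p = c j p * vderiv M Y (vderiv M (fieldT (j, 0)) f) p"
      unfolding vderiv_mult[OF p(1) cS smooth_near_vderiv'[OF p(1) f ct_fieldT] Y] by simp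
  qed
  finally show ?thesis by (simp add: c_def)
qed

lemma cderiv_levi_jet:
  assumes a: "smooth_near M p a" and b: "smooth_near M p b" and w: "w \<in> CT M p" and k: "kernel_jet w b"
  shows "cderiv M (\<lambda>q. levi q (a q) (b q)) p w = 0"
  unfolding cderiv_cong[OF p(1) levi_expand_near(1)] using k
  by (intro cderiv_sum_products_zero p w smooth_coord smooth_levi_p a b smooth_near_const)
    (auto simp: kernel_jet_def)

text \<open>The functions \<open>a\<close> and \<open>b\<close> are replaced, one after the other, by the chosen functions with the same
  values at \<open>p\<close> and with vanishing jets in all directions. Replacing \<open>a\<close> first needs only the jet of \<open>b\<close>
  in the directions of \<open>X\<close> and \<open>Y\<close>; when \<open>b\<close> is replaced, \<open>a\<close> has already become a function with
  all jet conditions. Only then is \<open>X\<close> replaced, since the differential of the remaining function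
  vanishes in all directions.\<close>

theorem vderiv2_levi_eq_quartic:
  assumes X: "ct_field p X" and Y: "ct_field p Y" and a: "smooth_near M p a" "a p \<in> levi_null"
    and b: "smooth_near M p b" "b p \<in> levi_null" and k: "kernel_jet (X p) b" "kernel_jet (Y p) b"
  shows "vderiv M Y (vderiv M X (\<lambda>q. levi q (a q) (b q))) p = quartic (Y p) (X p) (a p) (b p)"
proof -
  define a' where "a' = jet_ext (a p)"
  define b' where "b' = jet_ext (b p)"
  have a': "smooth_near M p a'" "a' p = a p" "\<forall>w\<in>CT M p. kernel_jet w a'"
    using jet_ext a(2) by (auto simp: a'_def)
  have b': "smooth_near M p b'" "b' p = b p" "\<forall>w\<in>CT M p. kernel_jet w b'"
    using jet_ext b(2) by (auto simp: b'_def)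
  define f where "f q = levi q (a' q) (b' q)" for q
  have fS: "smooth_near M p f" unfolding f_def[abs_def] by (intro smooth_levi_p a' b')
  have df: "cderiv M f p w = 0" if "w \<in> CT M p" for w
    unfolding f_def[abs_def] using cderiv_levi_jet[OF a'(1) b'(1) that] b'(3) that by blast
  have Xp: "X p \<in> CT M p" and Yp: "Y p \<in> CT M p" using ct_field_at[OF p(1)] X Y by auto
  have "eventually (\<lambda>q. levi q (a q) (b q) = levi q (a q - a' q) (b q) + (levi q (a' q) (b q - b' q) + f q)) (near_in M p)"
    using near_U[OF p(2)] by eventually_elim (simp add: levi_diff f_def)
  from vderiv2_cong[OF p(1) this, of Y X]
  have "vderiv M Y (vderiv M X (\<lambda>q. levi q (a q) (b q))) p = vderiv M Y (vderiv M X (\<lambda>q. levi q (a q - a' q) (b q))) p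
     + (vderiv M Y (vderiv M X (\<lambda>q. levi q (a' q) (b q - b' q))) p + vderiv M Y (vderiv M X f) p)"
    using a a' b b' fS by (simp add: vderiv2_add[OF p(1) _ _ X Y] smooth_levi_p smooth_near_add smooth_near_diff)
  also have "vderiv M Y (vderiv M X (\<lambda>q. levi q (a q - a' q) (b q))) p = 0"
    using a a' b k by (intro vderiv2_levi_vanishing(1) X Y smooth_near_diff) auto
  also have "vderiv M Y (vderiv M X (\<lambda>q. levi q (a' q) (b q - b' q))) p = 0"
    using a' b b' by (intro vderiv2_levi_vanishing(2) X Y smooth_near_diff) auto
  also have "vderiv M Y (vderiv M X f) p = vderiv M Y (vderiv M (fieldT (X p)) f) p"
    using vderiv2_expand[OF X Y fS] vderiv2_expand[OF ct_fieldT[of "X p"] Y fS] df by (simp add: fieldT_at[OF Xp])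
  also have "\<dots> = vderiv M (fieldT (Y p)) (vderiv M (fieldT (X p)) f) p"
    unfolding vderiv_eq_cderiv[of M Y] vderiv_eq_cderiv[of M "fieldT (Y p)"] fieldT_at[OF Yp] ..
  also have "\<dots> = quartic (Y p) (X p) (a p) (b p)"
    by (simp add: quartic_def f_def[abs_def] a'_def b'_def)
  finally show ?thesis by simp
qed

text \<open>In the last two arguments this follows from the independence of the chosen functions, since sums and
  multiples of functions with vanishing jets have vanishing jets as well.\<close>

lemma quartic_lin:
  assumes x: "x \<in> CT M p" "x' \<in> CT M p" and y: "y \<in> CT M p" "y' \<in> CT M p"
    and a: "a \<in> levi_null" "a' \<in> levi_null" and b: "b \<in> levi_null" "b' \<in> levi_null"
  shows "quartic (x + x') y a b = quartic x y a b + quartic x' y a b"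
    "quartic (cscale c x) y a b = c * quartic x y a b"
    "quartic x (y + y') a b = quartic x y a b + quartic x y' a b"
    "quartic x (cscale c y) a b = c * quartic x y a b"
    "quartic x y (a + a') b = quartic x y a b + quartic x y a' b"
    "quartic x y (c *s a) b = c * quartic x y a b"
    "quartic x y a (b + b') = quartic x y a b + quartic x y a b'"
    "quartic x y a (c *s b) = cnj c * quartic x y a b"
proof -
  define f where "f q = levi q (jet_ext a q) (jet_ext b q)" for q
  have fS: "smooth_near M p f" unfolding f_def[abs_def] by (intro smooth_levi_p jet_ext a b)
  have df: "cderiv M f p w = 0" if "w \<in> CT M p" for w
    unfolding f_def[abs_def] using cderiv_levi_jet[OF jet_ext(1)[OF a(1)] jet_ext(1)[OF b(1)] that jet_ext(3)[OF b(1) that]] .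
  have q1: "quartic u y a b = cderiv M (vderiv M (fieldT y) f) p u" if "u \<in> CT M p" for u
    unfolding quartic_def vderiv_eq_cderiv[of M "fieldT u"] fieldT_at[OF that] f_def[abs_def] ..
  have vS: "smooth_near M p (vderiv M (fieldT y) f)"
    by (rule smooth_near_vderiv'[OF p(1) fS ct_fieldT])
  show "quartic (x + x') y a b = quartic x y a b + quartic x' y a b"
    "quartic (cscale c x) y a b = c * quartic x y a b"
    using x by (simp_all add: q1 CT_closed cderiv_add_vec[OF p(1) vS] cderiv_cscale[OF p(1) vS])
  have q2: "quartic x u a b = (\<Sum>j\<in>Basis. (complex_of_real (fst u \<bullet> j) + \<i> * complex_of_real (snd u \<bullet> j))
      * vderiv M (fieldT x) (vderiv M (fieldT (j, 0)) f) p)" if "u \<in> CT M p" for u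
    using vderiv2_expand[OF ct_fieldT[of u] ct_fieldT[of x] fS] df
    unfolding quartic_def f_def[abs_def, symmetric] fieldT_at[OF that] by blast
  show "quartic x (y + y') a b = quartic x y a b + quartic x y' a b"
    using y by (simp add: q2 CT_closed inner_add_left algebra_simps sum.distrib)
  show "quartic x (cscale c y) a b = c * quartic x y a b"
  proof -
    have "complex_of_real (fst (cscale c y) \<bullet> j) + \<i> * complex_of_real (snd (cscale c y) \<bullet> j)
      = c * (complex_of_real (fst y \<bullet> j) + \<i> * complex_of_real (snd y \<bullet> j))" for j
      by (simp add: cscale_def complex_eq_iff inner_diff_left inner_add_left)
    then show ?thesis
      using y by (simp add: q2 CT_closed sum_distrib_left mult.assoc)
  qed
  let ?V = "\<lambda>f. vderiv M (fieldT x) (vderiv M (fieldT y) f) p"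
  have Q: "quartic x y (g p) (h p) = ?V (\<lambda>q. levi q (g q) (h q))"
    if "smooth_near M p g" "g p \<in> levi_null" "smooth_near M p h" "h p \<in> levi_null" "\<forall>w\<in>CT M p. kernel_jet w h" for g h
    using vderiv2_levi_eq_quartic[OF ct_fieldT ct_fieldT that(1-4), of y x] that(5) x y by (simp add: fieldT_at)
  have V_add: "?V (\<lambda>q. g q + h q) = ?V g + ?V h" if "smooth_near M p g" "smooth_near M p h" for g h
    by (rule vderiv2_add[OF p(1) that ct_fieldT ct_fieldT])
  have V_mult: "?V (\<lambda>q. d * g q) = d * ?V g" if "smooth_near M p g" for d g
    by (rule vderiv2_cmult[OF p(1) that ct_fieldT ct_fieldT])
  have V_cong: "?V g = ?V h" if "\<And>q. q \<in> U \<Longrightarrow> g q = h q" for g h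
  proof -
    have "eventually (\<lambda>q. g q = h q) (near_in M p)"
      using near_U[OF p(2)] that by (auto elim: eventually_mono)
    then show ?thesis by (rule vderiv2_cong[OF p(1)])
  qed
  have scS: "smooth_near M p (\<lambda>q. c *s jet_ext v q)" if "v \<in> levi_null" for v
    unfolding complex_scale_J
    by (intro smooth_near_add smooth_near_scaleR smooth_near_const smooth_J jet_ext that)
  note S = jet_ext(1)[OF a(1)] jet_ext(1)[OF a(2)] jet_ext(1)[OF b(1)] jet_ext(1)[OF b(2)]
  note P = jet_ext(2)[OF a(1)] jet_ext(2)[OF a(2)] jet_ext(2)[OF b(1)] jet_ext(2)[OF b(2)]
  have "quartic x y (a + a') b = ?V (\<lambda>q. levi q (jet_ext a q + jet_ext a' q) (jet_ext b q))"
    using Q[of "\<lambda>q. jet_ext a q + jet_ext a' q" "jet_ext b"] S P a b jet_ext(3) by (simp add: smooth_near_add levi_null_closed)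
  also have "\<dots> = ?V (\<lambda>q. levi q (jet_ext a q) (jet_ext b q) + levi q (jet_ext a' q) (jet_ext b q))"
    by (rule V_cong) (simp add: levi_lin)
  also have "\<dots> = quartic x y a b + quartic x y a' b"
    unfolding quartic_def by (intro V_add smooth_levi_p S)
  finally show "quartic x y (a + a') b = quartic x y a b + quartic x y a' b" .
  have "quartic x y (c *s a) b = ?V (\<lambda>q. levi q (c *s jet_ext a q) (jet_ext b q))"
    using Q[of "\<lambda>q. c *s jet_ext a q" "jet_ext b"] S P a b jet_ext(3) scS by (simp add: levi_null_closed)
  also have "\<dots> = ?V (\<lambda>q. c * levi q (jet_ext a q) (jet_ext b q))"
    by (rule V_cong) (simp add: levi_complex_scale)
  also have "\<dots> = c * quartic x y a b"
    unfolding quartic_def by (intro V_mult smooth_levi_p S)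
  finally show "quartic x y (c *s a) b = c * quartic x y a b" .
  have "quartic x y a (b + b') = ?V (\<lambda>q. levi q (jet_ext a q) (jet_ext b q + jet_ext b' q))"
    using Q[of "jet_ext a" "\<lambda>q. jet_ext b q + jet_ext b' q"] S P a b jet_ext(3) kernel_jet_closed(2)[OF _ S(3) _ S(4)]
    by (simp add: smooth_near_add levi_null_closed)
  also have "\<dots> = ?V (\<lambda>q. levi q (jet_ext a q) (jet_ext b q) + levi q (jet_ext a q) (jet_ext b' q))"
    by (rule V_cong) (simp add: levi_lin)
  also have "\<dots> = quartic x y a b + quartic x y a b'"
    unfolding quartic_def by (intro V_add smooth_levi_p S)
  finally show "quartic x y a (b + b') = quartic x y a b + quartic x y a b'" .
  have "quartic x y a (c *s b) = ?V (\<lambda>q. levi q (jet_ext a q) (c *s jet_ext b q))"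
    using Q[of "jet_ext a" "\<lambda>q. c *s jet_ext b q"] S P a b jet_ext(3) scS kernel_jet_closed(1)[OF _ S(3)]
    by (simp add: levi_null_closed)
  also have "\<dots> = ?V (\<lambda>q. cnj c * levi q (jet_ext a q) (jet_ext b q))"
    by (rule V_cong) (simp add: levi_complex_scale)
  also have "\<dots> = cnj c * quartic x y a b"
    unfolding quartic_def by (intro V_mult smooth_levi_p S)
  finally show "quartic x y a (c *s b) = cnj c * quartic x y a b" .
qed

definition quartic_map :: "'n cxvec \<times> 'n cxvec \<times> 'n cxvec \<times> 'n cxvec \<Rightarrow> 'n cxvec set" where
  "quartic_map = restrict (\<lambda>(x4, x3, x2, x1). \<kappa> (- 2 * quartic x4 x3 (fst x2) (fst x1)))
     (CT M p \<times> CT M p \<times> K10 M p \<times> K01 M p)"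

lemma tensor4_quartic_map: "tensor4 M p (CT M p) (CT M p) (K10 M p) (K01 M p) quartic_map"
  unfolding quartic_map_def
proof (intro tensor4I)
  fix x y v w assume x: "x \<in> CT M p" and y: "y \<in> CT M p" 
  {
    assume v: "v \<in> K10 M p" and w: "w \<in> K01 M p"
    have k: "fst v \<in> levi_null" "fst w \<in> levi_null" using v w K10_iff K01_iff by auto
    show "clin_on (CT M p) (\<lambda>x. - 2 * quartic x y (fst v) (fst w))"
      using quartic_lin(1,2)[OF _ _ y y k(1,1,2,2)] by (auto simp: clin_on_def CT_closed algebra_simps)
    show "clin_on (CT M p) (\<lambda>y. - 2 * quartic x y (fst v) (fst w))"
      using quartic_lin(3,4)[OF x x _ _ k(1,1,2,2)] by (auto simp: clin_on_def CT_closed algebra_simps)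
  }
  show "clin_on (K10 M p) (\<lambda>v. - 2 * quartic x y (fst v) (fst w))" if w: "w \<in> K01 M p"
  proof -
    have k: "fst v \<in> levi_null" if "v \<in> K10 M p" for v using that K10_iff by auto
    have k': "fst w \<in> levi_null" using w K01_iff by auto
    show ?thesis
      using quartic_lin(5,6)[OF x x y y k k k' k']
      by (auto simp: clin_on_def K_closed cscale10 K_H algebra_simps)
  qed
  show "clin_on (K01 M p) (\<lambda>w. - 2 * quartic x y (fst v) (fst w))" if v: "v \<in> K10 M p"
  proof -
    have k: "fst w \<in> levi_null" if "w \<in> K01 M p" for w using that K01_iff by auto
    have k': "fst v \<in> levi_null" using v K10_iff by auto
    show ?thesis
      using quartic_lin(7,8)[OF x x y y k' k' k k]
      by (auto simp: clin_on_def K_closed cscale10 K_H algebra_simps)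
  qed
qed

text \<open>The contact coefficient comes out of both derivatives because the function it multiplies vanishes at \<open>p\<close>
  together with its derivatives along \<open>L3\<close> and \<open>L4\<close>.\<close>

theorem quartic_map_identity:
  assumes L1: "local_section M p (H10 M) (cconj \<circ> L1)" and L2: "local_section M p (H10 M) L2"
    and L3: "local_section M p (CT M) L3" and L4: "local_section M p (CT M) L4" and \<theta>: "contact_form M \<theta>"
    and k1: "kernel_jet (L3 p) (\<lambda>q. fst (L1 q))" "kernel_jet (L4 p) (\<lambda>q. fst (L1 q))"
    and k2: "fst (L2 p) \<in> levi_null"
  shows "quartic_identity M p quartic_map L4 L3 L2 L1 \<theta>"
proof -
  have L1': "local_section M p (H01 M) L1" using L1 section01_iff by blast
  have h: "L1 p \<in> H01 M p" "L2 p \<in> H10 M p" "L3 p \<in> CT M p" "L4 p \<in> CT M p"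
    using section_at L1' L2 L3 L4 by blast+
  have X: "ct_field p L3" "ct_field p L4" using L3 L4 ct_field_iff p by blast+
  have Ker1: "fst (L1 p) \<in> levi_null" using kernel_jet_levi_null[OF k1(1)] h by (simp add: H01_iff p)
  have K: "L1 p \<in> K01 M p" "L2 p \<in> K10 M p" using h k2 Ker1 by (simp_all add: K01_iff K10_iff H01_iff H10_iff p)
  have s: "smooth_near M p (\<lambda>q. fst (L1 q))" "smooth_near M p (\<lambda>q. fst (L2 q))"
    using section_fst L1' L2 by blast+
  let ?f = "\<lambda>q. levi q (fst (L2 q)) (fst (L1 q))"
  have f0: "?f p = 0" using Ker1 by (simp add: levi_null_right)
  have "vderiv M L4 (vderiv M L3 (contact_bracket M \<theta> L2 L1)) p
      = vderiv M L4 (vderiv M L3 (\<lambda>x. (2 * \<i> * contact_coeff \<theta> x) * ?f x)) p"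
    by (rule vderiv2_cong[OF p(1) contact_bracket_near[OF \<theta> L2 L1']])
  also have "\<dots> = 2 * \<i> * contact_coeff \<theta> p * vderiv M L4 (vderiv M L3 ?f) p"
    by (rule vderiv2_cmult_zero[OF p(1) X smooth_bracket_factor[OF \<theta>] smooth_levi_p[OF s(2,1)] f0
          cderiv_levi_jet[OF s(2,1) h(3) k1(1)] cderiv_levi_jet[OF s(2,1) h(4) k1(2)]])
  also have "vderiv M L4 (vderiv M L3 ?f) p = quartic (L4 p) (L3 p) (fst (L2 p)) (fst (L1 p))"
    by (rule vderiv2_levi_eq_quartic[OF X s(2) k2 s(1) Ker1 k1])
  finally show ?thesis
    using h K by (simp add: quartic_identity_def quartic_map_def CQ_pair_\<kappa>[OF \<theta>] complex_eq_iff)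
qed

theorem is_quartic_tensor_quartic_map: "is_quartic_tensor M p quartic_map"
  unfolding is_quartic_tensor_def
proof (intro conjI allI impI tensor4_quartic_map)
  fix L4 L3 L2 L1 \<theta>
  assume A: "local_section M p (H10 M) (cconj \<circ> L1) \<and> levi_kernel_order1 M p (cconj \<circ> L1) \<and>
        local_section M p (H10 M) L2 \<and> levi_kernel_order1 M p L2 \<and>
        local_section M p (CT M) L3 \<and> local_section M p (CT M) L4 \<and> contact_form M \<theta>"
  have k1: "kernel_jet v (\<lambda>q. fst (L1 q))" if "v \<in> CT M p" for v
    using order1_iff_kernel_jet[of "cconj \<circ> L1"] A that by (simp add: cconj_def)
  have k2: "kernel_jet v (\<lambda>q. fst (L2 q))" if "v \<in> CT M p" for v
    using order1_iff_kernel_jet[of L2] A that by simp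
  have "L3 p \<in> CT M p" "L4 p \<in> CT M p" "L2 p \<in> H10 M p" using A section_at by blast+
  then show "quartic_identity M p quartic_map L4 L3 L2 L1 \<theta>"
    using A by (intro quartic_map_identity k1 kernel_jet_levi_null[OF k2]) (auto simp: H10_iff p)
qed

text \<open>Every argument extends to fields as in the defining property, by \<open>kernel_field_exists\<close>, and the pairing
  with one contact form that does not vanish at \<open>p\<close> determines an element of the quotient.\<close>

theorem quartic_tensor_unique:
  assumes "is_quartic_tensor M p \<tau>" shows "\<tau> = quartic_map"
proof (rule extensionalityI[of _ "CT M p \<times> CT M p \<times> K10 M p \<times> K01 M p"])
  show "\<tau> \<in> extensional (CT M p \<times> CT M p \<times> K10 M p \<times> K01 M p)"
    using assms by (auto simp: is_quartic_tensor_def tensor4_def PiE_def)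
  show "quartic_map \<in> extensional (CT M p \<times> CT M p \<times> K10 M p \<times> K01 M p)"
    unfolding quartic_map_def by (rule restrict_extensional)
  fix t assume t: "t \<in> CT M p \<times> CT M p \<times> K10 M p \<times> K01 M p"
  obtain x4 x3 x2 x1 where x: "t = (x4, x3, x2, x1)" "x4 \<in> CT M p" "x3 \<in> CT M p" "x2 \<in> K10 M p" "x1 \<in> K01 M p"
    using t by auto
  have k: "fst x2 \<in> levi_null" "fst x1 \<in> levi_null" using x K10_iff K01_iff by auto
  let ?L2 = "field10 (jet_ext (fst x2))" and ?L1 = "cconj \<circ> field10 (jet_ext (fst x1))"
  have s: "local_section M p (H10 M) ?L2" "local_section M p (H10 M) (cconj \<circ> ?L1)"
    using field10_section jet_ext(1) k by (auto simp: o_def)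
  have kj: "kernel_jet w (\<lambda>q. fst (field10 (jet_ext a) q))" if "a \<in> levi_null" "w \<in> CT M p" for a w
  proof -
    have "eventually (\<lambda>q. levi q i (fst (field10 (jet_ext a) q)) = levi q i (jet_ext a q)) (near_in M p)" for i
      using near_U[OF p(2)] by eventually_elim (simp add: field10_def levi_hproj)
    from cderiv_cong[OF p(1) this] show ?thesis
      using jet_ext(3)[OF that] by (simp add: kernel_jet_def field10_def levi_hproj p)
  qed
  have o: "levi_kernel_order1 M p ?L2" "levi_kernel_order1 M p (cconj \<circ> ?L1)"
    using order1_iff_kernel_jet[OF s(1)] order1_iff_kernel_jet[OF s(2)] kj k by (simp_all add: o_def)
  have v: "?L2 p = x2" "?L1 p = x1"
    using K_H(1)[OF x(4)] K_H(2)[OF x(5)] k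
    by (auto simp: field10_at jet_ext(2) H10_iff H01_iff p cconj_def prod_eq_iff)
  have id: "quartic_identity M p \<sigma> (fieldT x4) (fieldT x3) ?L2 ?L1 \<theta>p" if "is_quartic_tensor M p \<sigma>" for \<sigma>
    using that s o local_section_fieldT contact_\<theta>p unfolding is_quartic_tensor_def by blast
  have "CQ_pair (\<theta>p p) (\<tau> t) = CQ_pair (\<theta>p p) (quartic_map t)"
    using id[OF assms] id[OF is_quartic_tensor_quartic_map]
    unfolding quartic_identity_def v fieldT_at[OF x(2)] fieldT_at[OF x(3)] x(1) by simp
  moreover have "\<sigma> t \<in> CQ M p" if "is_quartic_tensor M p \<sigma>" for \<sigma>
    using that t unfolding is_quartic_tensor_def tensor4_def by (blast dest: PiE_mem)
  ultimately show "\<tau> t = quartic_map t"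
    using CQ_eqI[OF _ refl] assms is_quartic_tensor_quartic_map by metis
qed

end

theorem lemma4p14:
  fixes M :: "(complex^'n) set" and p :: "complex^'n"
  assumes "smooth_real_hypersurface M" and "p \<in> M"
    and "\<forall>t \<in> CT M p \<times> K10 M p \<times> K01 M p. cubic_tensor M p t = CQ_zero M p"
  shows "(\<exists>!\<tau>. is_quartic_tensor M p \<tau>) \<and>
    (\<forall>\<tau> L4 L3 L2 L1 \<theta>. is_quartic_tensor M p \<tau> \<and>
       local_section M p (H10 M) (cconj \<circ> L1) \<and> local_section M p (H10 M) L2 \<and>
       local_section M p (CT M) L3 \<and> local_section M p (CT M) L4 \<and> contact_form M \<theta> \<and>
       (\<forall>v \<in> {L3 p, L4 p}. levi_kernel_vorder1 M p v (cconj \<circ> L1) \<and> levi_kernel_vorder1 M p v L2)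
       \<longrightarrow> quartic_identity M p \<tau> L4 L3 L2 L1 \<theta>)"
proof -
  interpret H: hypersurface M using assms(1) by unfold_locales
  obtain U \<rho> where c: "p \<in> U" "hypersurface_chart M U \<rho>" using H.chart_at assms(2) by blast
  interpret point_chart M U \<rho> p
    using c assms(2) H.hypersurface_axioms
    by (intro point_chart.intro levi_chart.intro point_chart_axioms.intro)
  interpret cubic_flat_point M U \<rho> p
  proof unfold_locales
    fix x y z assume "x \<in> CT M p" "y \<in> K10 M p" "z \<in> K01 M p"
    then have "\<kappa> (cubic x y z) = \<kappa> 0"
      using assms(3) by (force simp: cubic_tensor_eq CQ_zero_eq)
    then show "cubic x y z = 0" by simp
  qed
  show ?thesis
  proof (intro conjI ex1I allI impI)
    show "is_quartic_tensor M p quartic_map" by (rule is_quartic_tensor_quartic_map)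
    show "\<tau> = quartic_map" if "is_quartic_tensor M p \<tau>" for \<tau> by (rule quartic_tensor_unique[OF that])
    fix \<tau> L4 L3 L2 L1 \<theta>
    assume A: "is_quartic_tensor M p \<tau> \<and>
       local_section M p (H10 M) (cconj \<circ> L1) \<and> local_section M p (H10 M) L2 \<and>
       local_section M p (CT M) L3 \<and> local_section M p (CT M) L4 \<and> contact_form M \<theta> \<and>
       (\<forall>v \<in> {L3 p, L4 p}. levi_kernel_vorder1 M p v (cconj \<circ> L1) \<and> levi_kernel_vorder1 M p v L2)"
    have h: "L3 p \<in> CT M p" "L4 p \<in> CT M p" "L2 p \<in> H10 M p" using A section_at by blast+
    have k1: "kernel_jet v (\<lambda>q. fst (L1 q))" if "v \<in> {L3 p, L4 p}" for v
      using vorder1_iff_kernel_jet[of "cconj \<circ> L1" v] A that h by (auto simp: cconj_def)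
    have k2: "kernel_jet (L3 p) (\<lambda>q. fst (L2 q))"
      using vorder1_iff_kernel_jet[of L2 "L3 p"] A h by simp
    have "quartic_identity M p quartic_map L4 L3 L2 L1 \<theta>"
      using A k1 h by (intro quartic_map_identity kernel_jet_levi_null[OF k2]) (auto simp: H10_iff p)
    then show "quartic_identity M p \<tau> L4 L3 L2 L1 \<theta>"
      using A quartic_tensor_unique by metis
  qed
qed

end
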